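(* Let $\mathbb{K}$ be an algebraically closed field, let $n\ge 0$, $k\geq 1$, $d\geq 1$ be integers, and let $f_1,\dots,f_k,h_1,\dots,h_k\in\mathbb{K}[T_0,\dots,T_n]$ be nonzero homogeneous polynomials, all of degree $d$, such that the image $\overline{h_j}$ of each $h_j$ in $R=\mathbb{K}[T_0,\dots,T_n]/(f_1,\dots,f_k)$ is nonzero (in particular $h_j$ is not a scalar multiple of any $f_i$). Let $X=\{x\in\mathbb{P}^n(\mathbb{K}): f_i(x)=0 \text{ for all } 1\le i\le k\}$, let $D_+(\overline{h_j})=\{x\in X: h_j(x)\ne 0\}$, let $Q$, $V$, $W$ and the $d$-th Veronese embedding $\nu$ be as defined in the context, let $\mathbf{d}=(0,1,1)$, and let $\mathcal{E}={}^{\perp}W$ be the full subcategory of finite-dimensional $Q$-representations $Y$ with $\mathrm{Hom}_Q(Y,W)=0$, an open subcategory considered with its fully exact structure. Then Reineke's isomorphism $$\mathrm{Gr}_Q(\mathbf{d},V)\to\nu(X)\cong X,\qquad (i\colon U\rightarrowtail V)\mapsto \mathrm{Im}\, i_2,$$ restricts to an isomorphism of open subvarieties $$\mathrm{Gr}_{\mathcal{E}}(\mathbf{d},V)\to\bigcup_{j=1}^k D_+(\overline{h_j}).$$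
   Context: A variety means the $\mathbb{K}$-valued points of a reduced, separated scheme of finite type over $\mathrm{Spec}(\mathbb{K})$. Veronese embedding: $M_{n,d}=\{(m_0,\dots,m_n)\in\mathbb{N}_0^{n+1}:\sum_j m_j=d\}$, $N=|M_{n,d}|$, and $\nu\colon\mathbb{P}^n\to\mathbb{P}^{N-1}$, $[x_0:\dots:x_n]\mapsto[\cdots:x_{\mathbf{m}}:\cdots]_{\mathbf{m}\in M_{n,d}}$ with $x_{\mathbf{m}}=x_0^{m_0}\cdots x_n^{m_n}$; this is a closed embedding. Quiver: $Q$ has three vertices $1,2,3$, with $n+1$ arrows from $2$ to $3$ and $k$ arrows from $2$ to $1$. Write $f_i=\sum_{\mathbf{m}\in M_{n,d}}a^{(i)}_{\mathbf{m}}T^{\mathbf{m}}$ and $h_i=\sum_{\mathbf{m}\in M_{n,d}}b^{(i)}_{\mathbf{m}}T^{\mathbf{m}}$. Let $\{v_{\mathbf{m}}:\mathbf{m}\in M_{n,d}\}$ be the standard basis of $\mathbb{K}^{M_{n,d}}$, and similarly for $\mathbb{K}^{M_{n,d-1}}$. Let $\varphi_i,\psi_i\colon\mathbb{K}^{M_{n,d}}\to\mathbb{K}$ be the linear maps $\varphi_i(v_{\mathbf{m}})=a^{(i)}_{\mathbf{m}}$, $\psi_i(v_{\mathbf{m}})=b^{(i)}_{\mathbf{m}}$. Representation $V$: $V_1=\mathbb{K}$, $V_2=\mathbb{K}^{M_{n,d}}$, $V_3=\mathbb{K}^{M_{n,d-1}}$; the $k$ arrows $2\to1$ act by $\varphi_1,\dots,\varphi_k$;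 the $n+1$ arrows $2\to 3$ act by $g_0,\dots,g_n$, where $g_j(v_{\mathbf{m}})=v_{\mathbf{m}-\mathbf{e}_j}$ if $m_j>0$ and $g_j(v_{\mathbf{m}})=0$ if $m_j=0$ ($\mathbf{e}_j$ is the tuple with $1$ in position $j$ and $0$ elsewhere). Representation $W$: the same vector spaces and the same maps $g_j$, but the arrows $2\to1$ act by $\psi_1,\dots,\psi_k$. $\mathrm{Gr}_Q(\mathbf{d},V)$ is the variety of subrepresentations $i\colon U\rightarrowtail V$ of dimension vector $\mathbf{d}=(0,1,1)$ (with entries at vertices $1,2,3$); $i_2\colon U_2\to V_2$ is the component of $i$ at vertex $2$, and the line $\mathrm{Im}\,i_2\subset V_2=\mathbb{K}^{M_{n,d}}$ is viewed as a point of $\mathbb{P}^{N-1}$. Reineke's theorem (a known result) says that $(i\colon U\rightarrowtail V)\mapsto\mathrm{Im}\,i_2$ is an isomorphism $\mathrm{Gr}_Q(\mathbf{d},V)\to\nu(X)$; $\nu(X)$ is identified with $X$ via $\nu$. For an additively closed, extension-closed full subcategory $\mathcal{E}$ of finite-dimensional $Q$-representations and $M\in\mathcal{E}$, $\mathrm{Gr}_{\mathcal{E}}(\mathbf{d},M)$ is the set of $\mathbf{d}$-dimensional subrepresentations $U\subseteq M$ with $U\in\mathcal{E}$ and $M/U\in\mathcal{E}$. When $\mathcal{E}$ is open (i.e. for every dimension vector the representations lying in $\mathcal{E}$ form a Zariski open subset of the representation space), this is an open subvariety of $\mathrm{Gr}_Q(\mathbf{d},M)$. Here ${}^{\perp}W$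 is open, and $V$ lies in ${}^{\perp}W$. *)

theory Defs
  imports
    "HOL-Analysis.Abstract_Topology"
    "HOL-Analysis.Function_Topology"
    "HOL-Library.Poly_Mapping"
    "HOL-Algebra.QuotRing"
    "HOL-Computational_Algebra.Polynomial"
    "Graph_Theory.Digraph"
    "Jordan_Normal_Form.VS_Connect"
begin

text \<open>
  The base field is a type of class \<open>alg_closed_field\<close>; \<open>class_ring\<close> turns it
  into the carrier-based field over which vector spaces are taken.
\<close>

section \<open>Polynomials\<close>

text \<open>
  A polynomial over \<open>'k\<close> in variables indexed by \<open>'i\<close> is a finitely supported map
  from exponent vectors \<open>'i \<Rightarrow>\<^sub>0 nat\<close> to coefficients.
\<close>

type_synonym ('i, 'k) mpoly = "('i \<Rightarrow>\<^sub>0 nat) \<Rightarrow>\<^sub>0 'k"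

definition mdeg :: "('i \<Rightarrow>\<^sub>0 nat) \<Rightarrow> nat" where
  "mdeg m = (\<Sum>i\<in>Poly_Mapping.keys m. Poly_Mapping.lookup m i)"

definition monoms :: "nat \<Rightarrow> ('i \<Rightarrow>\<^sub>0 nat) set" where
  "monoms e = {m. mdeg m = e}"

definition mono_eval :: "('i \<Rightarrow>\<^sub>0 nat) \<Rightarrow> ('i \<Rightarrow> 'k::comm_ring_1) \<Rightarrow> 'k" where
  "mono_eval m x = (\<Prod>i\<in>Poly_Mapping.keys m. x i ^ Poly_Mapping.lookup m i)"

definition peval :: "('i, 'k::comm_ring_1) mpoly \<Rightarrow> ('i \<Rightarrow> 'k) \<Rightarrow> 'k" where
  "peval p x = (\<Sum>m\<in>Poly_Mapping.keys p. Poly_Mapping.lookup p m * mono_eval m x)"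

definition homogeneous :: "'i set \<Rightarrow> nat \<Rightarrow> ('i, 'k::zero) mpoly \<Rightarrow> bool" where
  "homogeneous I e p \<longleftrightarrow>
     (\<forall>m\<in>Poly_Mapping.keys p. Poly_Mapping.keys m \<subseteq> I \<and> mdeg m = e)"

definition gens_ideal :: "('r \<Rightarrow> ('n, 'k::field) mpoly) \<Rightarrow> ('n, 'k) mpoly set" where
  "gens_ideal f = Idl\<^bsub>class_ring\<^esub> (range f)"

definition coord_ring :: "('r \<Rightarrow> ('n, 'k::field) mpoly) \<Rightarrow> ('n, 'k) mpoly set ring" where
  "coord_ring f = class_ring Quot (gens_ideal f)"

definition coord_class :: "('r \<Rightarrow> ('n, 'k::field) mpoly) \<Rightarrow> ('n, 'k) mpoly \<Rightarrow> ('n, 'k) mpoly set" where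
  "coord_class f p = gens_ideal f +>\<^bsub>class_ring\<^esub> p"


section \<open>Varieties as spaces with functions\<close>

text \<open>
  A variety over an algebraically closed field is its set of points with the Zariski
  topology and the sheaf of regular \<open>'k\<close>-valued functions. Only the values of
  members of \<open>kreg X U\<close> on the open set \<open>U\<close> are meaningful.
\<close>

record ('a, 'k) kspace =
  ktop :: "'a topology"
  kreg :: "'a set \<Rightarrow> ('a \<Rightarrow> 'k) set"

definition variety_morphism :: "('a, 'k) kspace \<Rightarrow> ('b, 'k) kspace \<Rightarrow> ('a \<Rightarrow> 'b) \<Rightarrow> bool" where
  "variety_morphism X Y f \<longleftrightarrow> continuous_map (ktop X) (ktop Y) f \<and>
     (\<forall>U r. openin (ktop Y) U \<longrightarrow> r \<in> kreg Y U \<longrightarrow>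
        r \<circ> f \<in> kreg X {x \<in> topspace (ktop X). f x \<in> U})"

definition variety_iso :: "('a, 'k) kspace \<Rightarrow> ('b, 'k) kspace \<Rightarrow> ('a \<Rightarrow> 'b) \<Rightarrow> bool" where
  "variety_iso X Y f \<longleftrightarrow> variety_morphism X Y f \<and>
     (\<exists>g. variety_morphism Y X g \<and>
        (\<forall>x\<in>topspace (ktop X). g (f x) = x) \<and> (\<forall>y\<in>topspace (ktop Y). f (g y) = y))"

text \<open>
  The reduced structure on a locally closed subset: regular functions are locally
  restrictions of regular functions on the ambient space.
\<close>

definition sub_kspace :: "('a, 'k) kspace \<Rightarrow> 'a set \<Rightarrow> ('a, 'k) kspace" where
  "sub_kspace X S = \<lparr>
     ktop = subtopology (ktop X) S,
     kreg = (\<lambda>U. {r. \<forall>x\<in>U. \<exists>N R. openin (ktop X) N \<and> x \<in> N \<and> N \<inter> S \<subseteq> U \<and>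
                        R \<in> kreg X N \<and> (\<forall>y\<in>N \<inter> S. r y = R y)})\<rparr>"

text \<open>
  A (locally closed) subset \<open>S\<close> of affine space, with \<open>A\<close> the algebra of polynomial functions.
\<close>

definition affine_kspace :: "'a set \<Rightarrow> ('a \<Rightarrow> 'k::field) set \<Rightarrow> ('a, 'k) kspace" where
  "affine_kspace S A = (let T = topology_generated_by {{x \<in> S. p x \<noteq> 0} | p. p \<in> A} in \<lparr>
     ktop = T,
     kreg = (\<lambda>U. {r. \<forall>x\<in>U. \<exists>N p q. openin T N \<and> x \<in> N \<and> N \<subseteq> U \<and> p \<in> A \<and> q \<in> A \<and>
                        (\<forall>y\<in>N. q y \<noteq> 0 \<and> r y = p y / q y)})\<rparr>)"

definition quotient_topology :: "'a topology \<Rightarrow> ('a \<Rightarrow> 'b) \<Rightarrow> 'b topology" where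
  "quotient_topology X f =
     topology (\<lambda>U. U \<subseteq> f ` topspace X \<and> openin X {x \<in> topspace X. f x \<in> U})"

lemma openin_quotient_topology:
  "openin (quotient_topology X f) U \<longleftrightarrow>
     U \<subseteq> f ` topspace X \<and> openin X {x \<in> topspace X. f x \<in> U}"
proof -
  have "istopology (\<lambda>U. U \<subseteq> f ` topspace X \<and> openin X {x \<in> topspace X. f x \<in> U})"
  proof (unfold istopology_def, intro conjI allI impI)
    fix S T
    assume S: "S \<subseteq> f ` topspace X \<and> openin X {x \<in> topspace X. f x \<in> S}"
      and T: "T \<subseteq> f ` topspace X \<and> openin X {x \<in> topspace X. f x \<in> T}"
    have "{x \<in> topspace X. f x \<in> S \<inter> T} =
        {x \<in> topspace X. f x \<in> S} \<inter> {x \<in> topspace X. f x \<in> T}"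
      by blast
    then show "openin X {x \<in> topspace X. f x \<in> S \<inter> T}"
      using S T by (simp only: openin_Int)
    show "S \<inter> T \<subseteq> f ` topspace X"
      using S by blast
  next
    fix K
    assume K: "\<forall>S\<in>K. S \<subseteq> f ` topspace X \<and> openin X {x \<in> topspace X. f x \<in> S}"
    have "{x \<in> topspace X. f x \<in> \<Union>K} = (\<Union>S\<in>K. {x \<in> topspace X. f x \<in> S})"
      by blast
    then show "openin X {x \<in> topspace X. f x \<in> \<Union>K}"
      using K by (simp only:) (blast intro: openin_Union)
    show "\<Union>K \<subseteq> f ` topspace X"
      using K by blast
  qed
  then show ?thesis
    by (simp add: quotient_topology_def topology_inverse')
qed

lemma topspace_quotient_topology: "topspace (quotient_topology X f) = f ` topspace X"
proof
  show "topspace (quotient_topology X f) \<subseteq> f ` topspace X"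
    by (metis openin_quotient_topology openin_topspace)
  have "{x \<in> topspace X. f x \<in> f ` topspace X} = topspace X"
    by blast
  then have "openin (quotient_topology X f) (f ` topspace X)"
    by (simp add: openin_quotient_topology)
  then show "f ` topspace X \<subseteq> topspace (quotient_topology X f)"
    by (rule openin_subset)
qed

lemma quotient_map_quotient_topology: "quotient_map X (quotient_topology X f) f"
  by (auto simp: quotient_map_def topspace_quotient_topology openin_quotient_topology)

definition quotient_kspace :: "('a, 'k) kspace \<Rightarrow> ('a \<Rightarrow> 'b) \<Rightarrow> ('b, 'k) kspace" where
  "quotient_kspace X f = \<lparr>
     ktop = quotient_topology (ktop X) f,
     kreg = (\<lambda>U. {r. r \<circ> f \<in> kreg X {x \<in> topspace (ktop X). f x \<in> U}})\<rparr>"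


section \<open>Projective space\<close>

abbreviation func_vs :: "'i set \<Rightarrow> ('k::field, 'i \<Rightarrow> 'k) module" where
  "func_vs I \<equiv> ring.func_space class_ring I"

abbreviation sub_dim :: "('k::field, 'v) module \<Rightarrow> 'v set \<Rightarrow> nat" where
  "sub_dim V U \<equiv> vectorspace.dim class_ring (V\<lparr>carrier := U\<rparr>)"

text \<open>Points of the projective space of \<open>K\<^sup>I\<close> are the lines of \<open>K\<^sup>I\<close> through the origin.\<close>

definition proj_points :: "'i set \<Rightarrow> ('i \<Rightarrow> 'k::field) set set" where
  "proj_points I = {L. VectorSpace.subspace class_ring L (func_vs I) \<and> sub_dim (func_vs I) L = 1}"

definition nonzeros :: "'i set \<Rightarrow> ('i \<Rightarrow> 'k::field) set \<Rightarrow> ('i \<Rightarrow> 'k) set" where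
  "nonzeros I L = L - {\<zero>\<^bsub>func_vs I\<^esub>}"

definition proj_nonvanishing :: "'i set \<Rightarrow> ('i, 'k::field) mpoly \<Rightarrow> ('i \<Rightarrow> 'k) set set" where
  "proj_nonvanishing I F = {L \<in> proj_points I. \<forall>x\<in>nonzeros I L. peval F x \<noteq> 0}"

definition proj_space :: "'i set \<Rightarrow> (('i \<Rightarrow> 'k::field) set, 'k) kspace" where
  "proj_space I =
     (let T = topology_generated_by {proj_nonvanishing I F | F e. homogeneous I e F} in \<lparr>
        ktop = T,
        kreg = (\<lambda>U. {r. \<forall>L\<in>U. \<exists>N e F G. openin T N \<and> L \<in> N \<and> N \<subseteq> U \<and>
                  homogeneous I e F \<and> homogeneous I e G \<and>
                  (\<forall>L'\<in>N. \<forall>x\<in>nonzeros I L'. peval G x \<noteq> 0 \<and> r L' = peval F x / peval G x)})\<rparr>)"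

text \<open>
  As \<open>(t x)\<^sub>m = t\<^sup>e x\<^sub>m\<close>, the set below is the line spanned by \<open>(x\<^sub>m)\<^sub>m\<close> for any nonzero \<open>x \<in> L\<close>.
\<close>

definition veronese :: "nat \<Rightarrow> ('n \<Rightarrow> 'k::field) set \<Rightarrow> (('n \<Rightarrow>\<^sub>0 nat) \<Rightarrow> 'k) set" where
  "veronese e L = {(\<lambda>m\<in>monoms e. c * mono_eval m x) | c x. x \<in> L}"

definition proj_zeros :: "('r \<Rightarrow> ('n, 'k::field) mpoly) \<Rightarrow> ('n \<Rightarrow> 'k) set set" where
  "proj_zeros f = {L \<in> proj_points UNIV. \<forall>i. \<forall>x\<in>L. peval (f i) x = 0}"

definition D_plus :: "('r \<Rightarrow> ('n, 'k::field) mpoly) \<Rightarrow> ('n, 'k) mpoly \<Rightarrow> ('n \<Rightarrow> 'k) set set" where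
  "D_plus f p = {L \<in> proj_zeros f. \<forall>x\<in>nonzeros UNIV L. peval p x \<noteq> 0}"


section \<open>Quiver representations\<close>

text \<open>Quivers are \<open>pre_digraph\<close>s: arrow \<open>a\<close> goes from \<open>tail Q a\<close> to \<open>head Q a\<close>.\<close>

record ('q, 'a, 'k, 'v) qrep =
  vsp :: "'q \<Rightarrow> ('k, 'v) module"
  act :: "'a \<Rightarrow> 'v \<Rightarrow> 'v"

definition is_rep :: "('q, 'a) pre_digraph \<Rightarrow> ('q, 'a, 'k::field, 'v) qrep \<Rightarrow> bool" where
  "is_rep Q M \<longleftrightarrow>
     (\<forall>i\<in>verts Q. vectorspace class_ring (vsp M i) \<and> vectorspace.fin_dim class_ring (vsp M i)) \<and>
     (\<forall>a\<in>arcs Q. act M a \<in> module_hom class_ring (vsp M (tail Q a)) (vsp M (head Q a)))"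

definition rep_hom :: "('q, 'a) pre_digraph \<Rightarrow> ('q, 'a, 'k::field, 'v) qrep \<Rightarrow>
    ('q, 'a, 'k, 'w) qrep \<Rightarrow> ('q \<Rightarrow> 'v \<Rightarrow> 'w) set" where
  "rep_hom Q M N = {\<eta>.
     (\<forall>i\<in>verts Q. \<eta> i \<in> module_hom class_ring (vsp M i) (vsp N i)) \<and>
     (\<forall>a\<in>arcs Q. \<forall>x\<in>carrier (vsp M (tail Q a)).
        \<eta> (head Q a) (act M a x) = act N a (\<eta> (tail Q a) x))}"

definition left_perp :: "('q, 'a) pre_digraph \<Rightarrow> ('q, 'a, 'k::field, 'w) qrep \<Rightarrow>
    ('q, 'a, 'k, 'v) qrep set" where
  "left_perp Q W = {Y. is_rep Q Y \<and>
     (\<forall>\<eta>\<in>rep_hom Q Y W. \<forall>i\<in>verts Q. \<forall>x\<in>carrier (vsp Y i). \<eta> i x = \<zero>\<^bsub>vsp W i\<^esub>)}"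

definition subreps :: "('q, 'a) pre_digraph \<Rightarrow> ('q, 'a, 'k::field, 'v) qrep \<Rightarrow> ('q \<Rightarrow> 'v set) set" where
  "subreps Q M = {U \<in> extensional (verts Q).
     (\<forall>i\<in>verts Q. VectorSpace.subspace class_ring (U i) (vsp M i)) \<and>
     (\<forall>a\<in>arcs Q. act M a ` U (tail Q a) \<subseteq> U (head Q a))}"

definition sub_rep :: "('q, 'a, 'k, 'v) qrep \<Rightarrow> ('q \<Rightarrow> 'v set) \<Rightarrow> ('q, 'a, 'k, 'v) qrep" where
  "sub_rep M U = \<lparr>vsp = (\<lambda>i. (vsp M i)\<lparr>carrier := U i\<rparr>), act = act M\<rparr>"

text \<open>
  The record type \<open>module\<close> extends \<open>ring\<close>, but the fields \<open>mult\<close> and \<open>one\<close> play no role in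
  the locale \<open>module\<close> and are filled arbitrarily.
\<close>

definition quot_module :: "('k, 'v) module \<Rightarrow> 'v set \<Rightarrow> ('k, 'v set) module" where
  "quot_module V U = \<lparr>
     carrier = a_rcosets\<^bsub>V\<^esub> U,
     mult = (\<lambda>_ _. U),
     one = U,
     zero = U,
     add = (\<lambda>A B. A <+>\<^bsub>V\<^esub> B),
     smult = (\<lambda>c A. \<Union>x\<in>A. U +>\<^bsub>V\<^esub> (c \<odot>\<^bsub>V\<^esub> x))\<rparr>"

definition quot_rep :: "('q, 'a) pre_digraph \<Rightarrow> ('q, 'a, 'k, 'v) qrep \<Rightarrow> ('q \<Rightarrow> 'v set) \<Rightarrow>
    ('q, 'a, 'k, 'v set) qrep" where
  "quot_rep Q M U = \<lparr>
     vsp = (\<lambda>i. quot_module (vsp M i) (U i)),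
     act = (\<lambda>a A. \<Union>x\<in>A. U (head Q a) +>\<^bsub>vsp M (head Q a)\<^esub> act M a x)\<rparr>"


section \<open>Quiver Grassmannians\<close>

definition Gr_points :: "('q, 'a) pre_digraph \<Rightarrow> ('q \<Rightarrow> nat) \<Rightarrow> ('q, 'a, 'k::field, 'v) qrep \<Rightarrow>
    ('q \<Rightarrow> 'v set) set" where
  "Gr_points Q dv M = {U \<in> subreps Q M. \<forall>i\<in>verts Q. sub_dim (vsp M i) (U i) = dv i}"

text \<open>
  A subcategory \<open>\<E>\<close> has to be given twice, since \<open>U\<close> and \<open>M / U\<close> have vectors of different
  types \<open>'v\<close> and \<open>'v set\<close>: \<open>E\<close> and \<open>E'\<close> are the classes of objects of \<open>\<E>\<close> of these types.
\<close>

definition Gr_in_points :: "('q, 'a) pre_digraph \<Rightarrow> ('q, 'a, 'k::field, 'v) qrep set \<Rightarrow>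
    ('q, 'a, 'k, 'v set) qrep set \<Rightarrow> ('q \<Rightarrow> nat) \<Rightarrow> ('q, 'a, 'k, 'v) qrep \<Rightarrow> ('q \<Rightarrow> 'v set) set" where
  "Gr_in_points Q E E' dv M = {U \<in> Gr_points Q dv M. sub_rep M U \<in> E \<and> quot_rep Q M U \<in> E'}"

text \<open>
  The product of the Grassmannians \<open>Gr(dv i, V i)\<close>, \<open>i \<in> I\<close>, is the geometric quotient of the
  space of frames, that is of families of \<open>dv i\<close> linearly independent vectors in each \<open>V i\<close>,
  by the product of the groups \<open>GL\<^bsub>dv i\<^esub>\<close>; the quotient map sends a frame to its spans.
  Frames form an open subset of an affine space, with polynomial functions generated by the
  linear functionals applied to single frame vectors. (A family of \<open>dv i\<close> vectors is independent
  iff its span has dimension \<open>dv i\<close>.)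
\<close>

definition scalars :: "('k::field, 'k) module" where
  "scalars = \<lparr>carrier = UNIV, mult = (*), one = 1, zero = 0, add = (+), smult = (*)\<rparr>"

definition frame_span :: "'q set \<Rightarrow> ('q \<Rightarrow> ('k::field, 'v) module) \<Rightarrow> ('q \<Rightarrow> nat) \<Rightarrow>
    ('q \<Rightarrow> nat \<Rightarrow> 'v) \<Rightarrow> 'q \<Rightarrow> 'v set" where
  "frame_span I V dv b = (\<lambda>i\<in>I. LinearCombinations.module.span class_ring (V i) (b i ` {..<dv i}))"

definition frames :: "'q set \<Rightarrow> ('q \<Rightarrow> ('k::field, 'v) module) \<Rightarrow> ('q \<Rightarrow> nat) \<Rightarrow>
    ('q \<Rightarrow> nat \<Rightarrow> 'v) set" where
  "frames I V dv = {b \<in> (\<Pi>\<^sub>E i\<in>I. {..<dv i} \<rightarrow>\<^sub>E carrier (V i)).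
     \<forall>i\<in>I. sub_dim (V i) (frame_span I V dv b i) = dv i}"

inductive_set frame_polys :: "'q set \<Rightarrow> ('q \<Rightarrow> ('k::field, 'v) module) \<Rightarrow> ('q \<Rightarrow> nat) \<Rightarrow>
    (('q \<Rightarrow> nat \<Rightarrow> 'v) \<Rightarrow> 'k) set"
  for I V dv where
  const: "(\<lambda>_. c) \<in> frame_polys I V dv"
| functional: "i \<in> I \<Longrightarrow> l < dv i \<Longrightarrow> \<xi> \<in> module_hom class_ring (V i) scalars \<Longrightarrow>
    (\<lambda>b. \<xi> (b i l)) \<in> frame_polys I V dv"
| add: "p \<in> frame_polys I V dv \<Longrightarrow> q \<in> frame_polys I V dv \<Longrightarrow> (\<lambda>b. p b + q b) \<in> frame_polys I V dv"
| mult: "p \<in> frame_polys I V dv \<Longrightarrow> q \<in> frame_polys I V dv \<Longrightarrow> (\<lambda>b. p b * q b) \<in> frame_polys I V dv"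

definition Gr_prod :: "'q set \<Rightarrow> ('q \<Rightarrow> ('k::field, 'v) module) \<Rightarrow> ('q \<Rightarrow> nat) \<Rightarrow>
    ('q \<Rightarrow> 'v set, 'k) kspace" where
  "Gr_prod I V dv =
     quotient_kspace (affine_kspace (frames I V dv) (frame_polys I V dv)) (frame_span I V dv)"

definition Gr_var :: "('q, 'a) pre_digraph \<Rightarrow> ('q \<Rightarrow> nat) \<Rightarrow> ('q, 'a, 'k::field, 'v) qrep \<Rightarrow>
    ('q \<Rightarrow> 'v set, 'k) kspace" where
  "Gr_var Q dv M = sub_kspace (Gr_prod (verts Q) (vsp M) dv) (Gr_points Q dv M)"


section \<open>Reineke's quiver and representations\<close>

text \<open>The variables \<open>T\<^sub>0, \<dots>, T\<^sub>n\<close> are indexed by \<open>'n\<close> and the polynomials by \<open>'r\<close>.\<close>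

definition reineke_quiver :: "(nat, 'n + 'r) pre_digraph" where
  "reineke_quiver = \<lparr>verts = {1, 2, 3}, arcs = UNIV,
     tail = (\<lambda>_. 2), head = (\<lambda>a. case a of Inl _ \<Rightarrow> 3 | Inr _ \<Rightarrow> 1)\<rparr>"

text \<open>The linear map \<open>K\<^sup>A \<rightarrow> K\<^sup>B\<close> that sends the \<open>m\<close>-th standard basis vector to \<open>w m\<close>.\<close>

definition lin_ext :: "'i set \<Rightarrow> 'j set \<Rightarrow> ('i \<Rightarrow> 'j \<Rightarrow> 'k::field) \<Rightarrow> ('i \<Rightarrow> 'k) \<Rightarrow> 'j \<Rightarrow> 'k" where
  "lin_ext A B w x = (\<lambda>m'\<in>B. \<Sum>m\<in>A. x m * w m m')"

text \<open>
  All vertices carry vectors of the same type; \<open>V\<^sub>1 = K\<close> is realized as \<open>K\<^bsup>{0}\<^esup>\<close>.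
\<close>

definition reineke_rep :: "nat \<Rightarrow> ('r \<Rightarrow> ('n, 'k::field) mpoly) \<Rightarrow>
    (nat, 'n + 'r, 'k, ('n \<Rightarrow>\<^sub>0 nat) \<Rightarrow> 'k) qrep" where
  "reineke_rep d f = \<lparr>
     vsp = (\<lambda>i. func_vs (if i = 1 then {0} else if i = 2 then monoms d else monoms (d - 1))),
     act = (\<lambda>a. case a of
         Inl j \<Rightarrow> lin_ext (monoms d) (monoms (d - 1))
           (\<lambda>m. if Poly_Mapping.lookup m j > 0
                then (\<lambda>m'. of_bool (m' = m - Poly_Mapping.single j 1)) else (\<lambda>_. 0))
       | Inr i \<Rightarrow> lin_ext (monoms d) {0} (\<lambda>m _. Poly_Mapping.lookup (f i) m))\<rparr>"

definition dim_011 :: "nat \<Rightarrow> nat" where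
  "dim_011 = (\<lambda>_. 0)(2 := 1, 3 := 1)"

end

theory Submission
  imports Defs
begin

text \<open>
  Write \<open>\<nu>\<^sub>e(x)\<close> for the vector of all monomials of degree \<open>e\<close> at \<open>x\<close>. A subrepresentation of
  \<open>V\<close> of dimension \<open>(0, 1, 1)\<close> consists of a line \<open>K u\<close> in degree \<open>d\<close> and a line \<open>K w\<close> in degree
  \<open>d - 1\<close> with \<open>\<phi>\<^sub>i(u) = 0\<close> and \<open>g\<^sub>j(u) = y\<^sub>j w\<close> for scalars \<open>y\<^sub>j\<close>. The second condition means that the
  catalecticant matrix of \<open>u\<close> has rank one, which forces \<open>u\<close> and \<open>w\<close> to be multiples of \<open>\<nu>\<^sub>d(y)\<close>
  and \<open>\<nu>\<^bsub>d-1\<^esub>(y)\<close> (\<open>rank_one_catalecticant\<close>); the first one then says \<open>f\<^sub>i(y) = 0\<close>. So the points of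
  the quiver Grassmannian are exactly the \<open>veronese_subrep d L\<close> with \<open>L \<in> X\<close>
  (\<open>Gr_points_reineke_rep\<close>).

  Three morphisms make this an isomorphism of varieties. \<open>A\<close> sends a point \<open>L\<close> of projective
  space to \<open>veronese_subrep d L\<close>, \<open>B\<close> sends \<open>U\<close> to its line at vertex 2, and \<open>D\<close> is the
  inverse of the Veronese embedding \<open>B \<circ> A\<close>. On the chart where the coordinate at the monomial
  \<open>T\<^sub>i\<^sup>d\<close> does not vanish, \<open>D\<close> is the linear map that reads off the coordinates at the
  \<open>T\<^sub>i\<^bsup>d-1\<^esup>T\<^sub>j\<close>. For \<open>B\<close> and \<open>D\<close>, forms pull back to polynomials of the required kind. For \<open>A\<close> they do not:
  open sets and regular functions on the Grassmannian are given by arbitrary polynomials in frame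
  vectors, which pull back to inhomogeneous polynomials. Restricted to a line through the origin
  these are polynomials in one variable \<open>t\<close>, and since the field is infinite one may pass to
  homogeneous components by comparing coefficients
  (\<open>variety_morphism_proj_space_to_quotient\<close>).

  It remains to see which \<open>U\<close> lie in \<open>Gr\<^sub>\<E>\<close>. A homomorphism \<open>V \<rightarrow> W\<close> commutes with all \<open>g\<^sub>j\<close>, so it
  is a scalar \<open>\<mu>\<close> at vertex 2 (\<open>contraction_equivariant_matrix_scalar\<close>), and with the scalar \<open>\<lambda>\<close>
  at vertex 1 one gets \<open>\<lambda> f\<^sub>i = \<mu> h\<^sub>i\<close>. As \<open>h\<^sub>i\<close> is not in the ideal of the \<open>f\<^sub>i\<close> and \<open>f\<^sub>i \<noteq> 0\<close>, both
  scalars vanish and \<open>Hom(V, W) = 0\<close> (\<open>reineke_rep_in_left_perp\<close>). Hence \<open>Hom(V/U, W) = 0\<close> for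
  every \<open>U\<close>. A homomorphism from \<open>U = (0, K \<nu>\<^sub>d(x), K \<nu>\<^bsub>d-1\<^esub>(x))\<close> to \<open>W\<close> is again multiplication by
  some \<open>c\<close>, by the rank one argument, and \<open>c\<close> can be nonzero precisely if all \<open>h\<^sub>j\<close> vanish
  at \<open>x\<close> (\<open>veronese_subrep_in_left_perp_iff\<close>). So \<open>Gr\<^sub>\<E>\<close> corresponds to the union of the
  \<open>D\<^sub>+(h\<^sub>j)\<close>, and the isomorphism restricts.
\<close>

section \<open>Spaces with functions\<close>

text \<open>
  The inverse of the Veronese embedding is given by different formulas on different charts, each of
  which makes sense on an open subset \<open>N\<close> of the ambient projective space.
\<close>

definition local_morphism :: "('a, 'k) kspace \<Rightarrow> ('b, 'k) kspace \<Rightarrow> 'a set \<Rightarrow> ('a \<Rightarrow> 'b) \<Rightarrow> bool" where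
  "local_morphism X Y N F \<longleftrightarrow> openin (ktop X) N \<and>
     (\<forall>U. openin (ktop Y) U \<longrightarrow> openin (ktop X) {x \<in> N. F x \<in> U}) \<and>
     (\<forall>U r. openin (ktop Y) U \<longrightarrow> r \<in> kreg Y U \<longrightarrow> r \<circ> F \<in> kreg X {x \<in> N. F x \<in> U})"

lemma variety_morphism_iff_local:
  "variety_morphism X Y f \<longleftrightarrow>
     f ` topspace (ktop X) \<subseteq> topspace (ktop Y) \<and> local_morphism X Y (topspace (ktop X)) f"
  unfolding variety_morphism_def local_morphism_def continuous_map_def by auto

lemma topspace_sub_kspace: "topspace (ktop (sub_kspace X S)) = topspace (ktop X) \<inter> S"
  by (simp add: sub_kspace_def)

lemma variety_morphism_comp:
  assumes f: "variety_morphism X Y f" and g: "variety_morphism Y Z g"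
  shows "variety_morphism X Z (g \<circ> f)"
  unfolding variety_morphism_def
proof (intro conjI allI impI)
  show "continuous_map (ktop X) (ktop Z) (g \<circ> f)"
    using f g unfolding variety_morphism_def by (blast intro: continuous_map_compose)
next
  fix U r
  assume U: "openin (ktop Z) U" and r: "r \<in> kreg Z U"
  have fim: "\<And>x. x \<in> topspace (ktop X) \<Longrightarrow> f x \<in> topspace (ktop Y)"
    using f unfolding variety_morphism_def continuous_map_def by auto
  have op: "openin (ktop Y) {y \<in> topspace (ktop Y). g y \<in> U}"
    using g U unfolding variety_morphism_def continuous_map_def by auto
  have "r \<circ> g \<in> kreg Y {y \<in> topspace (ktop Y). g y \<in> U}"
    using g U r unfolding variety_morphism_def by auto
  then have "(r \<circ> g) \<circ> f \<in> kreg X {x \<in> topspace (ktop X). f x \<in> {y \<in> topspace (ktop Y). g y \<in> U}}"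
    using f op unfolding variety_morphism_def by blast
  moreover have "{x \<in> topspace (ktop X). f x \<in> {y \<in> topspace (ktop Y). g y \<in> U}} =
      {x \<in> topspace (ktop X). (g \<circ> f) x \<in> U}"
    using fim by auto
  ultimately show "r \<circ> (g \<circ> f) \<in> kreg X {x \<in> topspace (ktop X). (g \<circ> f) x \<in> U}"
    by (simp add: comp_assoc)
qed

text \<open>
  Continuity is local on the source, and regular functions on a subset are local restrictions of
  ambient ones. So it is enough to extend the map to an ambient neighbourhood of each point,
  with an extension that may depend on the point.
\<close>

lemma variety_morphism_sub_kspace_local:
  assumes im: "f ` (topspace (ktop X) \<inter> A) \<subseteq> topspace (ktop Y) \<inter> B"
    and loc: "\<And>x. x \<in> topspace (ktop X) \<inter> A \<Longrightarrow>
      \<exists>N F. x \<in> N \<and> local_morphism X Y N F \<and> (\<forall>y\<in>N \<inter> A. f y = F y)"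
  shows "variety_morphism (sub_kspace X A) (sub_kspace Y B) f"
  unfolding variety_morphism_def
proof (intro conjI allI impI)
  have "openin (ktop (sub_kspace X A)) {x \<in> topspace (ktop X) \<inter> A. f x \<in> U}"
    if "openin (ktop (sub_kspace Y B)) U" for U
  proof -
    obtain T where T: "openin (ktop Y) T" and U: "U = T \<inter> B"
      using \<open>openin (ktop (sub_kspace Y B)) U\<close>
      by (auto simp: sub_kspace_def openin_subtopology)
    show ?thesis
    proof (subst openin_subopen, intro ballI)
      fix x assume x: "x \<in> {x \<in> topspace (ktop X) \<inter> A. f x \<in> U}"
      then obtain N F where N: "x \<in> N" "local_morphism X Y N F" "\<forall>y\<in>N \<inter> A. f y = F y"
        using loc by blast
      let ?W = "{y \<in> N. F y \<in> T}"
      have W: "openin (ktop X) ?W"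
        using N(2) T unfolding local_morphism_def by blast
      have "openin (ktop (sub_kspace X A)) (?W \<inter> A)"
        using W by (auto simp: sub_kspace_def openin_subtopology)
      moreover have "x \<in> ?W \<inter> A" using x N U by auto
      moreover have "?W \<inter> A \<subseteq> {x \<in> topspace (ktop X) \<inter> A. f x \<in> U}"
      proof
        fix y assume y: "y \<in> ?W \<inter> A"
        then have "f y = F y" "y \<in> topspace (ktop X)" using N(3) openin_subset[OF W] by auto
        moreover from this have "f y \<in> B" using im y by auto
        ultimately show "y \<in> {x \<in> topspace (ktop X) \<inter> A. f x \<in> U}" using y U by auto
      qed
      ultimately show "\<exists>T. openin (ktop (sub_kspace X A)) T \<and> x \<in> T \<and>
          T \<subseteq> {x \<in> topspace (ktop X) \<inter> A. f x \<in> U}" by blast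
    qed
  qed
  with im show "continuous_map (ktop (sub_kspace X A)) (ktop (sub_kspace Y B)) f"
    by (auto simp: continuous_map_def topspace_sub_kspace)
next
  fix U r
  assume U: "openin (ktop (sub_kspace Y B)) U" and r: "r \<in> kreg (sub_kspace Y B) U"
  let ?P = "{x \<in> topspace (ktop (sub_kspace X A)). f x \<in> U}"
  show "r \<circ> f \<in> kreg (sub_kspace X A) ?P"
    unfolding sub_kspace_def kspace.simps mem_Collect_eq
  proof (intro ballI)
    fix x assume "x \<in> {x \<in> topspace (subtopology (ktop X) A). f x \<in> U}"
    then have x: "x \<in> topspace (ktop X)" "x \<in> A" "f x \<in> U" by auto
    obtain M R where M: "openin (ktop Y) M" "f x \<in> M" "M \<inter> B \<subseteq> U" "R \<in> kreg Y M"
        "\<forall>y\<in>M \<inter> B. r y = R y"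
      using r x(3) unfolding sub_kspace_def by auto
    obtain N F where N: "x \<in> N" "local_morphism X Y N F" "\<forall>y\<in>N \<inter> A. f y = F y"
      using loc x by blast
    let ?W = "{y \<in> N. F y \<in> M}"
    have W: "openin (ktop X) ?W"
      using N(2) M(1) unfolding local_morphism_def by blast
    have "R \<circ> F \<in> kreg X ?W"
      using N(2) M(1,4) unfolding local_morphism_def by blast
    moreover have "x \<in> ?W" using N M x by auto
    moreover have "?W \<inter> A \<subseteq> {x \<in> topspace (subtopology (ktop X) A). f x \<in> U}"
    proof
      fix y assume y: "y \<in> ?W \<inter> A"
      then have "f y = F y" "y \<in> topspace (ktop X)" using N(3) openin_subset[OF W] by auto
      moreover from this have "f y \<in> B" using im y by auto
      ultimately show "y \<in> {x \<in> topspace (subtopology (ktop X) A). f x \<in> U}" using y M(3) by auto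
    qed
    moreover have "\<forall>y\<in>?W \<inter> A. (r \<circ> f) y = (R \<circ> F) y"
    proof
      fix y assume y: "y \<in> ?W \<inter> A"
      then have "f y = F y" "y \<in> topspace (ktop X)" using N(3) openin_subset[OF W] by auto
      moreover from this have "f y \<in> B" using im y by auto
      ultimately have "f y = F y" "f y \<in> B" by auto
      then show "(r \<circ> f) y = (R \<circ> F) y" using M(5) y by auto
    qed
    ultimately show "\<exists>N R. openin (ktop X) N \<and> x \<in> N \<and>
        N \<inter> A \<subseteq> {x \<in> topspace (subtopology (ktop X) A). f x \<in> U} \<and>
        R \<in> kreg X N \<and> (\<forall>y\<in>N \<inter> A. (r \<circ> f) y = R y)"
      using W by blast
  qed
qed

lemma variety_morphism_sub_kspace:
  assumes f: "variety_morphism X Y f" and "f ` (topspace (ktop X) \<inter> A) \<subseteq> B"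
  shows "variety_morphism (sub_kspace X A) (sub_kspace Y B) f"
proof (rule variety_morphism_sub_kspace_local)
  show "f ` (topspace (ktop X) \<inter> A) \<subseteq> topspace (ktop Y) \<inter> B"
    using assms by (auto simp: variety_morphism_iff_local)
  show "\<exists>N F. x \<in> N \<and> local_morphism X Y N F \<and> (\<forall>y\<in>N \<inter> A. f y = F y)"
    if "x \<in> topspace (ktop X) \<inter> A" for x
    using that f unfolding variety_morphism_iff_local by blast
qed

lemma variety_isoI:
  assumes "variety_morphism X Y f" "variety_morphism Y X g"
    and "\<And>x. x \<in> topspace (ktop X) \<Longrightarrow> g (f x) = x"
    and "\<And>y. y \<in> topspace (ktop Y) \<Longrightarrow> f (g y) = y"
  shows "variety_iso X Y f" "variety_iso Y X g"
  using assms unfolding variety_iso_def by blast+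

lemma variety_iso_comp:
  assumes f: "variety_iso X Y f" and g: "variety_iso Y Z g"
  shows "variety_iso X Z (g \<circ> f)"
proof -
  obtain f' g' where f': "variety_morphism Y X f'"
      "\<forall>x\<in>topspace (ktop X). f' (f x) = x" "\<forall>y\<in>topspace (ktop Y). f (f' y) = y"
    and g': "variety_morphism Z Y g'"
      "\<forall>x\<in>topspace (ktop Y). g' (g x) = x" "\<forall>y\<in>topspace (ktop Z). g (g' y) = y"
    using f g unfolding variety_iso_def by metis
  have fg: "variety_morphism X Y f" "variety_morphism Y Z g"
    using f g by (auto simp: variety_iso_def)
  have im: "f x \<in> topspace (ktop Y)" if "x \<in> topspace (ktop X)" for x
    using fg(1) that by (auto simp: variety_morphism_iff_local)
  have im': "g' y \<in> topspace (ktop Y)" if "y \<in> topspace (ktop Z)" for y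
    using g'(1) that by (auto simp: variety_morphism_iff_local)
  show ?thesis
    by (rule variety_isoI(1)[OF variety_morphism_comp[OF fg] variety_morphism_comp[OF g'(1) f'(1)]])
      (use im im' f' g' in auto)
qed

lemma variety_iso_sub_kspace:
  assumes "variety_iso X Y f" and fA: "f ` A = B" and A: "A \<subseteq> topspace (ktop X)"
  shows "variety_iso (sub_kspace X A) (sub_kspace Y B) f"
proof -
  obtain g where f: "variety_morphism X Y f" and g: "variety_morphism Y X g"
      and inv: "\<forall>x\<in>topspace (ktop X). g (f x) = x" "\<forall>y\<in>topspace (ktop Y). f (g y) = y"
    using assms unfolding variety_iso_def by metis
  have "variety_morphism (sub_kspace X A) (sub_kspace Y B) f"
    using fA by (intro variety_morphism_sub_kspace[OF f]) auto
  moreover have "variety_morphism (sub_kspace Y B) (sub_kspace X A) g"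
    using fA A inv by (intro variety_morphism_sub_kspace[OF g]) auto
  ultimately show ?thesis
    by (rule variety_isoI(1)) (use inv in \<open>auto simp: topspace_sub_kspace\<close>)
qed

lemma openin_topology_generated_by_basis:
  assumes Int: "\<And>A B. A \<in> S \<Longrightarrow> B \<in> S \<Longrightarrow> A \<inter> B \<in> S"
  shows "openin (topology_generated_by S) U \<longleftrightarrow> (\<forall>x\<in>U. \<exists>B\<in>S. x \<in> B \<and> B \<subseteq> U)"
proof
  assume "openin (topology_generated_by S) U"
  then have "generate_topology_on S U" by (simp add: openin_topology_generated_by_iff)
  then show "\<forall>x\<in>U. \<exists>B\<in>S. x \<in> B \<and> B \<subseteq> U"
  proof induction
    case (Int a b)
    show ?case
    proof
      fix x assume "x \<in> a \<inter> b"
      then obtain A B where "A \<in> S" "x \<in> A" "A \<subseteq> a" "B \<in> S" "x \<in> B" "B \<subseteq> b"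
        using Int.IH by blast
      then show "\<exists>B\<in>S. x \<in> B \<and> B \<subseteq> a \<inter> b"
        using assms[of A B] by blast
    qed
  next
    case (UN K)
    show ?case
    proof
      fix x assume "x \<in> \<Union>K"
      then obtain k where k: "k \<in> K" "x \<in> k" by blast
      then obtain B where "B \<in> S" "x \<in> B" "B \<subseteq> k" using UN.IH by blast
      then show "\<exists>B\<in>S. x \<in> B \<and> B \<subseteq> \<Union>K" using k by blast
    qed
  qed auto
next
  assume *: "\<forall>x\<in>U. \<exists>B\<in>S. x \<in> B \<and> B \<subseteq> U"
  show "openin (topology_generated_by S) U"
    by (subst openin_subopen) (use * topology_generated_by_Basis in blast)
qed

section \<open>Linear algebra\<close>

lemma (in vectorspace) span_singleton:
  assumes "u \<in> carrier V"
  shows "span {u} = {c \<odot>\<^bsub>V\<^esub> u | c. c \<in> carrier K}"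
proof -
  have *: "lincomb a {u} = a u \<odot>\<^bsub>V\<^esub> u" if "a \<in> {u} \<rightarrow> carrier K" for a
    using that assms by (simp add: lincomb_def)
  have "span {u} = {lincomb a {u} | a. a \<in> {u} \<rightarrow> carrier K}"
    using assms by (intro finite_span) auto
  also have "\<dots> = {c \<odot>\<^bsub>V\<^esub> u | c. c \<in> carrier K}"
  proof (intro equalityI subsetI)
    fix x assume "x \<in> {c \<odot>\<^bsub>V\<^esub> u | c. c \<in> carrier K}"
    then obtain c where c: "c \<in> carrier K" "x = c \<odot>\<^bsub>V\<^esub> u" by blast
    then have "x = lincomb (\<lambda>_. c) {u}" using * by simp
    then show "x \<in> {lincomb a {u} | a. a \<in> {u} \<rightarrow> carrier K}" using c by blast
  qed (use * in auto)
  finally show ?thesis .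
qed

text \<open>
  The dimension of a space without a finite generating set is an unspecified number. This lemma is
  what gives the dimensions of subspaces their meaning: a maximal independent subset generates.
\<close>

lemma (in vectorspace) fin_dim_subspace:
  assumes fd: fin_dim and U: "subspace K U V"
  shows "vectorspace.fin_dim K (vs U)"
proof -
  interpret W: vectorspace K "vs U" by (rule subspace_is_vs[OF U])
  have sm: "submodule K U V" using U by simp
  then have Usub: "U \<subseteq> carrier V" by (rule submodule.subset)
  let ?P = "\<lambda>S. S \<subseteq> carrier (vs U) \<and> \<not> W.lin_dep S"
  have "\<exists>A. finite A \<and> maximal A ?P"
  proof (rule maximal_exists)
    show "finite A \<and> card A \<le> dim" if "?P A" for A
      using that li_le_dim[OF fd, of A] span_li_not_depend(2)[OF _ sm, of A] Usub by auto
    show "?P {}" by (auto simp: W.lin_dep_def)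
  qed
  then obtain A where A: "finite A" "maximal A ?P" by blast
  then have "W.gen_set A" by (intro W.max_li_is_gen)
  then show ?thesis
    unfolding W.fin_dim_def using A by (auto simp: maximal_def)
qed

lemma (in vectorspace) dim_eq_0_iff:
  assumes fin_dim
  shows "dim = 0 \<longleftrightarrow> carrier V = {\<zero>\<^bsub>V\<^esub>}"
proof
  assume "dim = 0"
  moreover obtain B where B: "finite B" "basis B" using finite_basis_exists[OF assms] by blast
  ultimately have "B = {}" using dim_basis[OF B] by simp
  then show "carrier V = {\<zero>\<^bsub>V\<^esub>}" using B(2) span_empty by (simp add: basis_def)
next
  assume "carrier V = {\<zero>\<^bsub>V\<^esub>}"
  moreover have "span {\<zero>\<^bsub>V\<^esub>} \<subseteq> carrier V" "\<zero>\<^bsub>V\<^esub> \<in> span {\<zero>\<^bsub>V\<^esub>}"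
    using span_is_subset2[of "{\<zero>\<^bsub>V\<^esub>}"] in_own_span[of "{\<zero>\<^bsub>V\<^esub>}"] by auto
  ultimately have "gen_set {\<zero>\<^bsub>V\<^esub>}" by (intro equalityI) auto
  then show "dim = 0" by (rule dim0I)
qed

lemma (in vectorspace) dim_eq_1_iff:
  assumes fin_dim
  shows "dim = 1 \<longleftrightarrow>
    (\<exists>u\<in>carrier V. u \<noteq> \<zero>\<^bsub>V\<^esub> \<and> carrier V = {c \<odot>\<^bsub>V\<^esub> u | c. c \<in> carrier K})"
proof
  assume "dim = 1"
  moreover obtain B where B: "finite B" "basis B" using finite_basis_exists[OF assms] by blast
  ultimately have "card B = 1" using dim_basis[OF B] by simp
  then obtain u where u: "B = {u}" by (auto simp: card_1_singleton_iff)
  then have "u \<in> carrier V" "u \<noteq> \<zero>\<^bsub>V\<^esub>" "carrier V = span {u}"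
    using B(2) vs_zero_lin_dep[of B] by (auto simp: basis_def)
  then show "\<exists>u\<in>carrier V. u \<noteq> \<zero>\<^bsub>V\<^esub> \<and> carrier V = {c \<odot>\<^bsub>V\<^esub> u | c. c \<in> carrier K}"
    using span_singleton by blast
next
  assume "\<exists>u\<in>carrier V. u \<noteq> \<zero>\<^bsub>V\<^esub> \<and> carrier V = {c \<odot>\<^bsub>V\<^esub> u | c. c \<in> carrier K}"
  then obtain u where u: "u \<in> carrier V" "u \<noteq> \<zero>\<^bsub>V\<^esub>"
      "carrier V = {c \<odot>\<^bsub>V\<^esub> u | c. c \<in> carrier K}"
    by blast
  have "gen_set {u}" by (rule trans[OF span_singleton[OF u(1)] u(3)[symmetric]])
  with u(1,2) show "dim = 1" by (intro dim1I)
qed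

lemma func_vs_simps [simp]:
  "carrier (func_vs I) = (I \<rightarrow>\<^sub>E UNIV)"
  "\<zero>\<^bsub>func_vs I\<^esub> = (\<lambda>i\<in>I. 0)"
  "x \<oplus>\<^bsub>func_vs I\<^esub> y = (\<lambda>i\<in>I. x i + y i)"
  "c \<odot>\<^bsub>func_vs I\<^esub> x = (\<lambda>i\<in>I. c * x i)"
  by (simp_all add: class_ring.func_space_def)

lemma vectorspace_func_vs: "vectorspace class_ring (func_vs I :: ('k::field, 'i \<Rightarrow> 'k) module)"
  unfolding vectorspace_def
  using cring.func_space_is_module[OF class_cring.cring_axioms] class_field by blast

text \<open>
  Every vector is reached from zero by changing one coordinate at a time.
\<close>

lemma func_vs_induct [consumes 2, case_names zero add]:
  fixes x :: "'i \<Rightarrow> 'k::field"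
  assumes "finite I" and x: "x \<in> I \<rightarrow>\<^sub>E UNIV"
    and zero: "P (\<lambda>i\<in>I. 0)"
    and add: "\<And>y c i. y \<in> I \<rightarrow>\<^sub>E UNIV \<Longrightarrow> i \<in> I \<Longrightarrow> P y \<Longrightarrow>
      P (\<lambda>j\<in>I. y j + c * of_bool (j = i))"
  shows "P x"
proof -
  have "P (\<lambda>i\<in>I. if i \<in> J then x i else 0)" if "finite J" "J \<subseteq> I" for J
    using that
  proof (induction J)
    case empty
    have "(\<lambda>i\<in>I. if i \<in> {} then x i else 0) = (\<lambda>i\<in>I. 0)" by (rule restrict_ext) simp
    then show ?case using zero by metis
  next
    case (insert a J)
    let ?y = "\<lambda>i\<in>I. if i \<in> J then x i else 0"
    have "P (\<lambda>j\<in>I. ?y j + x a * of_bool (j = a))"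
      using insert by (intro add) auto
    moreover have "(\<lambda>j\<in>I. ?y j + x a * of_bool (j = a)) =
        (\<lambda>i\<in>I. if i \<in> insert a J then x i else 0)"
      using insert.hyps by (intro restrict_ext) auto
    ultimately show "P (\<lambda>i\<in>I. if i \<in> insert a J then x i else 0)" by simp
  qed
  from this[OF \<open>finite I\<close> subset_refl] show ?thesis
    using x by (auto cong: restrict_cong simp: PiE_restrict)
qed

lemma linear_functional_expand:
  fixes \<phi> :: "('i \<Rightarrow> 'k::field) \<Rightarrow> 'k"
  assumes "finite I" and "x \<in> I \<rightarrow>\<^sub>E UNIV"
    and add: "\<And>x y. x \<in> I \<rightarrow>\<^sub>E UNIV \<Longrightarrow> y \<in> I \<rightarrow>\<^sub>E UNIV \<Longrightarrow> \<phi> (\<lambda>i\<in>I. x i + y i) = \<phi> x + \<phi> y"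
    and smult: "\<And>c x. x \<in> I \<rightarrow>\<^sub>E UNIV \<Longrightarrow> \<phi> (\<lambda>i\<in>I. c * x i) = c * \<phi> x"
  shows "\<phi> x = (\<Sum>i\<in>I. x i * \<phi> (\<lambda>j\<in>I. of_bool (j = i)))"
  using assms(1,2)
proof (induction x rule: func_vs_induct)
  case zero
  have "(\<lambda>i\<in>I. 0 * (\<lambda>i\<in>I. 0::'k) i) = (\<lambda>i\<in>I. 0)" by (rule restrict_ext) simp
  then have "\<phi> (\<lambda>i\<in>I. 0) = 0" using smult[of "\<lambda>i\<in>I. 0" 0] by simp
  moreover have "(\<Sum>i\<in>I. (\<lambda>i\<in>I. 0) i * \<phi> (\<lambda>j\<in>I. of_bool (j = i))) = 0"
    by (rule sum.neutral) simp
  ultimately show ?case by metis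
next
  case (add y c i)
  let ?e = "\<lambda>i. \<lambda>j\<in>I. of_bool (j = i)"
  have "(\<lambda>j\<in>I. y j + c * of_bool (j = i)) = (\<lambda>j\<in>I. y j + (\<lambda>j\<in>I. c * ?e i j) j)"
    by (intro restrict_ext) auto
  then have "\<phi> (\<lambda>j\<in>I. y j + c * of_bool (j = i)) = \<phi> y + c * \<phi> (?e i)"
    using assms(3)[of y "\<lambda>j\<in>I. c * ?e i j"] smult[of "?e i" c] add.hyps by auto
  moreover have "(\<Sum>j\<in>I. (\<lambda>j\<in>I. y j + c * of_bool (j = i)) j * \<phi> (?e j)) =
      (\<Sum>j\<in>I. y j * \<phi> (?e j)) + (\<Sum>j\<in>I. if j = i then c * \<phi> (?e j) else 0)"
    unfolding sum.distrib[symmetric] by (intro sum.cong) (auto simp: algebra_simps)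
  moreover have "(\<Sum>j\<in>I. if j = i then c * \<phi> (?e j) else 0) = c * \<phi> (?e i)"
    using assms(1) add.hyps by (simp add: sum.delta)
  ultimately show "\<phi> (\<lambda>j\<in>I. y j + c * of_bool (j = i)) =
      (\<Sum>j\<in>I. (\<lambda>j\<in>I. y j + c * of_bool (j = i)) j * \<phi> (?e j))"
    using add.IH by metis
qed

lemma module_hom_func_vs_expand:
  fixes g :: "('i \<Rightarrow> 'k::field) \<Rightarrow> 'j \<Rightarrow> 'k"
  assumes "finite I" "g \<in> module_hom class_ring (func_vs I) (func_vs J)" "x \<in> I \<rightarrow>\<^sub>E UNIV" "j \<in> J"
  shows "g x j = (\<Sum>i\<in>I. x i * g (\<lambda>j\<in>I. of_bool (j = i)) j)"
  by (rule linear_functional_expand[where \<phi> = "\<lambda>x. g x j", OF assms(1,3)])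
    (use assms(2,4) in \<open>auto simp: module_hom_def\<close>)

lemma fin_dim_func_vs:
  assumes "finite I"
  shows "vectorspace.fin_dim class_ring (func_vs I :: ('k::field, 'i \<Rightarrow> 'k) module)"
proof -
  interpret V: vectorspace class_ring "func_vs I :: ('k, 'i \<Rightarrow> 'k) module"
    by (rule vectorspace_func_vs)
  let ?e = "\<lambda>i. (\<lambda>j\<in>I. of_bool (j = i)) :: 'i \<Rightarrow> 'k"
  have sub: "?e ` I \<subseteq> carrier (func_vs I)" by auto
  interpret S: submodule class_ring "V.span (?e ` I)" "func_vs I :: ('k, 'i \<Rightarrow> 'k) module"
    by (rule V.span_is_submodule[OF sub])
  have "x \<in> V.span (?e ` I)" if "x \<in> I \<rightarrow>\<^sub>E UNIV" for x
    using assms that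
  proof (induction x rule: func_vs_induct)
    case zero
    show "(\<lambda>i\<in>I. 0) \<in> V.span (?e ` I)" using S.zero_closed by simp
  next
    case (add y c i)
    have "?e i \<in> V.span (?e ` I)" using V.in_own_span[OF sub] add by blast
    moreover have "y \<in> V.span (?e ` I)" by (rule add.IH)
    ultimately have "y \<oplus>\<^bsub>func_vs I\<^esub> (c \<odot>\<^bsub>func_vs I\<^esub> ?e i) \<in> V.span (?e ` I)"
      by (intro S.m_closed S.smult_closed) auto
    moreover have "y \<oplus>\<^bsub>func_vs I\<^esub> (c \<odot>\<^bsub>func_vs I\<^esub> ?e i) = (\<lambda>j\<in>I. y j + c * of_bool (j = i))"
      by (auto intro!: restrict_ext)
    ultimately show "(\<lambda>j\<in>I. y j + c * of_bool (j = i)) \<in> V.span (?e ` I)" by simp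
  qed
  then have "V.gen_set (?e ` I)" using V.span_is_subset2[OF sub] by auto
  then show ?thesis unfolding V.fin_dim_def using sub assms by blast
qed

text \<open>
  The vector space axioms are equations and therefore pass to images. This spares a direct
  verification for quotient spaces, whose operations are defined by unions of cosets.
\<close>

lemma vectorspace_surj_image:
  assumes V: "vectorspace class_ring V" and fd: "vectorspace.fin_dim class_ring V"
    and surj: "p ` carrier V = carrier Q"
    and zero: "\<zero>\<^bsub>Q\<^esub> = p \<zero>\<^bsub>V\<^esub>"
    and add: "\<And>x y. x \<in> carrier V \<Longrightarrow> y \<in> carrier V \<Longrightarrow> p (x \<oplus>\<^bsub>V\<^esub> y) = p x \<oplus>\<^bsub>Q\<^esub> p y"
    and smult: "\<And>c x. x \<in> carrier V \<Longrightarrow> p (c \<odot>\<^bsub>V\<^esub> x) = c \<odot>\<^bsub>Q\<^esub> p x"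
  shows "vectorspace (class_ring :: 'k::field ring) Q" "vectorspace.fin_dim class_ring Q"
proof -
  interpret V: vectorspace class_ring V by (rule V)
  have car: "carrier Q = p ` carrier V" using surj by simp
  have [simp]: "p x \<oplus>\<^bsub>Q\<^esub> p y = p (x \<oplus>\<^bsub>V\<^esub> y)" "c \<odot>\<^bsub>Q\<^esub> p x = p (c \<odot>\<^bsub>V\<^esub> x)"
    if "x \<in> carrier V" "y \<in> carrier V" for x y c
    using that add smult by auto
  have cl: "c \<odot>\<^bsub>V\<^esub> x \<in> carrier V" if "x \<in> carrier V" for c x
    using that V.smult_closed by simp
  show Q: "vectorspace class_ring Q"
  proof (rule vs_criteria)
    show "\<forall>v\<in>carrier Q. \<exists>w\<in>carrier Q. v \<oplus>\<^bsub>Q\<^esub> w = \<zero>\<^bsub>Q\<^esub>"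
    proof
      fix v assume "v \<in> carrier Q"
      then obtain x where x: "x \<in> carrier V" "v = p x" unfolding car by blast
      then have "v \<oplus>\<^bsub>Q\<^esub> p (\<ominus>\<^bsub>V\<^esub> x) = \<zero>\<^bsub>Q\<^esub>" by (simp add: V.r_neg zero)
      then show "\<exists>w\<in>carrier Q. v \<oplus>\<^bsub>Q\<^esub> w = \<zero>\<^bsub>Q\<^esub>" using x unfolding car by blast
    qed
    show "\<forall>v w. v \<in> carrier Q \<and> w \<in> carrier Q \<longrightarrow> v \<oplus>\<^bsub>Q\<^esub> w = w \<oplus>\<^bsub>Q\<^esub> v"
      unfolding car by (auto simp: V.a_comm)
    show "\<forall>v w x. v \<in> carrier Q \<and> w \<in> carrier Q \<and> x \<in> carrier Q \<longrightarrow>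
        v \<oplus>\<^bsub>Q\<^esub> w \<oplus>\<^bsub>Q\<^esub> x = v \<oplus>\<^bsub>Q\<^esub> (w \<oplus>\<^bsub>Q\<^esub> x)"
      unfolding car by (auto simp: V.a_assoc)
    show "\<forall>a b v. a \<in> carrier class_ring \<and> b \<in> carrier class_ring \<and> v \<in> carrier Q \<longrightarrow>
        (a \<otimes>\<^bsub>class_ring\<^esub> b) \<odot>\<^bsub>Q\<^esub> v = a \<odot>\<^bsub>Q\<^esub> (b \<odot>\<^bsub>Q\<^esub> v)"
      unfolding car using V.smult_assoc1 by (auto simp: cl)
    show "\<forall>a b v. a \<in> carrier class_ring \<and> b \<in> carrier class_ring \<and> v \<in> carrier Q \<longrightarrow>
        (a \<oplus>\<^bsub>class_ring\<^esub> b) \<odot>\<^bsub>Q\<^esub> v = a \<odot>\<^bsub>Q\<^esub> v \<oplus>\<^bsub>Q\<^esub> b \<odot>\<^bsub>Q\<^esub> v"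
      unfolding car using V.smult_l_distr by (auto simp: cl)
    show "\<forall>a v w. a \<in> carrier class_ring \<and> v \<in> carrier Q \<and> w \<in> carrier Q \<longrightarrow>
        a \<odot>\<^bsub>Q\<^esub> (v \<oplus>\<^bsub>Q\<^esub> w) = a \<odot>\<^bsub>Q\<^esub> v \<oplus>\<^bsub>Q\<^esub> a \<odot>\<^bsub>Q\<^esub> w"
      unfolding car using V.smult_r_distr by (auto simp: cl)
    show "\<forall>v\<in>carrier Q. \<one>\<^bsub>class_ring\<^esub> \<odot>\<^bsub>Q\<^esub> v = v"
      unfolding car using V.smult_one by auto
  qed (use class_field in \<open>auto simp: car zero cl\<close>)
  have "p \<in> module_hom class_ring V Q"
    unfolding module_hom_def using car add smult by blast
  then have "linear_map class_ring V Q p"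
    unfolding linear_map_def mod_hom_def mod_hom_axioms_def
    using V Q unfolding vectorspace_def by blast
  then show "vectorspace.fin_dim class_ring Q"
    by (rule linear_map.surj_fin_dim[OF _ fd surj])
qed

text \<open>
  The operations of the quotient are unions over all representatives; since all of these
  contribute the same coset, they may be computed on any single one.
\<close>

lemma quot_module_coset:
  fixes V :: "('k::field, 'v) module"
  assumes V: "vectorspace class_ring V" and U: "VectorSpace.subspace class_ring U V"
  shows "(+>\<^bsub>V\<^esub>) U ` carrier V = carrier (quot_module V U)"
    and "\<zero>\<^bsub>quot_module V U\<^esub> = U +>\<^bsub>V\<^esub> \<zero>\<^bsub>V\<^esub>"
    and "\<And>x y. x \<in> carrier V \<Longrightarrow> y \<in> carrier V \<Longrightarrow>
      U +>\<^bsub>V\<^esub> (x \<oplus>\<^bsub>V\<^esub> y) = (U +>\<^bsub>V\<^esub> x) \<oplus>\<^bsub>quot_module V U\<^esub> (U +>\<^bsub>V\<^esub> y)"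
    and "\<And>c x. x \<in> carrier V \<Longrightarrow>
      U +>\<^bsub>V\<^esub> (c \<odot>\<^bsub>V\<^esub> x) = c \<odot>\<^bsub>quot_module V U\<^esub> (U +>\<^bsub>V\<^esub> x)"
    and "\<And>x y. x \<in> carrier V \<Longrightarrow> y \<in> U +>\<^bsub>V\<^esub> x \<Longrightarrow>
      \<exists>u\<in>U. y = u \<oplus>\<^bsub>V\<^esub> x"
    and "\<And>x. x \<in> carrier V \<Longrightarrow> x \<in> U +>\<^bsub>V\<^esub> x"
    and "\<And>x u. x \<in> carrier V \<Longrightarrow> u \<in> U \<Longrightarrow> U +>\<^bsub>V\<^esub> (u \<oplus>\<^bsub>V\<^esub> x) = U +>\<^bsub>V\<^esub> x"
proof -
  interpret V: vectorspace class_ring V by (rule V)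
  interpret S: submodule class_ring U V using U by simp
  have neg: "\<ominus>\<^bsub>V\<^esub> x \<in> U" if "x \<in> U" for x
  proof -
    have "x \<in> carrier V" using that S.subset by auto
    then have "(- 1) \<odot>\<^bsub>V\<^esub> x = \<ominus>\<^bsub>V\<^esub> x"
      using V.smult_minus_1[of x] by (simp add: class_ring_simps)
    moreover have "(- 1) \<odot>\<^bsub>V\<^esub> x \<in> U" using that by (intro S.smult_closed) auto
    ultimately show ?thesis by simp
  qed
  have "additive_subgroup U V"
    unfolding additive_subgroup_def
  proof (rule group.subgroupI[OF V.add.group_axioms])
    show "U \<noteq> {}" using S.zero_closed by blast
  qed (use S.subset S.m_closed neg in \<open>auto simp: a_inv_def\<close>)
  then interpret A: abelian_subgroup U V
    by (intro abelian_subgroupI3 V.abelian_group_axioms)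
  show "(+>\<^bsub>V\<^esub>) U ` carrier V = carrier (quot_module V U)"
    by (auto simp: quot_module_def A_RCOSETS_def' a_r_coset_def')
  show "\<zero>\<^bsub>quot_module V U\<^esub> = U +>\<^bsub>V\<^esub> \<zero>\<^bsub>V\<^esub>"
    using S.subset by (simp add: quot_module_def V.a_coset_add_zero)
  show "U +>\<^bsub>V\<^esub> (x \<oplus>\<^bsub>V\<^esub> y) = (U +>\<^bsub>V\<^esub> x) \<oplus>\<^bsub>quot_module V U\<^esub> (U +>\<^bsub>V\<^esub> y)"
    if "x \<in> carrier V" "y \<in> carrier V" for x y
    using that by (simp add: quot_module_def A.a_rcos_sum)
  show mem: "\<exists>u\<in>U. y = u \<oplus>\<^bsub>V\<^esub> x" if "x \<in> carrier V" "y \<in> U +>\<^bsub>V\<^esub> x" for x y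
    using that by (auto simp: a_r_coset_def')
  show self: "x \<in> U +>\<^bsub>V\<^esub> x" if "x \<in> carrier V" for x
    using that by (rule A.a_rcos_self)
  show abs: "U +>\<^bsub>V\<^esub> (u \<oplus>\<^bsub>V\<^esub> x) = U +>\<^bsub>V\<^esub> x" if "x \<in> carrier V" "u \<in> U" for x u
  proof -
    have "u \<oplus>\<^bsub>V\<^esub> x \<in> U +>\<^bsub>V\<^esub> x" using that by (auto simp: a_r_coset_def')
    then show ?thesis using A.a_repr_independence' that(1) by simp
  qed
  show "U +>\<^bsub>V\<^esub> (c \<odot>\<^bsub>V\<^esub> x) = c \<odot>\<^bsub>quot_module V U\<^esub> (U +>\<^bsub>V\<^esub> x)" if x: "x \<in> carrier V" for c x
  proof -
    have "U +>\<^bsub>V\<^esub> (c \<odot>\<^bsub>V\<^esub> y) = U +>\<^bsub>V\<^esub> (c \<odot>\<^bsub>V\<^esub> x)" if "y \<in> U +>\<^bsub>V\<^esub> x" for y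
    proof -
      obtain u where u: "u \<in> U" "y = u \<oplus>\<^bsub>V\<^esub> x" using mem[OF x \<open>y \<in> U +>\<^bsub>V\<^esub> x\<close>] by blast
      then have "c \<odot>\<^bsub>V\<^esub> y = c \<odot>\<^bsub>V\<^esub> u \<oplus>\<^bsub>V\<^esub> c \<odot>\<^bsub>V\<^esub> x"
        using x S.subset V.smult_r_distr by auto
      then show ?thesis using abs[of "c \<odot>\<^bsub>V\<^esub> x" "c \<odot>\<^bsub>V\<^esub> u"] u x S.smult_closed V.smult_closed by auto
    qed
    then have "c \<odot>\<^bsub>quot_module V U\<^esub> (U +>\<^bsub>V\<^esub> x) = (\<Union>y\<in>U +>\<^bsub>V\<^esub> x. U +>\<^bsub>V\<^esub> (c \<odot>\<^bsub>V\<^esub> x))"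
      unfolding quot_module_def by simp
    then show ?thesis using self[OF x] by auto
  qed
qed

lemma vectorspace_quot_module:
  fixes V :: "('k::field, 'v) module"
  assumes V: "vectorspace class_ring V" and "vectorspace.fin_dim class_ring V"
    and U: "VectorSpace.subspace class_ring U V"
  shows "vectorspace class_ring (quot_module V U)"
    "vectorspace.fin_dim class_ring (quot_module V U)"
  using vectorspace_surj_image[OF V assms(2) quot_module_coset(1-4)[OF V U]] by blast+

section \<open>Polynomial functions\<close>

lemma mdeg_eq_sum:
  assumes "finite A" "Poly_Mapping.keys m \<subseteq> A"
  shows "mdeg m = (\<Sum>i\<in>A. Poly_Mapping.lookup m i)"
  unfolding mdeg_def by (rule sum.mono_neutral_left) (use assms in \<open>auto simp: in_keys_iff\<close>)

lemma mono_eval_eq_prod: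
  assumes "finite A" "Poly_Mapping.keys m \<subseteq> A"
  shows "mono_eval m x = (\<Prod>i\<in>A. x i ^ Poly_Mapping.lookup m i)"
  unfolding mono_eval_def by (rule prod.mono_neutral_left) (use assms in \<open>auto simp: in_keys_iff\<close>)

lemma peval_eq_sum:
  assumes "finite A" "Poly_Mapping.keys p \<subseteq> A"
  shows "peval p x = (\<Sum>m\<in>A. Poly_Mapping.lookup p m * mono_eval m x)"
  unfolding peval_def by (rule sum.mono_neutral_left) (use assms in \<open>auto simp: in_keys_iff\<close>)

lemma mdeg_add: "mdeg (m + m') = mdeg m + mdeg m'"
  using Poly_Mapping.keys_add[of m m']
  by (simp add: mdeg_eq_sum[of "Poly_Mapping.keys m \<union> Poly_Mapping.keys m'"] lookup_add sum.distrib)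

lemma mdeg_single [simp]: "mdeg (Poly_Mapping.single i k) = k"
  by (simp add: mdeg_eq_sum[of "{i}"])

lemma mdeg_zero [simp]: "mdeg 0 = 0"
  by (simp add: mdeg_def)

lemma mono_eval_add: "mono_eval (m + m') x = mono_eval m x * mono_eval m' x"
  using Poly_Mapping.keys_add[of m m']
  by (simp add: mono_eval_eq_prod[of "Poly_Mapping.keys m \<union> Poly_Mapping.keys m'"] lookup_add
      power_add prod.distrib)

lemma mono_eval_single [simp]: "mono_eval (Poly_Mapping.single i k) x = x i ^ k"
  by (simp add: mono_eval_eq_prod[of "{i}"])

lemma mono_eval_zero [simp]: "mono_eval 0 x = 1"
  by (simp add: mono_eval_def)

lemma mono_eval_scale:
  assumes "Poly_Mapping.keys m \<subseteq> I"
  shows "mono_eval m (\<lambda>i\<in>I. t * x i) = t ^ mdeg m * mono_eval m x"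
proof -
  have "mono_eval m (\<lambda>i\<in>I. t * x i) = (\<Prod>i\<in>Poly_Mapping.keys m. (t * x i) ^ Poly_Mapping.lookup m i)"
    unfolding mono_eval_def by (rule prod.cong) (use assms in auto)
  then show ?thesis
    by (simp add: mono_eval_def mdeg_def power_mult_distrib prod.distrib power_sum)
qed

lemma peval_single [simp]: "peval (Poly_Mapping.single m c) x = c * mono_eval m x"
  by (simp add: peval_eq_sum[of "{m}"])

lemma peval_zero [simp]: "peval 0 x = 0"
  by (simp add: peval_def)

lemma peval_add: "peval (p + q) x = peval p x + peval q x"
  using Poly_Mapping.keys_add[of p q]
  by (simp add: peval_eq_sum[of "Poly_Mapping.keys p \<union> Poly_Mapping.keys q"] lookup_add
      sum.distrib algebra_simps)

lemma peval_sum: "peval (\<Sum>a\<in>A. p a) x = (\<Sum>a\<in>A. peval (p a) x)"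
  by (induction A rule: infinite_finite_induct) (auto simp: peval_add)

lemma poly_mapping_eq_sum_single:
  "p = (\<Sum>m\<in>Poly_Mapping.keys p. Poly_Mapping.single m (Poly_Mapping.lookup p m))"
proof (rule poly_mapping_eqI)
  fix k
  have "Poly_Mapping.lookup (\<Sum>m\<in>Poly_Mapping.keys p. Poly_Mapping.single m (Poly_Mapping.lookup p m)) k =
      (\<Sum>m\<in>Poly_Mapping.keys p. if m = k then Poly_Mapping.lookup p k else 0)"
    unfolding lookup_sum by (intro sum.cong) (auto simp: lookup_single)
  then show "Poly_Mapping.lookup p k =
      Poly_Mapping.lookup (\<Sum>m\<in>Poly_Mapping.keys p. Poly_Mapping.single m (Poly_Mapping.lookup p m)) k"
    by (simp add: sum.delta in_keys_iff)
qed

lemma peval_mult: "peval (p * q) x = peval p x * peval q x"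
proof -
  let ?s = "\<lambda>p m. Poly_Mapping.single m (Poly_Mapping.lookup p m)"
  have "p * q = (\<Sum>m\<in>Poly_Mapping.keys p. ?s p m) * (\<Sum>m\<in>Poly_Mapping.keys q. ?s q m)"
    using poly_mapping_eq_sum_single[of p] poly_mapping_eq_sum_single[of q] by simp
  then have "peval (p * q) x = (\<Sum>m\<in>Poly_Mapping.keys p. \<Sum>m'\<in>Poly_Mapping.keys q.
      Poly_Mapping.lookup p m * Poly_Mapping.lookup q m' * (mono_eval m x * mono_eval m' x))"
    by (simp add: sum_product mult_single peval_sum mono_eval_add)
  then show ?thesis
    by (simp add: peval_def sum_product mult_ac)
qed

text \<open>
  Forms are treated as functions: substituting polynomial maps into them then only needs closure
  under sums and products.
\<close>

definition form :: "'i set \<Rightarrow> nat \<Rightarrow> (('i \<Rightarrow> 'k::field) \<Rightarrow> 'k) \<Rightarrow> bool" where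
  "form I e p \<longleftrightarrow> (\<exists>F. homogeneous I e F \<and> p = peval F)"

lemma form_peval: "homogeneous I e F \<Longrightarrow> form I e (peval F)"
  by (auto simp: form_def)

lemma form_const: "form I 0 (\<lambda>_. c)"
  unfolding form_def
  by (rule exI[of _ "Poly_Mapping.single 0 c"]) (auto simp: homogeneous_def)

lemma form_zero: "form I e (\<lambda>_. 0)"
  unfolding form_def by (rule exI[of _ 0]) (auto simp: homogeneous_def)

lemma form_coord: "i \<in> I \<Longrightarrow> form I 1 (\<lambda>x. x i)"
  unfolding form_def
  by (rule exI[of _ "Poly_Mapping.single (Poly_Mapping.single i 1) 1"]) (auto simp: homogeneous_def)

lemma form_add: "form I e p \<Longrightarrow> form I e q \<Longrightarrow> form I e (\<lambda>x. p x + q x)"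
  unfolding form_def homogeneous_def
proof (elim exE conjE)
  fix F G
  assume "\<forall>m\<in>Poly_Mapping.keys F. Poly_Mapping.keys m \<subseteq> I \<and> mdeg m = e" "p = peval F"
    "\<forall>m\<in>Poly_Mapping.keys G. Poly_Mapping.keys m \<subseteq> I \<and> mdeg m = e" "q = peval G"
  then show "\<exists>H. (\<forall>m\<in>Poly_Mapping.keys H. Poly_Mapping.keys m \<subseteq> I \<and> mdeg m = e) \<and>
      (\<lambda>x. p x + q x) = peval H"
    using Poly_Mapping.keys_add[of F G] by (intro exI[of _ "F + G"]) (auto simp: peval_add)
qed

lemma form_mult: "form I e p \<Longrightarrow> form I e' q \<Longrightarrow> form I (e + e') (\<lambda>x. p x * q x)"
  unfolding form_def homogeneous_def
proof (elim exE conjE)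
  fix F G
  assume *: "\<forall>m\<in>Poly_Mapping.keys F. Poly_Mapping.keys m \<subseteq> I \<and> mdeg m = e" "p = peval F"
    "\<forall>m\<in>Poly_Mapping.keys G. Poly_Mapping.keys m \<subseteq> I \<and> mdeg m = e'" "q = peval G"
  have "Poly_Mapping.keys m \<subseteq> I \<and> mdeg m = e + e'" if m: "m \<in> Poly_Mapping.keys (F * G)" for m
  proof -
    obtain a b where "m = a + b" "a \<in> Poly_Mapping.keys F" "b \<in> Poly_Mapping.keys G"
      using m Poly_Mapping.keys_mult[of F G] by auto
    moreover have "Poly_Mapping.keys a \<subseteq> I" "mdeg a = e" "Poly_Mapping.keys b \<subseteq> I" "mdeg b = e'"
      using * calculation by auto
    ultimately show ?thesis using Poly_Mapping.keys_add[of a b] by (force simp: mdeg_add)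
  qed
  then show "\<exists>H. (\<forall>m\<in>Poly_Mapping.keys H. Poly_Mapping.keys m \<subseteq> I \<and> mdeg m = e + e') \<and>
      (\<lambda>x. p x * q x) = peval H"
    using * by (intro exI[of _ "F * G"]) (auto simp: peval_mult)
qed

text \<open>
  Indexing \<open>A\<close> by degrees covers two situations: with forms as the graded pieces it says that forms
  compose, and with a constant family it says that a form in members of an ungraded
  algebra, such as the polynomial functions on frames, is a member of that algebra.
\<close>

lemma form_substitute:
  fixes A :: "nat \<Rightarrow> ('x \<Rightarrow> 'k::field) set"
  assumes const: "\<And>c. (\<lambda>_. c) \<in> A 0" and zero: "\<And>a. (\<lambda>_. 0) \<in> A a"
    and add: "\<And>a p q. p \<in> A a \<Longrightarrow> q \<in> A a \<Longrightarrow> (\<lambda>x. p x + q x) \<in> A a"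
    and mult: "\<And>a b p q. p \<in> A a \<Longrightarrow> q \<in> A b \<Longrightarrow> (\<lambda>x. p x * q x) \<in> A (a + b)"
    and G: "\<And>j. j \<in> J \<Longrightarrow> (\<lambda>x. G x j) \<in> A e"
    and p: "form J e' p"
  shows "(\<lambda>x. p (G x)) \<in> A (e * e')"
proof -
  obtain F where F: "homogeneous J e' F" "p = peval F"
    using p unfolding form_def by blast
  have pow: "(\<lambda>x. q x ^ k) \<in> A (a * k)" if "q \<in> A a" for q a k
    by (induction k) (use that const mult in auto)
  have mono: "(\<lambda>x. \<Prod>i\<in>M. G x i ^ l i) \<in> A (e * (\<Sum>i\<in>M. l i))" if "finite M" "M \<subseteq> J" for M l
    using that
  proof (induction M)
    case (insert i M)
    then show ?case using mult[OF pow[OF G[of i], of "l i"]] by (simp add: distrib_left)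
  qed (use const in simp)
  have sum: "(\<lambda>x. \<Sum>m\<in>M. q m x) \<in> A a" if "finite M" "\<And>m. m \<in> M \<Longrightarrow> q m \<in> A a"
    for q :: "('c \<Rightarrow>\<^sub>0 nat) \<Rightarrow> 'x \<Rightarrow> 'k" and M a
    using that by (induction M) (use zero add in auto)
  have "(\<lambda>x. Poly_Mapping.lookup F m * mono_eval m (G x)) \<in> A (e * e')"
    if "m \<in> Poly_Mapping.keys F" for m
  proof -
    have m: "Poly_Mapping.keys m \<subseteq> J" "mdeg m = e'"
      using F(1) that by (auto simp: homogeneous_def)
    then show ?thesis
      using mult[OF const mono[OF finite_keys m(1), of "Poly_Mapping.lookup m"],
          of "Poly_Mapping.lookup F m"]
      by (simp add: mono_eval_def mdeg_def)
  qed
  then show ?thesis unfolding F(2) peval_def by (intro sum) auto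
qed

lemma form_compose:
  assumes "\<And>j. j \<in> J \<Longrightarrow> form I e (\<lambda>x. G x j)" "form J e' p"
  shows "form I (e * e') (\<lambda>x. p (G x))"
  using form_substitute[where A = "\<lambda>a. {q. form I a q}" and G = G, OF _ _ _ _ _ assms(2)] assms(1)
  by (auto intro: form_const form_zero form_add form_mult)

lemma form_sum:
  "finite A \<Longrightarrow> (\<And>a. a \<in> A \<Longrightarrow> form I e (p a)) \<Longrightarrow> form I e (\<lambda>x. \<Sum>a\<in>A. p a x)"
  by (induction A rule: finite_induct) (auto intro: form_zero form_add)

lemma form_cmult: "form I e p \<Longrightarrow> form I e (\<lambda>x. c * p x)"
  using form_mult[OF form_const, of I e p c] by simp

lemma form_mono_eval: "form UNIV (mdeg m) (mono_eval m)"
proof -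
  have "mono_eval m = peval (Poly_Mapping.single m 1)" by auto
  moreover have "homogeneous UNIV (mdeg m) (Poly_Mapping.single m (1::'k::field))"
    by (simp add: homogeneous_def)
  ultimately show ?thesis using form_peval by metis
qed

lemma form_scale:
  assumes "form I e p"
  shows "p (\<lambda>i\<in>I. t * x i) = t ^ e * p x"
proof -
  obtain F where F: "homogeneous I e F" "p = peval F"
    using assms unfolding form_def by blast
  then show ?thesis
    by (auto simp: peval_def sum_distrib_left homogeneous_def mono_eval_scale intro!: sum.cong)
qed

text \<open>
  All polynomial functions. They are generated from forms by sums alone, so that each comes with
  homogeneous components; closure under products is proved separately.
\<close>

inductive polyfun :: "'i set \<Rightarrow> (('i \<Rightarrow> 'k::field) \<Rightarrow> 'k) \<Rightarrow> bool" for I where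
  form: "form I e p \<Longrightarrow> polyfun I p"
| add: "polyfun I p \<Longrightarrow> polyfun I q \<Longrightarrow> polyfun I (\<lambda>x. p x + q x)"

lemma polyfun_mult:
  assumes "polyfun I p" "polyfun I q"
  shows "polyfun I (\<lambda>x. p x * q x)"
  using assms(1)
proof induction
  case (form e p)
  show ?case using assms(2)
  proof induction
    case (form e' q)
    then show ?case using polyfun.form form_mult[OF \<open>form I e p\<close>] by blast
  next
    case (add q q')
    then show ?case using polyfun.add by (simp add: distrib_left)
  qed
next
  case (add p p')
  then show ?case using polyfun.add by (simp add: distrib_right)
qed

text \<open>
  The components above \<open>n\<close> vanish, so that several polynomials can be expanded up to a common
  bound \<open>N\<close>.
\<close>

lemma polyfun_components:
  assumes "polyfun I g"
  obtains n P where "\<And>e. form I e (P e)" "\<And>N x. N \<ge> n \<Longrightarrow> g x = (\<Sum>e<N. P e x)"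
proof -
  have "\<exists>n P. (\<forall>e. form I e (P e)) \<and> (\<forall>N x. N \<ge> n \<longrightarrow> g x = (\<Sum>e<N. P e x))"
    using assms
  proof induction
    case (form e p)
    let ?P = "\<lambda>a x. if a = e then p x else 0"
    have "form I a (?P a)" for a
      using form form_zero[of I a] by (cases "a = e") auto
    moreover have "p x = (\<Sum>a<N. ?P a x)" if "N \<ge> Suc e" for N x
      using that by (simp add: sum.delta)
    ultimately show ?case by (intro exI[of _ "Suc e"] exI[of _ ?P]) blast
  next
    case (add p q)
    then obtain n P n' P' where "\<forall>e. form I e (P e)" "\<forall>N x. N \<ge> n \<longrightarrow> p x = (\<Sum>e<N. P e x)"
      "\<forall>e. form I e (P' e)" "\<forall>N x. N \<ge> n' \<longrightarrow> q x = (\<Sum>e<N. P' e x)" by blast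
    then show ?case
      by (intro exI[of _ "max n n'"] exI[of _ "\<lambda>e x. P e x + P' e x"])
        (auto simp: sum.distrib intro: form_add)
  qed
  then show ?thesis using that by blast
qed

lemma finite_roots_sum:
  fixes a :: "nat \<Rightarrow> 'k::field"
  assumes "e < n" "a e \<noteq> 0"
  shows "finite {t. (\<Sum>i<n. t ^ i * a i) = 0}"
proof -
  let ?p = "\<Sum>i<n. monom (a i) i"
  have "coeff ?p e = a e" using assms(1) by (simp add: coeff_sum sum.delta)
  then have "?p \<noteq> 0" using assms(2) by auto
  then have "finite {t. poly ?p t = 0}" by (rule poly_roots_finite)
  then show ?thesis by (simp add: poly_sum poly_monom mult.commute)
qed

text \<open>
  Over a finite field \<open>1 + \<Prod>\<^sub>a (T - a)\<close> has no root.
\<close>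

lemma infinite_alg_closed_field: "infinite (UNIV :: 'k::alg_closed_field set)"
proof
  assume fin: "finite (UNIV :: 'k set)"
  let ?p = "\<Prod>a\<in>(UNIV :: 'k set). [:- a, 1:]"
  have deg: "degree ?p = card (UNIV :: 'k set)"
    by (subst degree_prod_eq_sum_degree) auto
  moreover have "card (UNIV :: 'k set) > 0" using fin by (simp add: card_gt_0_iff)
  ultimately have "degree (?p + 1) > 0" by (simp add: degree_add_eq_left)
  then obtain x where "poly (?p + 1) x = 0" using alg_closed_imp_poly_has_root by blast
  moreover have "poly ?p x = 0" using fin by (auto simp: poly_prod)
  ultimately show False by simp
qed

section \<open>Projective spaces and geometric quotients\<close>

definition nz_vectors :: "'i set \<Rightarrow> ('i \<Rightarrow> 'k::field) set" where
  "nz_vectors I = {u \<in> I \<rightarrow>\<^sub>E UNIV. u \<noteq> (\<lambda>i\<in>I. 0)}"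

definition line :: "'i set \<Rightarrow> ('i \<Rightarrow> 'k::field) \<Rightarrow> ('i \<Rightarrow> 'k) set" where
  "line I u = range (\<lambda>c. \<lambda>i\<in>I. c * u i)"

lemma nz_vectors_iff: "u \<in> nz_vectors I \<longleftrightarrow> u \<in> I \<rightarrow>\<^sub>E UNIV \<and> (\<exists>i\<in>I. u i \<noteq> 0)"
proof -
  have "u = (\<lambda>i\<in>I. 0) \<longleftrightarrow> (\<forall>i\<in>I. u i = 0)" if "u \<in> I \<rightarrow>\<^sub>E UNIV"
    using that by (auto simp: fun_eq_iff PiE_def extensional_def)
  then show ?thesis by (auto simp: nz_vectors_def)
qed

lemma scale_nz_vectors: "u \<in> nz_vectors I \<Longrightarrow> t \<noteq> 0 \<Longrightarrow> (\<lambda>i\<in>I. t * u i) \<in> nz_vectors I"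
  by (auto simp: nz_vectors_iff)

lemma self_in_line: "u \<in> I \<rightarrow>\<^sub>E UNIV \<Longrightarrow> u \<in> line I u"
  unfolding line_def by (rule range_eqI[of _ _ 1]) (auto simp: PiE_restrict)

lemma line_scale: "t \<noteq> 0 \<Longrightarrow> line I (\<lambda>i\<in>I. t * u i) = line I u"
proof (intro equalityI subsetI)
  fix x assume "t \<noteq> 0" "x \<in> line I u"
  then obtain c where "x = (\<lambda>i\<in>I. c * u i)" by (auto simp: line_def)
  then have "x = (\<lambda>i\<in>I. (c / t) * (\<lambda>i\<in>I. t * u i) i)"
    using \<open>t \<noteq> 0\<close> by (auto simp: fun_eq_iff)
  then show "x \<in> line I (\<lambda>i\<in>I. t * u i)" unfolding line_def by (rule range_eqI)
next
  fix x assume "x \<in> line I (\<lambda>i\<in>I. t * u i)"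
  then obtain c where "x = (\<lambda>i\<in>I. c * (\<lambda>i\<in>I. t * u i) i)" by (auto simp: line_def)
  then have "x = (\<lambda>i\<in>I. (c * t) * u i)" by (auto simp: fun_eq_iff)
  then show "x \<in> line I u" by (auto simp: line_def)
qed

lemma nonzeros_line:
  assumes "u \<in> nz_vectors I"
  shows "nonzeros I (line I u) = {\<lambda>i\<in>I. t * u i | t. t \<noteq> 0}"
proof (intro equalityI subsetI)
  fix x assume "x \<in> nonzeros I (line I u)"
  then obtain t where t: "x = (\<lambda>i\<in>I. t * u i)" "x \<noteq> (\<lambda>i\<in>I. 0)"
    by (auto simp: nonzeros_def line_def)
  then have "t \<noteq> 0" by auto
  with t show "x \<in> {\<lambda>i\<in>I. t * u i | t. t \<noteq> 0}" by blast
next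
  fix x assume "x \<in> {\<lambda>i\<in>I. t * u i | t. t \<noteq> 0}"
  then obtain t where "x = (\<lambda>i\<in>I. t * u i)" "t \<noteq> 0" by blast
  then show "x \<in> nonzeros I (line I u)"
    using scale_nz_vectors[OF assms] by (auto simp: nonzeros_def line_def nz_vectors_def)
qed

lemma line_eqD:
  assumes "line I u = line I v" "u \<in> nz_vectors I" "v \<in> nz_vectors I"
  obtains t where "t \<noteq> 0" "v = (\<lambda>i\<in>I. t * u i)"
proof -
  have "v \<in> nonzeros I (line I u)"
    using assms self_in_line[of v I] by (auto simp: nonzeros_def nz_vectors_def)
  then show ?thesis using nonzeros_line[OF assms(2)] that by auto
qed

lemma sub_dim_eq_1_iff_line:
  fixes L :: "('i \<Rightarrow> 'k::field) set"
  assumes "finite I" and L: "VectorSpace.subspace class_ring L (func_vs I)"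
  shows "sub_dim (func_vs I) L = 1 \<longleftrightarrow> (\<exists>u\<in>nz_vectors I. L = line I u)"
proof -
  interpret V: vectorspace class_ring "func_vs I :: ('k, 'i \<Rightarrow> 'k) module"
    by (rule vectorspace_func_vs)
  interpret W: vectorspace class_ring "V.vs L" by (rule V.subspace_is_vs[OF L])
  have "W.fin_dim" by (rule V.fin_dim_subspace[OF fin_dim_func_vs[OF assms(1)] L])
  moreover have "L \<subseteq> I \<rightarrow>\<^sub>E UNIV" using submodule.subset[OF V.is_module[OF L]] by simp
  moreover have "u \<in> L" if "L = line I u" "u \<in> I \<rightarrow>\<^sub>E UNIV" for u
    using that self_in_line by blast
  moreover have "{c \<odot>\<^bsub>V.vs L\<^esub> u | c. c \<in> carrier class_ring} = line I u" for u
    by (auto simp: line_def)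
  ultimately show ?thesis
    using W.dim_eq_1_iff by (auto simp: nz_vectors_def)
qed

lemma subspace_line:
  fixes u :: "'i \<Rightarrow> 'k::field"
  assumes "u \<in> I \<rightarrow>\<^sub>E UNIV"
  shows "VectorSpace.subspace class_ring (line I u) (func_vs I)"
    "LinearCombinations.module.span class_ring (func_vs I) {u} = line I u"
proof -
  interpret V: vectorspace class_ring "func_vs I :: ('k, 'i \<Rightarrow> 'k) module"
    by (rule vectorspace_func_vs)
  show *: "V.span {u} = line I u"
    using V.span_singleton[of u] assms by (auto simp: line_def full_SetCompr_eq)
  show "VectorSpace.subspace class_ring (line I u) (func_vs I)"
    using V.span_is_subspace[of "{u}"] assms unfolding * by simp
qed

lemma proj_points_eq: "finite I \<Longrightarrow> proj_points I = line I ` nz_vectors I"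
  using sub_dim_eq_1_iff_line[of I] subspace_line(1)
  by (auto simp: proj_points_def nz_vectors_def image_iff Bex_def)

lemma proj_pointsE:
  assumes "finite I" "L \<in> proj_points I"
  obtains u where "u \<in> nz_vectors I" "L = line I u"
  using assms by (auto simp: proj_points_eq)

lemma line_in_proj_nonvanishing:
  assumes "finite I" "homogeneous I e F" "u \<in> nz_vectors I"
  shows "line I u \<in> proj_nonvanishing I F \<longleftrightarrow> peval F u \<noteq> 0"
proof -
  have "u \<in> nonzeros I (line I u)"
    using assms(3) self_in_line[of u I] by (auto simp: nonzeros_def nz_vectors_def)
  moreover have "peval F (\<lambda>i\<in>I. t * u i) = t ^ e * peval F u" for t
    by (rule form_scale[OF form_peval[OF assms(2)]])
  ultimately show ?thesis
    using assms by (auto simp: proj_nonvanishing_def proj_points_eq nonzeros_line)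
qed

lemma proj_nonvanishing_subset: "proj_nonvanishing I F \<subseteq> proj_points I"
  by (auto simp: proj_nonvanishing_def)

text \<open>
  Nonvanishing loci of forms are a basis of the topology because forms can be multiplied.
  Points are replaced by nonzero vectors that span them, since polynomial maps are given on vectors.
\<close>

lemma openin_proj_space:
  assumes "finite I"
  shows "openin (ktop (proj_space I)) N \<longleftrightarrow> N \<subseteq> proj_points I \<and>
    (\<forall>u\<in>nz_vectors I. line I u \<in> N \<longrightarrow>
      (\<exists>e p. form I e p \<and> p u \<noteq> 0 \<and> (\<forall>v\<in>nz_vectors I. p v \<noteq> 0 \<longrightarrow> line I v \<in> N)))"
proof -
  let ?S = "{proj_nonvanishing I F | F e. homogeneous I e F}"
  have "A \<inter> B \<in> ?S" if AB_in: "A \<in> ?S" "B \<in> ?S" for A B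
  proof -
    obtain F G e e' where AB: "A = proj_nonvanishing I F" "B = proj_nonvanishing I G"
      and FG: "homogeneous I e F" "homogeneous I e' G"
      using AB_in by blast
    obtain H where H: "homogeneous I (e + e') H" "(\<lambda>x. peval F x * peval G x) = peval H"
      using form_mult[OF form_peval[OF FG(1)] form_peval[OF FG(2)]] unfolding form_def by blast
    then have "peval H x = peval F x * peval G x" for x by metis
    then have "A \<inter> B = proj_nonvanishing I H"
      unfolding AB proj_nonvanishing_def by auto
    then show ?thesis using H by blast
  qed
  then have "openin (ktop (proj_space I)) N \<longleftrightarrow> (\<forall>L\<in>N. \<exists>B\<in>?S. L \<in> B \<and> B \<subseteq> N)"
    unfolding proj_space_def Let_def kspace.simps by (rule openin_topology_generated_by_basis)
  also have "\<dots> \<longleftrightarrow> N \<subseteq> proj_points I \<and>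
    (\<forall>u\<in>nz_vectors I. line I u \<in> N \<longrightarrow>
      (\<exists>e p. form I e p \<and> p u \<noteq> 0 \<and> (\<forall>v\<in>nz_vectors I. p v \<noteq> 0 \<longrightarrow> line I v \<in> N)))"
    (is "?l \<longleftrightarrow> ?r")
  proof
    assume l: ?l
    have "L \<in> proj_points I" if "L \<in> N" for L
      using bspec[OF l that] by (auto simp: proj_nonvanishing_def)
    then have "N \<subseteq> proj_points I" by blast
    moreover have "\<exists>e p. form I e p \<and> p u \<noteq> 0 \<and> (\<forall>v\<in>nz_vectors I. p v \<noteq> 0 \<longrightarrow> line I v \<in> N)"
      if u: "u \<in> nz_vectors I" "line I u \<in> N" for u
    proof -
      obtain F e where F: "homogeneous I e F" "line I u \<in> proj_nonvanishing I F"
          "proj_nonvanishing I F \<subseteq> N"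
        using l u(2) by blast
      then have "peval F u \<noteq> 0" "\<forall>v\<in>nz_vectors I. peval F v \<noteq> 0 \<longrightarrow> line I v \<in> N"
        using line_in_proj_nonvanishing[OF assms F(1)] u(1) by auto
      then show ?thesis using form_peval[OF F(1)] by blast
    qed
    ultimately show ?r by blast
  next
    assume r: ?r
    show ?l
    proof
      fix L assume "L \<in> N"
      then have "L \<in> proj_points I" using r by blast
      then obtain u where u: "u \<in> nz_vectors I" "L = line I u"
        by (rule proj_pointsE[OF assms])
      have "line I u \<in> N" using u \<open>L \<in> N\<close> by simp
      then obtain e p where p: "form I e p" "p u \<noteq> 0" "\<forall>v\<in>nz_vectors I. p v \<noteq> 0 \<longrightarrow> line I v \<in> N"
        using r u(1) by blast
      then obtain F where F: "homogeneous I e F" "peval F u \<noteq> 0"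
          "\<forall>v\<in>nz_vectors I. peval F v \<noteq> 0 \<longrightarrow> line I v \<in> N"
        unfolding form_def by blast
      have "L \<in> proj_nonvanishing I F"
        using line_in_proj_nonvanishing[OF assms F(1)] F(2) u by simp
      moreover have "proj_nonvanishing I F \<subseteq> N"
      proof
        fix L' assume L': "L' \<in> proj_nonvanishing I F"
        then have "L' \<in> proj_points I" using proj_nonvanishing_subset by blast
        then obtain v where v: "v \<in> nz_vectors I" "L' = line I v"
          by (rule proj_pointsE[OF assms])
        then have "peval F v \<noteq> 0" using line_in_proj_nonvanishing[OF assms F(1)] L' by simp
        then show "L' \<in> N" using F(3) v by simp
      qed
      ultimately show "\<exists>B\<in>?S. L \<in> B \<and> B \<subseteq> N" using F(1) by blast
    qed
  qed
  finally show ?thesis .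
qed

lemma topspace_proj_space:
  assumes "finite I"
  shows "topspace (ktop (proj_space I)) = proj_points I"
proof (rule antisym)
  show "topspace (ktop (proj_space I)) \<subseteq> proj_points I"
    using openin_topspace[of "ktop (proj_space I)"] unfolding openin_proj_space[OF assms] by blast
  have "openin (ktop (proj_space I)) (proj_points I)"
    unfolding openin_proj_space[OF assms]
    using proj_points_eq[OF assms] form_const[of I 1] by fastforce
  then show "proj_points I \<subseteq> topspace (ktop (proj_space I))" by (rule openin_subset)
qed

lemma kreg_proj_space:
  assumes "finite I" "N \<subseteq> proj_points I"
  shows "r \<in> kreg (proj_space I) N \<longleftrightarrow>
    (\<forall>u\<in>nz_vectors I. line I u \<in> N \<longrightarrow>
      (\<exists>e' s e p q. form I e' s \<and> form I e p \<and> form I e q \<and> s u \<noteq> 0 \<and>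
        (\<forall>v\<in>nz_vectors I. s v \<noteq> 0 \<longrightarrow>
          line I v \<in> N \<and> q v \<noteq> 0 \<and> r (line I v) = p v / q v)))"
    (is "?l \<longleftrightarrow> ?r")
proof -
  let ?T = "ktop (proj_space I)"
  have kreg: "r \<in> kreg (proj_space I) N \<longleftrightarrow> (\<forall>L\<in>N. \<exists>M e F G. openin ?T M \<and> L \<in> M \<and> M \<subseteq> N \<and>
      homogeneous I e F \<and> homogeneous I e G \<and>
      (\<forall>L'\<in>M. \<forall>x\<in>nonzeros I L'. peval G x \<noteq> 0 \<and> r L' = peval F x / peval G x))"
    by (simp add: proj_space_def Let_def)
  show ?thesis
  proof
    assume l: ?l
    show ?r
    proof (intro ballI impI)
      fix u assume u: "u \<in> nz_vectors I" "line I u \<in> N"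
      obtain M e F G where M: "openin ?T M" "line I u \<in> M" "M \<subseteq> N"
          and FG: "homogeneous I e F" "homogeneous I e G"
          "\<forall>L'\<in>M. \<forall>x\<in>nonzeros I L'. peval G x \<noteq> 0 \<and> r L' = peval F x / peval G x"
        using l[unfolded kreg] u(2) by meson
      obtain e' s where s: "form I e' s" "s u \<noteq> 0" "\<forall>v\<in>nz_vectors I. s v \<noteq> 0 \<longrightarrow> line I v \<in> M"
        using M u(1) unfolding openin_proj_space[OF assms(1)] by blast
      have "line I v \<in> N \<and> peval G v \<noteq> 0 \<and> r (line I v) = peval F v / peval G v"
        if v: "v \<in> nz_vectors I" "s v \<noteq> 0" for v
      proof -
        have "line I v \<in> M" using s v by blast
        moreover have "v \<in> nonzeros I (line I v)"
          using v(1) self_in_line[of v I] by (auto simp: nonzeros_def nz_vectors_def)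
        ultimately show ?thesis using FG(3) M(3) by blast
      qed
      then show "\<exists>e' s e p q. form I e' s \<and> form I e p \<and> form I e q \<and> s u \<noteq> 0 \<and>
        (\<forall>v\<in>nz_vectors I. s v \<noteq> 0 \<longrightarrow>
          line I v \<in> N \<and> q v \<noteq> 0 \<and> r (line I v) = p v / q v)"
        using s(1,2) form_peval[OF FG(1)] form_peval[OF FG(2)] by blast
    qed
  next
    assume r: ?r
    show ?l unfolding kreg
    proof
      fix L assume "L \<in> N"
      then have "L \<in> proj_points I" using assms(2) by blast
      then obtain u where u: "u \<in> nz_vectors I" "L = line I u"
        by (rule proj_pointsE[OF assms(1)])
      have "line I u \<in> N" using u \<open>L \<in> N\<close> by simp
      from r[rule_format, OF u(1) this] obtain e' s e p q where
          spq: "form I e' s" "form I e p" "form I e q" "s u \<noteq> 0"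
          "\<forall>v\<in>nz_vectors I. s v \<noteq> 0 \<longrightarrow> line I v \<in> N \<and> q v \<noteq> 0 \<and> r (line I v) = p v / q v"
        by blast
      obtain S F G where S: "homogeneous I e' S" "s = peval S"
          and FG: "homogeneous I e F" "homogeneous I e G" and pq: "p = peval F" "q = peval G"
        using spq(1-3) unfolding form_def by blast
      note reg = spq(5)[unfolded S(2) pq]
      let ?M = "proj_nonvanishing I S"
      have "openin ?T ?M"
        unfolding proj_space_def Let_def kspace.simps
        by (rule topology_generated_by_Basis) (use S in blast)
      moreover have "L \<in> ?M"
        using line_in_proj_nonvanishing[OF assms(1) S(1)] spq(4)[unfolded S(2)] u by simp
      moreover have M: "L' \<in> N \<and> (\<forall>x\<in>nonzeros I L'. peval G x \<noteq> 0 \<and> r L' = peval F x / peval G x)"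
        if L': "L' \<in> ?M" for L'
      proof -
        have "L' \<in> proj_points I" using L' proj_nonvanishing_subset by blast
        then obtain v where v: "v \<in> nz_vectors I" "L' = line I v"
          by (rule proj_pointsE[OF assms(1)])
        have Sv: "peval S v \<noteq> 0"
          using L' line_in_proj_nonvanishing[OF assms(1) S(1) v(1)] v(2) by simp
        have "peval G x \<noteq> 0 \<and> r L' = peval F x / peval G x" if x: "x \<in> nonzeros I L'" for x
        proof -
          obtain t where "t \<noteq> 0" "x = (\<lambda>i\<in>I. t * v i)"
            using x nonzeros_line[OF v(1)] v(2) by auto
          then have "peval F x = t ^ e * peval F v" "peval G x = t ^ e * peval G v"
            using form_scale[OF form_peval[OF FG(1)]] form_scale[OF form_peval[OF FG(2)]] by blast+
          moreover have "peval G v \<noteq> 0" "r L' = peval F v / peval G v"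
            using bspec[OF reg v(1)] v(2) Sv by auto
          ultimately show ?thesis using \<open>t \<noteq> 0\<close> by simp
        qed
        then show ?thesis using bspec[OF reg v(1)] v(2) Sv by auto
      qed
      ultimately show "\<exists>M e F G. openin ?T M \<and> L \<in> M \<and> M \<subseteq> N \<and>
          homogeneous I e F \<and> homogeneous I e G \<and>
          (\<forall>L'\<in>M. \<forall>x\<in>nonzeros I L'. peval G x \<noteq> 0 \<and> r L' = peval F x / peval G x)"
        using FG(1,2) by blast
    qed
  qed
qed

text \<open>
  Substituting forms of one degree \<open>e\<close> turns forms into forms, so basic open sets and fractions
  of forms pull back to such. The extra factor \<open>s\<close> cuts down to the chart on which the map has no
  base points.
\<close>

lemma local_morphism_proj_space:
  assumes I: "finite I" and J: "finite J" and s: "form I e0 s"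
    and G: "\<And>j. j \<in> J \<Longrightarrow> form I e (\<lambda>u. G u j)"
    and nz: "\<And>u. u \<in> nz_vectors I \<Longrightarrow> s u \<noteq> 0 \<Longrightarrow> G u \<in> nz_vectors J"
    and F: "\<And>u. u \<in> nz_vectors I \<Longrightarrow> s u \<noteq> 0 \<Longrightarrow> F (line I u) = line J (G u)"
  shows "local_morphism (proj_space I) (proj_space J) {line I u | u. u \<in> nz_vectors I \<and> s u \<noteq> 0} F"
    (is "local_morphism _ _ ?N F")
proof -
  have in_N: "line I u \<in> ?N \<longleftrightarrow> s u \<noteq> 0" if u: "u \<in> nz_vectors I" for u
  proof
    assume "line I u \<in> ?N"
    then obtain v where v: "line I u = line I v" "v \<in> nz_vectors I" "s v \<noteq> 0" by auto
    from line_eqD[OF v(1) u v(2)] obtain t where "v = (\<lambda>i\<in>I. t * u i)" by metis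
    then show "s u \<noteq> 0" using v(3) form_scale[OF s, of t u] by auto
  qed (use u in auto)
  have N: "?N \<subseteq> proj_points I" by (auto simp: proj_points_eq[OF I])
  have subst: "form I (e0 + e * e') (\<lambda>u. s u * p (G u))" if "form J e' p" for e' p
    by (rule form_mult[OF s form_compose[OF G that]])
  have open_preimage: "openin (ktop (proj_space I)) {L \<in> ?N. F L \<in> U}"
    if U: "openin (ktop (proj_space J)) U" for U
    unfolding openin_proj_space[OF I]
  proof (intro conjI ballI impI)
    fix u assume u: "u \<in> nz_vectors I" "line I u \<in> {L \<in> ?N. F L \<in> U}"
    then have su: "s u \<noteq> 0" using in_N by blast
    then have "line J (G u) \<in> U" using u F by simp
    then obtain e' p where p: "form J e' p" "p (G u) \<noteq> 0"
        "\<forall>w\<in>nz_vectors J. p w \<noteq> 0 \<longrightarrow> line J w \<in> U"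
      using U nz[OF u(1) su] unfolding openin_proj_space[OF J] by blast
    have "line I v \<in> {L \<in> ?N. F L \<in> U}" if v: "v \<in> nz_vectors I" "s v * p (G v) \<noteq> 0" for v
    proof -
      have "s v \<noteq> 0" "p (G v) \<noteq> 0" using v(2) by auto
      then show ?thesis using p(3) nz[OF v(1)] F[OF v(1)] in_N[OF v(1)] by simp
    qed
    then show "\<exists>e p. form I e p \<and> p u \<noteq> 0 \<and>
        (\<forall>v\<in>nz_vectors I. p v \<noteq> 0 \<longrightarrow> line I v \<in> {L \<in> ?N. F L \<in> U})"
      using subst[OF p(1)] su p(2)
      by (intro exI[of _ "e0 + e * e'"] exI[of _ "\<lambda>u. s u * p (G u)"]) auto
  qed (use N in blast)
  moreover have "r \<circ> F \<in> kreg (proj_space I) {L \<in> ?N. F L \<in> U}"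
    if U: "openin (ktop (proj_space J)) U" and r: "r \<in> kreg (proj_space J) U" for U r
  proof -
    have sub: "{L \<in> ?N. F L \<in> U} \<subseteq> proj_points I" using N by blast
    have U_sub: "U \<subseteq> proj_points J" using U unfolding openin_proj_space[OF J] by blast
    show ?thesis unfolding kreg_proj_space[OF I sub]
    proof (intro ballI impI)
      fix u assume u: "u \<in> nz_vectors I" "line I u \<in> {L \<in> ?N. F L \<in> U}"
      then have su: "s u \<noteq> 0" using in_N by blast
      then have "line J (G u) \<in> U" using u F by simp
      from r[unfolded kreg_proj_space[OF J U_sub], rule_format, OF nz[OF u(1) su] this]
      obtain e' s' e'' p q where pq: "form J e' s'" "form J e'' p" "form J e'' q" "s' (G u) \<noteq> 0"
          "\<forall>w\<in>nz_vectors J. s' w \<noteq> 0 \<longrightarrow> line J w \<in> U \<and> q w \<noteq> 0 \<and> r (line J w) = p w / q w"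
        by blast
      have "line I v \<in> {L \<in> ?N. F L \<in> U} \<and> q (G v) \<noteq> 0 \<and> (r \<circ> F) (line I v) = p (G v) / q (G v)"
        if v: "v \<in> nz_vectors I" "s v * s' (G v) \<noteq> 0" for v
      proof -
        have sv: "s v \<noteq> 0" "s' (G v) \<noteq> 0" using v(2) by auto
        show ?thesis
          using bspec[OF pq(5) nz[OF v(1) sv(1)]] F[OF v(1) sv(1)] in_N[OF v(1)] sv by simp
      qed
      then show "\<exists>e' s e p q. form I e' s \<and> form I e p \<and> form I e q \<and> s u \<noteq> 0 \<and>
          (\<forall>v\<in>nz_vectors I. s v \<noteq> 0 \<longrightarrow> line I v \<in> {L \<in> ?N. F L \<in> U} \<and>
            q v \<noteq> 0 \<and> (r \<circ> F) (line I v) = p v / q v)"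
        using subst[OF pq(1)] form_compose[OF G pq(2)] form_compose[OF G pq(3)] su pq(4)
        by (intro exI[of _ "e0 + e * e'"] exI[of _ "\<lambda>u. s u * s' (G u)"] exI[of _ "e * e''"]
            exI[of _ "\<lambda>u. p (G u)"] exI[of _ "\<lambda>u. q (G u)"]) auto
    qed
  qed
  moreover have "openin (ktop (proj_space I)) ?N"
    unfolding openin_proj_space[OF I] using N s in_N by blast
  ultimately show ?thesis unfolding local_morphism_def by blast
qed

locale function_algebra =
  fixes A :: "('x \<Rightarrow> 'k::field) set"
  assumes const: "(\<lambda>_. c) \<in> A"
    and add: "p \<in> A \<Longrightarrow> q \<in> A \<Longrightarrow> (\<lambda>x. p x + q x) \<in> A"
    and mult: "p \<in> A \<Longrightarrow> q \<in> A \<Longrightarrow> (\<lambda>x. p x * q x) \<in> A"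
begin

lemma openin_affine_kspace:
  "openin (ktop (affine_kspace S A)) N \<longleftrightarrow>
    N \<subseteq> S \<and> (\<forall>x\<in>N. \<exists>p\<in>A. p x \<noteq> 0 \<and> (\<forall>y\<in>S. p y \<noteq> 0 \<longrightarrow> y \<in> N))"
proof -
  let ?B = "{{x \<in> S. p x \<noteq> 0} | p. p \<in> A}"
  have "M \<inter> M' \<in> ?B" if MM: "M \<in> ?B" "M' \<in> ?B" for M M'
  proof -
    obtain p where p: "p \<in> A" "M = {x \<in> S. p x \<noteq> 0}" using MM(1) by blast
    obtain q where q: "q \<in> A" "M' = {x \<in> S. q x \<noteq> 0}" using MM(2) by blast
    have "M \<inter> M' = {x \<in> S. p x * q x \<noteq> 0}"
      unfolding p(2) q(2) by auto
    with mult[OF p(1) q(1)] show ?thesis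
      unfolding mem_Collect_eq by (intro exI[of _ "\<lambda>x. p x * q x"] conjI)
  qed
  then have "openin (ktop (affine_kspace S A)) N \<longleftrightarrow> (\<forall>x\<in>N. \<exists>B\<in>?B. x \<in> B \<and> B \<subseteq> N)"
    unfolding affine_kspace_def Let_def kspace.simps by (rule openin_topology_generated_by_basis)
  also have "\<dots> \<longleftrightarrow> N \<subseteq> S \<and> (\<forall>x\<in>N. \<exists>p\<in>A. p x \<noteq> 0 \<and> (\<forall>y\<in>S. p y \<noteq> 0 \<longrightarrow> y \<in> N))"
    (is "?l \<longleftrightarrow> ?r")
  proof
    assume l: ?l
    have *: "\<exists>p\<in>A. x \<in> S \<and> p x \<noteq> 0 \<and> (\<forall>y\<in>S. p y \<noteq> 0 \<longrightarrow> y \<in> N)" if "x \<in> N" for x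
    proof -
      obtain p where "p \<in> A" "x \<in> {x \<in> S. p x \<noteq> 0}" "{x \<in> S. p x \<noteq> 0} \<subseteq> N"
        using bspec[OF l \<open>x \<in> N\<close>] by auto
      then show ?thesis by (intro bexI[of _ p]) auto
    qed
    then show ?r by (meson subsetI)
  next
    assume r: ?r
    show ?l
    proof
      fix x assume x: "x \<in> N"
      then obtain p where p: "p \<in> A" "p x \<noteq> 0" "\<forall>y\<in>S. p y \<noteq> 0 \<longrightarrow> y \<in> N" using r by blast
      have "{x \<in> S. p x \<noteq> 0} \<in> ?B" using p(1) by blast
      moreover have "x \<in> {x \<in> S. p x \<noteq> 0}" using r x p(2) by blast
      moreover have "{x \<in> S. p x \<noteq> 0} \<subseteq> N" using p(3) by blast
      ultimately show "\<exists>B\<in>?B. x \<in> B \<and> B \<subseteq> N" by blast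
    qed
  qed
  finally show ?thesis .
qed

lemma topspace_affine_kspace: "topspace (ktop (affine_kspace S A)) = S"
proof (rule antisym)
  show "topspace (ktop (affine_kspace S A)) \<subseteq> S"
    using openin_topspace[of "ktop (affine_kspace S A)"] unfolding openin_affine_kspace by blast
  have "openin (ktop (affine_kspace S A)) S"
    unfolding openin_affine_kspace by (auto intro: bexI[OF _ const[of 1]])
  then show "S \<subseteq> topspace (ktop (affine_kspace S A))" by (rule openin_subset)
qed

lemma kreg_affine_kspace:
  assumes "N \<subseteq> S"
  shows "r \<in> kreg (affine_kspace S A) N \<longleftrightarrow>
    (\<forall>x\<in>N. \<exists>s\<in>A. \<exists>p\<in>A. \<exists>q\<in>A. s x \<noteq> 0 \<and>
      (\<forall>y\<in>S. s y \<noteq> 0 \<longrightarrow> y \<in> N \<and> q y \<noteq> 0 \<and> r y = p y / q y))"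
    (is "_ \<longleftrightarrow> ?r")
proof -
  let ?T = "ktop (affine_kspace S A)"
  have "r \<in> kreg (affine_kspace S A) N \<longleftrightarrow> (\<forall>x\<in>N. \<exists>M p q. openin ?T M \<and> x \<in> M \<and> M \<subseteq> N \<and>
      p \<in> A \<and> q \<in> A \<and> (\<forall>y\<in>M. q y \<noteq> 0 \<and> r y = p y / q y))"
    by (simp add: affine_kspace_def Let_def)
  also have "\<dots> \<longleftrightarrow> ?r"
  proof (intro ball_cong refl iffI)
    fix x assume "x \<in> N"
      "\<exists>M p q. openin ?T M \<and> x \<in> M \<and> M \<subseteq> N \<and> p \<in> A \<and> q \<in> A \<and> (\<forall>y\<in>M. q y \<noteq> 0 \<and> r y = p y / q y)"
    then obtain M p q where M: "openin ?T M" "x \<in> M" "M \<subseteq> N" "p \<in> A" "q \<in> A"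
        "\<forall>y\<in>M. q y \<noteq> 0 \<and> r y = p y / q y" by blast
    then obtain s where s: "s \<in> A" "s x \<noteq> 0" "\<forall>y\<in>S. s y \<noteq> 0 \<longrightarrow> y \<in> M"
      unfolding openin_affine_kspace by blast
    then have "\<forall>y\<in>S. s y \<noteq> 0 \<longrightarrow> y \<in> N \<and> q y \<noteq> 0 \<and> r y = p y / q y"
      using M by blast
    then show "\<exists>s\<in>A. \<exists>p\<in>A. \<exists>q\<in>A. s x \<noteq> 0 \<and>
        (\<forall>y\<in>S. s y \<noteq> 0 \<longrightarrow> y \<in> N \<and> q y \<noteq> 0 \<and> r y = p y / q y)"
      using s(1,2) M(4,5) by blast
  next
    fix x assume x: "x \<in> N" and "\<exists>s\<in>A. \<exists>p\<in>A. \<exists>q\<in>A. s x \<noteq> 0 \<and>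
        (\<forall>y\<in>S. s y \<noteq> 0 \<longrightarrow> y \<in> N \<and> q y \<noteq> 0 \<and> r y = p y / q y)"
    then obtain s p q where s: "s \<in> A" "s x \<noteq> 0" and pq: "p \<in> A" "q \<in> A"
        "\<forall>y\<in>S. s y \<noteq> 0 \<longrightarrow> y \<in> N \<and> q y \<noteq> 0 \<and> r y = p y / q y" by blast
    let ?M = "{y \<in> S. s y \<noteq> 0}"
    have "openin ?T ?M" unfolding openin_affine_kspace using s(1) by blast
    moreover have "x \<in> ?M" using x assms s(2) by blast
    moreover have "?M \<subseteq> N" "\<forall>y\<in>?M. q y \<noteq> 0 \<and> r y = p y / q y" using pq(3) by blast+
    ultimately show "\<exists>M p q. openin ?T M \<and> x \<in> M \<and> M \<subseteq> N \<and> p \<in> A \<and> q \<in> A \<and>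
        (\<forall>y\<in>M. q y \<noteq> 0 \<and> r y = p y / q y)" using pq(1,2) by blast
  qed
  finally show ?thesis .
qed

abbreviation (input) quot_space :: "'x set \<Rightarrow> ('x \<Rightarrow> 'y) \<Rightarrow> ('y, 'k) kspace" where
  "quot_space S f \<equiv> quotient_kspace (affine_kspace S A) f"

lemma topspace_quotient_affine: "topspace (ktop (quot_space S f)) = f ` S"
  by (simp add: quotient_kspace_def topspace_quotient_topology topspace_affine_kspace)

lemma openin_quotient_affine:
  "openin (ktop (quot_space S f)) U \<longleftrightarrow> U \<subseteq> f ` S \<and>
    (\<forall>x\<in>S. f x \<in> U \<longrightarrow> (\<exists>p\<in>A. p x \<noteq> 0 \<and> (\<forall>y\<in>S. p y \<noteq> 0 \<longrightarrow> f y \<in> U)))"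
  by (simp add: quotient_kspace_def openin_quotient_topology topspace_affine_kspace
      openin_affine_kspace) blast

lemma kreg_quotient_affine:
  "r \<in> kreg (quot_space S f) U \<longleftrightarrow>
    (\<forall>x\<in>S. f x \<in> U \<longrightarrow> (\<exists>s\<in>A. \<exists>p\<in>A. \<exists>q\<in>A. s x \<noteq> 0 \<and>
      (\<forall>y\<in>S. s y \<noteq> 0 \<longrightarrow> f y \<in> U \<and> q y \<noteq> 0 \<and> r (f y) = p y / q y)))"
proof -
  have "r \<in> kreg (quot_space S f) U \<longleftrightarrow> r \<circ> f \<in> kreg (affine_kspace S A) {x \<in> S. f x \<in> U}"
    by (simp add: quotient_kspace_def topspace_affine_kspace)
  also have "\<dots> \<longleftrightarrow> (\<forall>x\<in>S. f x \<in> U \<longrightarrow> (\<exists>s\<in>A. \<exists>p\<in>A. \<exists>q\<in>A. s x \<noteq> 0 \<and>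
      (\<forall>y\<in>S. s y \<noteq> 0 \<longrightarrow> f y \<in> U \<and> q y \<noteq> 0 \<and> r (f y) = p y / q y)))"
    by (subst kreg_affine_kspace) auto
  finally show ?thesis .
qed

text \<open>
  A form in the polynomial coordinates of \<open>G\<close> is a polynomial function on \<open>S\<close>, so basic open sets
  and fractions of forms pull back to basic open sets and fractions on \<open>S\<close>.
\<close>

lemma variety_morphism_quotient_to_proj_space:
  assumes J: "finite J" and G: "\<And>j. j \<in> J \<Longrightarrow> (\<lambda>x. G x j) \<in> A"
    and nz: "\<And>x. x \<in> S \<Longrightarrow> G x \<in> nz_vectors J"
    and F: "\<And>x. x \<in> S \<Longrightarrow> F (f x) = line J (G x)"
  shows "variety_morphism (quot_space S f) (proj_space J) F"
proof -
  have subst: "(\<lambda>x. p (G x)) \<in> A" if "form J e p" for e p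
    using form_substitute[where A = "\<lambda>_. A" and G = G, OF _ _ _ _ G that] const add mult by blast
  have "openin (ktop (quot_space S f)) {x \<in> f ` S. F x \<in> U}"
    if U: "openin (ktop (proj_space J)) U" for U
    unfolding openin_quotient_affine
  proof (intro conjI ballI impI)
    fix x assume x: "x \<in> S" "f x \<in> {x \<in> f ` S. F x \<in> U}"
    then have "line J (G x) \<in> U" using F by simp
    then obtain e p where p: "form J e p" "p (G x) \<noteq> 0"
        "\<forall>w\<in>nz_vectors J. p w \<noteq> 0 \<longrightarrow> line J w \<in> U"
      using U nz[OF x(1)] unfolding openin_proj_space[OF J] by blast
    then have "\<forall>y\<in>S. p (G y) \<noteq> 0 \<longrightarrow> f y \<in> {x \<in> f ` S. F x \<in> U}"
      using nz F by auto
    then show "\<exists>p\<in>A. p x \<noteq> 0 \<and> (\<forall>y\<in>S. p y \<noteq> 0 \<longrightarrow> f y \<in> {x \<in> f ` S. F x \<in> U})"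
      using subst[OF p(1)] p(2) by (intro bexI[of _ "\<lambda>x. p (G x)"]) auto
  qed blast
  moreover have "r \<circ> F \<in> kreg (quot_space S f) {x \<in> f ` S. F x \<in> U}"
    if U: "openin (ktop (proj_space J)) U" and r: "r \<in> kreg (proj_space J) U" for U r
    unfolding kreg_quotient_affine
  proof (intro conjI ballI impI)
    have U_sub: "U \<subseteq> proj_points J" using U unfolding openin_proj_space[OF J] by blast
    fix x assume x: "x \<in> S" "f x \<in> {x \<in> f ` S. F x \<in> U}"
    then have "line J (G x) \<in> U" using F by simp
    from r[unfolded kreg_proj_space[OF J U_sub], rule_format, OF nz[OF x(1)] this]
    obtain e' s e p q where pq: "form J e' s" "form J e p" "form J e q" "s (G x) \<noteq> 0"
        "\<forall>w\<in>nz_vectors J. s w \<noteq> 0 \<longrightarrow> line J w \<in> U \<and> q w \<noteq> 0 \<and> r (line J w) = p w / q w"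
      by blast
    have "f y \<in> {x \<in> f ` S. F x \<in> U} \<and> q (G y) \<noteq> 0 \<and> (r \<circ> F) (f y) = p (G y) / q (G y)"
      if "y \<in> S" "s (G y) \<noteq> 0" for y
      using bspec[OF pq(5) nz[OF that(1)]] F[OF that(1)] that by auto
    then show "\<exists>s\<in>A. \<exists>p\<in>A. \<exists>q\<in>A. s x \<noteq> 0 \<and> (\<forall>y\<in>S. s y \<noteq> 0 \<longrightarrow>
        f y \<in> {x \<in> f ` S. F x \<in> U} \<and> q y \<noteq> 0 \<and> (r \<circ> F) (f y) = p y / q y)"
      using subst[OF pq(1)] subst[OF pq(2)] subst[OF pq(3)] pq(4)
      by (intro bexI[of _ "\<lambda>x. s (G x)"] bexI[of _ "\<lambda>x. p (G x)"] bexI[of _ "\<lambda>x. q (G x)"]) auto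
  qed
  moreover have "F ` f ` S \<subseteq> topspace (ktop (proj_space J))"
    using F nz by (auto simp: topspace_proj_space[OF J] proj_points_eq[OF J])
  moreover have "openin (ktop (quot_space S f)) (f ` S)"
    using openin_topspace[of "ktop (quot_space S f)"] by (simp only: topspace_quotient_affine)
  ultimately show ?thesis
    unfolding variety_morphism_iff_local local_morphism_def topspace_quotient_affine by blast
qed

text \<open>
  A function \<open>a \<in> A\<close> pulls back to a polynomial function \<open>\<Sum>\<^sub>e P\<^sub>e\<close> that need not be homogeneous. Its
  value at \<open>t u\<close> is the polynomial \<open>\<Sum>\<^sub>e t\<^sup>e P\<^sub>e(u)\<close> in \<open>t\<close>. If some \<open>P\<^sub>e(u)\<close> is nonzero, then \<open>a\<close> is nonzero
  at the image of \<open>t u\<close> for all but finitely many \<open>t\<close>, and all \<open>t u\<close> span the same line; this gives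
  continuity. If \<open>r = p / q\<close> on the quotient, with components \<open>P\<^sub>e\<close> and \<open>Q\<^sub>e\<close> of the pullbacks,
  then \<open>\<Sum>\<^sub>e t\<^sup>e P\<^sub>e(u) = r \<cdot> \<Sum>\<^sub>e t\<^sup>e Q\<^sub>e(u)\<close> for infinitely many \<open>t\<close>, so \<open>P\<^sub>e(u) = r \<cdot> Q\<^sub>e(u)\<close> for each \<open>e\<close>, and
  \<open>P\<^sub>b / Q\<^sub>b\<close> with \<open>Q\<^sub>b(u) \<noteq> 0\<close> is a fraction of forms of equal degree that represents \<open>r\<close>.
\<close>

lemma variety_morphism_proj_space_to_quotient:
  assumes inf: "infinite (UNIV :: 'k set)" and I: "finite I"
    and G: "\<And>a. a \<in> A \<Longrightarrow> polyfun I (\<lambda>u. a (G u))"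
    and S: "\<And>u. u \<in> nz_vectors I \<Longrightarrow> G u \<in> S"
    and F: "\<And>u. u \<in> nz_vectors I \<Longrightarrow> F (line I u) = f (G u)"
  shows "variety_morphism (proj_space I) (quot_space S f) F"
proof -
  have scale: "F (line I u) = f (G (\<lambda>i\<in>I. t * u i))" if "u \<in> nz_vectors I" "t \<noteq> 0" for u t
    using F[OF scale_nz_vectors[OF that]] unfolding line_scale[OF that(2)] .
  \<comment> \<open>Both halves of the proof use the last two clauses: where \<open>a\<close> is nonzero some component is, and a nonzero component leaves only finitely many zeros of \<open>a\<close> on a line.\<close>
  have components: "\<exists>n P. (\<forall>e. form I e (P e)) \<and>
      (\<forall>N u t. N \<ge> n \<longrightarrow> a (G (\<lambda>i\<in>I. t * u i)) = (\<Sum>e<N. t ^ e * P e u)) \<and>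
      (\<forall>u\<in>nz_vectors I. a (G u) \<noteq> 0 \<longrightarrow> (\<exists>e. P e u \<noteq> 0)) \<and>
      (\<forall>u e. P e u \<noteq> 0 \<longrightarrow> finite {t. a (G (\<lambda>i\<in>I. t * u i)) = 0})"
    if "a \<in> A" for a
  proof -
    obtain n P where P: "\<And>e. form I e (P e)" "\<And>N u. N \<ge> n \<Longrightarrow> a (G u) = (\<Sum>e<N. P e u)"
      using polyfun_components[OF G[OF \<open>a \<in> A\<close>]] by metis
    have exp: "a (G (\<lambda>i\<in>I. t * u i)) = (\<Sum>e<N. t ^ e * P e u)" if "N \<ge> n" for N u t
      using P(2)[OF that] form_scale[OF P(1)] by simp
    have "\<exists>e. P e u \<noteq> 0" if "a (G u) \<noteq> 0" for u
      using that P(2)[of n u] by (metis order_refl sum.neutral)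
    moreover have "finite {t. a (G (\<lambda>i\<in>I. t * u i)) = 0}" if "P e u \<noteq> 0" for u e
      using finite_roots_sum[of e "max n (Suc e)" "\<lambda>e. P e u"] that
      by (simp add: exp[of "max n (Suc e)"])
    ultimately show ?thesis using P(1) exp by blast
  qed
  have N_sub: "{L \<in> proj_points I. F L \<in> U} \<subseteq> proj_points I" for U by blast
  have "openin (ktop (proj_space I)) {L \<in> proj_points I. F L \<in> U}"
    if U: "openin (ktop (quot_space S f)) U" for U
    unfolding openin_proj_space[OF I]
  proof (intro conjI ballI impI N_sub)
    fix u assume u: "u \<in> nz_vectors I" "line I u \<in> {L \<in> proj_points I. F L \<in> U}"
    then have "f (G u) \<in> U" using F by simp
    then obtain a where a: "a \<in> A" "a (G u) \<noteq> 0" "\<forall>y\<in>S. a y \<noteq> 0 \<longrightarrow> f y \<in> U"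
      using U S[OF u(1)] unfolding openin_quotient_affine by blast
    obtain P where P: "\<forall>e. form I e (P e)"
        "\<forall>u\<in>nz_vectors I. a (G u) \<noteq> 0 \<longrightarrow> (\<exists>e. P e u \<noteq> 0)"
        "\<forall>u e. P e u \<noteq> 0 \<longrightarrow> finite {t. a (G (\<lambda>i\<in>I. t * u i)) = 0}"
      using components[OF a(1)] by blast
    obtain e where e: "P e u \<noteq> 0" using P(2) u(1) a(2) by blast
    have "line I v \<in> {L \<in> proj_points I. F L \<in> U}" if v: "v \<in> nz_vectors I" "P e v \<noteq> 0" for v
    proof -
      have "finite (insert 0 {t. a (G (\<lambda>i\<in>I. t * v i)) = 0})" using P(3) v(2) by blast
      then obtain t where "t \<notin> insert 0 {t. a (G (\<lambda>i\<in>I. t * v i)) = 0}"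
        using inf ex_new_if_finite by blast
      then have t: "t \<noteq> 0" "a (G (\<lambda>i\<in>I. t * v i)) \<noteq> 0" by auto
      then have "F (line I v) \<in> U"
        using a(3) S[OF scale_nz_vectors[OF v(1) t(1)]] scale[OF v(1) t(1)] by simp
      then show ?thesis using v(1) by (simp add: proj_points_eq[OF I])
    qed
    then show "\<exists>e p. form I e p \<and> p u \<noteq> 0 \<and>
        (\<forall>v\<in>nz_vectors I. p v \<noteq> 0 \<longrightarrow> line I v \<in> {L \<in> proj_points I. F L \<in> U})"
      using P(1) e by blast
  qed
  moreover have "r \<circ> F \<in> kreg (proj_space I) {L \<in> proj_points I. F L \<in> U}"
    if U: "openin (ktop (quot_space S f)) U" and r: "r \<in> kreg (quot_space S f) U" for U r
    unfolding kreg_proj_space[OF I N_sub]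
  proof (intro ballI impI)
    fix u assume u: "u \<in> nz_vectors I" "line I u \<in> {L \<in> proj_points I. F L \<in> U}"
    then have "f (G u) \<in> U" using F by simp
    from r[unfolded kreg_quotient_affine, rule_format, OF S[OF u(1)] this]
    obtain s p q where A: "s \<in> A" "p \<in> A" "q \<in> A" and su: "s (G u) \<noteq> 0"
        and reg: "\<forall>y\<in>S. s y \<noteq> 0 \<longrightarrow> f y \<in> U \<and> q y \<noteq> 0 \<and> r (f y) = p y / q y"
      by blast
    obtain T where T: "\<forall>e. form I e (T e)"
        "\<forall>u\<in>nz_vectors I. s (G u) \<noteq> 0 \<longrightarrow> (\<exists>e. T e u \<noteq> 0)"
        "\<forall>u e. T e u \<noteq> 0 \<longrightarrow> finite {t. s (G (\<lambda>i\<in>I. t * u i)) = 0}"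
      using components[OF A(1)] by blast
    obtain n P where P: "\<forall>e. form I e (P e)"
        "\<forall>N u t. N \<ge> n \<longrightarrow> p (G (\<lambda>i\<in>I. t * u i)) = (\<Sum>e<N. t ^ e * P e u)"
      using components[OF A(2)] by blast
    obtain n' Q where Q: "\<forall>e. form I e (Q e)"
        "\<forall>N u t. N \<ge> n' \<longrightarrow> q (G (\<lambda>i\<in>I. t * u i)) = (\<Sum>e<N. t ^ e * Q e u)"
        "\<forall>u\<in>nz_vectors I. q (G u) \<noteq> 0 \<longrightarrow> (\<exists>e. Q e u \<noteq> 0)"
      using components[OF A(3)] by blast
    have "q (G u) \<noteq> 0" using reg S[OF u(1)] su by blast
    then obtain a b where ab: "T a u \<noteq> 0" "Q b u \<noteq> 0" using T(2) Q(3) u(1) su by blast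
    have "line I v \<in> {L \<in> proj_points I. F L \<in> U} \<and> Q b v \<noteq> 0 \<and>
        (r \<circ> F) (line I v) = P b v / Q b v"
      if v: "v \<in> nz_vectors I" "T a v * Q b v \<noteq> 0" for v
    proof -
      \<comment> \<open>The \<open>t\<close> for which \<open>t v\<close> is zero or \<open>s\<close>, hence possibly \<open>q\<close>, vanishes at its image.\<close>
      let ?bad = "insert 0 {t. s (G (\<lambda>i\<in>I. t * v i)) = 0}"
      have fin: "finite ?bad" using T(3) v(2) by auto
      have good: "F (line I v) \<in> U \<and> q (G (\<lambda>i\<in>I. t * v i)) \<noteq> 0 \<and>
          r (F (line I v)) = p (G (\<lambda>i\<in>I. t * v i)) / q (G (\<lambda>i\<in>I. t * v i))"
        if t: "t \<notin> ?bad" for t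
        using t bspec[OF reg S[OF scale_nz_vectors[OF v(1)]], of t] scale[OF v(1), of t] by simp
      obtain t where "t \<notin> ?bad" using fin inf ex_new_if_finite by blast
      then have "F (line I v) \<in> U" using good by blast
      let ?\<rho> = "r (F (line I v))" and ?N = "Suc (b + n + n')"
      \<comment> \<open>The value \<open>\<rho>\<close> belongs to the line of \<open>v\<close> and does not depend on \<open>t\<close>.\<close>
      have "(\<Sum>e<?N. t ^ e * (P e v - ?\<rho> * Q e v)) = 0" if t: "t \<notin> ?bad" for t
      proof -
        have "p (G (\<lambda>i\<in>I. t * v i)) = ?\<rho> * q (G (\<lambda>i\<in>I. t * v i))" using good[OF t] by simp
        moreover have "p (G (\<lambda>i\<in>I. t * v i)) = (\<Sum>e<?N. t ^ e * P e v)"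
          by (rule P(2)[rule_format]) simp
        moreover have "q (G (\<lambda>i\<in>I. t * v i)) = (\<Sum>e<?N. t ^ e * Q e v)"
          by (rule Q(2)[rule_format]) simp
        ultimately have "(\<Sum>e<?N. t ^ e * P e v) = ?\<rho> * (\<Sum>e<?N. t ^ e * Q e v)" by metis
        then show ?thesis
          by (simp add: right_diff_distrib sum_subtractf sum_distrib_left mult.left_commute
              del: sum.lessThan_Suc)
      qed
      then have "- ?bad \<subseteq> {t. (\<Sum>e<?N. t ^ e * (P e v - ?\<rho> * Q e v)) = 0}" by blast
      moreover have "infinite (- ?bad)" using fin inf by (metis Compl_eq_Diff_UNIV Diff_infinite_finite)
      ultimately have "infinite {t. (\<Sum>e<?N. t ^ e * (P e v - ?\<rho> * Q e v)) = 0}"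
        using finite_subset by blast
      then have "P b v - ?\<rho> * Q b v = 0"
        using finite_roots_sum[of b ?N "\<lambda>e. P e v - ?\<rho> * Q e v"] by linarith
      then show ?thesis
        using \<open>F (line I v) \<in> U\<close> v by (auto simp: proj_points_eq[OF I])
    qed
    then show "\<exists>e' s e p q. form I e' s \<and> form I e p \<and> form I e q \<and> s u \<noteq> 0 \<and>
        (\<forall>v\<in>nz_vectors I. s v \<noteq> 0 \<longrightarrow> line I v \<in> {L \<in> proj_points I. F L \<in> U} \<and>
          q v \<noteq> 0 \<and> (r \<circ> F) (line I v) = p v / q v)"
      using form_mult[OF spec[OF T(1), of a] spec[OF Q(1), of b]] P(1) Q(1) ab
      by (intro exI[of _ "a + b"] exI[of _ "\<lambda>u. T a u * Q b u"] exI[of _ b]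
          exI[of _ "P b"] exI[of _ "Q b"]) auto
  qed
  moreover have "F ` proj_points I \<subseteq> topspace (ktop (quot_space S f))"
    using F S by (auto simp: topspace_quotient_affine proj_points_eq[OF I])
  moreover have "openin (ktop (proj_space I)) (proj_points I)"
    using openin_topspace[of "ktop (proj_space I)"] by (simp only: topspace_proj_space[OF I])
  ultimately show ?thesis
    unfolding variety_morphism_iff_local local_morphism_def topspace_proj_space[OF I] by blast
qed

end

section \<open>Subrepresentations and quotients\<close>

lemma subreps_subspace:
  "U \<in> subreps Q M \<Longrightarrow> i \<in> verts Q \<Longrightarrow> VectorSpace.subspace class_ring (U i) (vsp M i)"
  by (auto simp: subreps_def)

lemma is_rep_sub_rep:
  assumes Q: "wf_digraph Q" and M: "is_rep Q M" and U: "U \<in> subreps Q M"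
  shows "is_rep Q (sub_rep M U)"
  unfolding is_rep_def
proof (intro conjI ballI)
  fix i assume i: "i \<in> verts Q"
  then interpret V: vectorspace class_ring "vsp M i"
    using M by (simp add: is_rep_def)
  have "V.fin_dim" using M i by (simp add: is_rep_def)
  then show "vectorspace class_ring (vsp (sub_rep M U) i)"
    "vectorspace.fin_dim class_ring (vsp (sub_rep M U) i)"
    using V.subspace_is_vs V.fin_dim_subspace subreps_subspace[OF U i] by (auto simp: sub_rep_def)
next
  fix a assume a: "a \<in> arcs Q"
  have sub: "U i \<subseteq> carrier (vsp M i)" if "i \<in> verts Q" for i
    using subreps_subspace[OF U that] by (auto simp: VectorSpace.subspace_def submodule_def)
  have "act M a \<in> module_hom class_ring (vsp M (tail Q a)) (vsp M (head Q a))"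
    using M a by (simp add: is_rep_def)
  moreover have "act M a ` U (tail Q a) \<subseteq> U (head Q a)"
    using U a by (auto simp: subreps_def)
  moreover have "tail Q a \<in> verts Q" using Q a by (simp add: wf_digraph_def)
  ultimately show "act (sub_rep M U) a \<in>
      module_hom class_ring (vsp (sub_rep M U) (tail Q a)) (vsp (sub_rep M U) (head Q a))"
    using sub by (simp add: sub_rep_def module_hom_def subset_iff Pi_iff image_subset_iff)
qed

lemma act_quot_rep_coset:
  fixes M :: "('q, 'a, 'k::field, 'v) qrep"
  assumes Q: "wf_digraph Q" and M: "is_rep Q M" and U: "U \<in> subreps Q M"
    and a: "a \<in> arcs Q" and x: "x \<in> carrier (vsp M (tail Q a))"
  shows "act (quot_rep Q M U) a (U (tail Q a) +>\<^bsub>vsp M (tail Q a)\<^esub> x) =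
    U (head Q a) +>\<^bsub>vsp M (head Q a)\<^esub> act M a x"
proof -
  let ?t = "tail Q a" and ?h = "head Q a"
  have verts: "?t \<in> verts Q" "?h \<in> verts Q" using Q a by (auto simp: wf_digraph_def)
  have vs: "vectorspace class_ring (vsp M ?t)" "vectorspace class_ring (vsp M ?h)"
    using M verts by (auto simp: is_rep_def)
  note t = quot_module_coset[OF vs(1) subreps_subspace[OF U verts(1)]]
  note h = quot_module_coset[OF vs(2) subreps_subspace[OF U verts(2)]]
  have hom: "act M a \<in> module_hom class_ring (vsp M ?t) (vsp M ?h)" using M a by (simp add: is_rep_def)
  have Ut: "U ?t \<subseteq> carrier (vsp M ?t)"
    using subreps_subspace[OF U verts(1)] by (auto simp: VectorSpace.subspace_def submodule_def)
  have "U ?h +>\<^bsub>vsp M ?h\<^esub> act M a y = U ?h +>\<^bsub>vsp M ?h\<^esub> act M a x"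
    if y: "y \<in> U ?t +>\<^bsub>vsp M ?t\<^esub> x" for y
  proof -
    obtain u where u: "u \<in> U ?t" "y = u \<oplus>\<^bsub>vsp M ?t\<^esub> x" using t(5)[OF x y] by blast
    then have "act M a y = act M a u \<oplus>\<^bsub>vsp M ?h\<^esub> act M a x"
      using module_hom_add[OF hom] Ut x by blast
    moreover have "act M a u \<in> U ?h" using U a u(1) by (auto simp: subreps_def)
    moreover have "act M a x \<in> carrier (vsp M ?h)" using module_hom_closed[OF hom] x by blast
    ultimately show ?thesis using h(7) by simp
  qed
  then have "act (quot_rep Q M U) a (U ?t +>\<^bsub>vsp M ?t\<^esub> x) =
      (\<Union>y\<in>U ?t +>\<^bsub>vsp M ?t\<^esub> x. U ?h +>\<^bsub>vsp M ?h\<^esub> act M a x)"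
    by (simp add: quot_rep_def)
  then show ?thesis using t(6)[OF x] by auto
qed

lemma is_rep_quot_rep:
  fixes M :: "('q, 'a, 'k::field, 'v) qrep"
  assumes Q: "wf_digraph Q" and M: "is_rep Q M" and U: "U \<in> subreps Q M"
  shows "is_rep Q (quot_rep Q M U)"
  unfolding is_rep_def
proof (intro conjI ballI)
  fix i assume i: "i \<in> verts Q"
  then show "vectorspace class_ring (vsp (quot_rep Q M U) i)"
    "vectorspace.fin_dim class_ring (vsp (quot_rep Q M U) i)"
    using vectorspace_quot_module[of "vsp M i" "U i"] M subreps_subspace[OF U i]
    by (auto simp: quot_rep_def is_rep_def)
next
  fix a assume a: "a \<in> arcs Q"
  let ?t = "tail Q a" and ?h = "head Q a"
  let ?p = "\<lambda>i. (+>\<^bsub>vsp M i\<^esub>) (U i)" and ?A = "act (quot_rep Q M U) a"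
  have verts: "?t \<in> verts Q" "?h \<in> verts Q" using Q a by (auto simp: wf_digraph_def)
  have vs: "vectorspace class_ring (vsp M ?t)" "vectorspace class_ring (vsp M ?h)"
    using M verts by (auto simp: is_rep_def)
  note t = quot_module_coset(1-4)[OF vs(1) subreps_subspace[OF U verts(1)]]
  note h = quot_module_coset(1-4)[OF vs(2) subreps_subspace[OF U verts(2)]]
  have hom: "act M a \<in> module_hom class_ring (vsp M ?t) (vsp M ?h)" using M a by (simp add: is_rep_def)
  note A = act_quot_rep_coset[OF Q M U a]
  interpret V: vectorspace class_ring "vsp M ?t" by (rule vs(1))
  have rep: "\<exists>x\<in>carrier (vsp M ?t). X = ?p ?t x" if "X \<in> carrier (quot_module (vsp M ?t) (U ?t))" for X
    using that t(1) by blast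
  have cl: "act M a x \<in> carrier (vsp M ?h)" if "x \<in> carrier (vsp M ?t)" for x
    using that module_hom_closed[OF hom] by blast
  have "?A X \<in> carrier (quot_module (vsp M ?h) (U ?h))"
    if X: "X \<in> carrier (quot_module (vsp M ?t) (U ?t))" for X
    using rep[OF X] A cl h(1) by auto
  moreover have "?A (X \<oplus>\<^bsub>quot_module (vsp M ?t) (U ?t)\<^esub> Y) =
      ?A X \<oplus>\<^bsub>quot_module (vsp M ?h) (U ?h)\<^esub> ?A Y"
    if XY: "X \<in> carrier (quot_module (vsp M ?t) (U ?t))" "Y \<in> carrier (quot_module (vsp M ?t) (U ?t))"
    for X Y
  proof -
    obtain x y where x: "x \<in> carrier (vsp M ?t)" "X = ?p ?t x"
      and y: "y \<in> carrier (vsp M ?t)" "Y = ?p ?t y"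
      using rep[OF XY(1)] rep[OF XY(2)] by blast
    have "?A (X \<oplus>\<^bsub>quot_module (vsp M ?t) (U ?t)\<^esub> Y) = ?A (?p ?t (x \<oplus>\<^bsub>vsp M ?t\<^esub> y))"
      unfolding x(2) y(2) t(3)[OF x(1) y(1)] ..
    also have "\<dots> = ?p ?h (act M a (x \<oplus>\<^bsub>vsp M ?t\<^esub> y))"
      using A x y by simp
    also have "\<dots> = ?p ?h (act M a x) \<oplus>\<^bsub>quot_module (vsp M ?h) (U ?h)\<^esub> ?p ?h (act M a y)"
      unfolding module_hom_add[OF hom x(1) y(1)] by (rule h(3)[OF cl[OF x(1)] cl[OF y(1)]])
    also have "\<dots> = ?A X \<oplus>\<^bsub>quot_module (vsp M ?h) (U ?h)\<^esub> ?A Y"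
      unfolding x(2) y(2) using A x(1) y(1) by simp
    finally show ?thesis .
  qed
  moreover have "?A (c \<odot>\<^bsub>quot_module (vsp M ?t) (U ?t)\<^esub> X) =
      c \<odot>\<^bsub>quot_module (vsp M ?h) (U ?h)\<^esub> ?A X"
    if X: "X \<in> carrier (quot_module (vsp M ?t) (U ?t))" for X c
  proof -
    obtain x where x: "x \<in> carrier (vsp M ?t)" "X = ?p ?t x"
      using rep[OF X] by blast
    have cx: "c \<odot>\<^bsub>vsp M ?t\<^esub> x \<in> carrier (vsp M ?t)" using x(1) V.smult_closed by simp
    have "?A (c \<odot>\<^bsub>quot_module (vsp M ?t) (U ?t)\<^esub> X) = ?A (?p ?t (c \<odot>\<^bsub>vsp M ?t\<^esub> x))"
      unfolding x(2) t(4)[OF x(1)] ..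
    also have "\<dots> = ?p ?h (act M a (c \<odot>\<^bsub>vsp M ?t\<^esub> x))"
      using A cx by simp
    also have "\<dots> = c \<odot>\<^bsub>quot_module (vsp M ?h) (U ?h)\<^esub> ?p ?h (act M a x)"
      using h(4)[OF cl[OF x(1)]] module_hom_smult[OF hom _ x(1), of c] by simp
    also have "\<dots> = c \<odot>\<^bsub>quot_module (vsp M ?h) (U ?h)\<^esub> ?A X"
      unfolding x(2) using A x(1) by simp
    finally show ?thesis .
  qed
  ultimately show "?A \<in> module_hom class_ring (vsp (quot_rep Q M U) ?t) (vsp (quot_rep Q M U) ?h)"
    by (simp add: quot_rep_def module_hom_def)
qed

text \<open>
  Composing with the projection embeds \<open>Hom(M / U, W)\<close> into \<open>Hom(M, W)\<close>.
\<close>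

lemma left_perp_quot_rep:
  fixes M :: "('q, 'a, 'k::field, 'v) qrep"
  assumes Q: "wf_digraph Q" and M: "M \<in> left_perp Q W" and U: "U \<in> subreps Q M"
  shows "quot_rep Q M U \<in> left_perp Q W"
  unfolding left_perp_def mem_Collect_eq
proof (intro conjI ballI)
  have rep: "is_rep Q M" using M by (simp add: left_perp_def)
  show "is_rep Q (quot_rep Q M U)" by (rule is_rep_quot_rep[OF Q rep U])
  let ?p = "\<lambda>i. (+>\<^bsub>vsp M i\<^esub>) (U i)"
  fix \<eta> i X
  assume \<eta>: "\<eta> \<in> rep_hom Q (quot_rep Q M U) W" and i: "i \<in> verts Q"
    and X: "X \<in> carrier (vsp (quot_rep Q M U) i)"
  have quot: "?p j ` carrier (vsp M j) = carrier (quot_module (vsp M j) (U j))"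
    "x \<in> carrier (vsp M j) \<Longrightarrow> y \<in> carrier (vsp M j) \<Longrightarrow>
      ?p j (x \<oplus>\<^bsub>vsp M j\<^esub> y) = ?p j x \<oplus>\<^bsub>quot_module (vsp M j) (U j)\<^esub> ?p j y"
    "x \<in> carrier (vsp M j) \<Longrightarrow> ?p j (c \<odot>\<^bsub>vsp M j\<^esub> x) = c \<odot>\<^bsub>quot_module (vsp M j) (U j)\<^esub> ?p j x"
    if j: "j \<in> verts Q" for j x y c
    using quot_module_coset(1,3,4)[OF _ subreps_subspace[OF U j]] rep j by (simp_all add: is_rep_def)
  have "(\<lambda>j x. \<eta> j (?p j x)) \<in> rep_hom Q M W"
    unfolding rep_hom_def mem_Collect_eq
  proof (intro conjI ballI)
    fix j assume j: "j \<in> verts Q"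
    then have hom: "\<eta> j \<in> module_hom class_ring (quot_module (vsp M j) (U j)) (vsp W j)"
      using \<eta> by (simp add: rep_hom_def quot_rep_def)
    have mem: "?p j x \<in> carrier (quot_module (vsp M j) (U j))" if "x \<in> carrier (vsp M j)" for x
      using that quot(1)[OF j] by blast
    show "(\<lambda>x. \<eta> j (?p j x)) \<in> module_hom class_ring (vsp M j) (vsp W j)"
      using module_hom_closed[OF hom] module_hom_add[OF hom mem mem] module_hom_smult[OF hom _ mem] mem
      by (simp add: module_hom_def quot(2,3)[OF j] Pi_iff)
  next
    fix a x assume a: "a \<in> arcs Q" and x: "x \<in> carrier (vsp M (tail Q a))"
    have "?p (tail Q a) x \<in> carrier (vsp (quot_rep Q M U) (tail Q a))"
      using quot(1)[of "tail Q a"] Q a x by (auto simp: quot_rep_def wf_digraph_def)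
    then have "\<eta> (head Q a) (act (quot_rep Q M U) a (?p (tail Q a) x)) =
        act W a (\<eta> (tail Q a) (?p (tail Q a) x))"
      using \<eta> a by (simp add: rep_hom_def)
    then show "\<eta> (head Q a) (?p (head Q a) (act M a x)) = act W a (\<eta> (tail Q a) (?p (tail Q a) x))"
      unfolding act_quot_rep_coset[OF Q rep U a x] .
  qed
  moreover obtain x where x: "x \<in> carrier (vsp M i)" "X = ?p i x"
    using X quot(1)[OF i] by (auto simp: quot_rep_def)
  ultimately show "\<eta> i X = \<zero>\<^bsub>vsp W i\<^esub>"
    using M i unfolding left_perp_def mem_Collect_eq by (metis (no_types, lifting))
qed

section \<open>Monomials and the Veronese embedding\<close>

lemma mdeg_eq_sum_UNIV:
  fixes m :: "'n::finite \<Rightarrow>\<^sub>0 nat"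
  shows "mdeg m = (\<Sum>i\<in>UNIV. Poly_Mapping.lookup m i)"
  by (rule mdeg_eq_sum) auto

lemma finite_monoms: "finite (monoms e :: ('n::finite \<Rightarrow>\<^sub>0 nat) set)"
proof (rule finite_imageD)
  have "Poly_Mapping.lookup m i \<le> e" if "m \<in> monoms e" for m :: "'n \<Rightarrow>\<^sub>0 nat" and i
    using that member_le_sum[of i UNIV "Poly_Mapping.lookup m"]
    by (simp add: monoms_def mdeg_eq_sum_UNIV)
  then have "Poly_Mapping.lookup ` (monoms e :: ('n \<Rightarrow>\<^sub>0 nat) set) \<subseteq> UNIV \<rightarrow>\<^sub>E {..e}"
    by auto
  then show "finite (Poly_Mapping.lookup ` (monoms e :: ('n \<Rightarrow>\<^sub>0 nat) set))"
    by (rule finite_subset) (intro finite_PiE, auto)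
  show "inj_on Poly_Mapping.lookup (monoms e :: ('n \<Rightarrow>\<^sub>0 nat) set)"
    by (auto intro!: inj_onI poly_mapping_eqI)
qed

abbreviation unit_monom :: "'n \<Rightarrow> 'n \<Rightarrow>\<^sub>0 nat" where
  "unit_monom j \<equiv> Poly_Mapping.single j 1"

lemma monoms_add_unit: "d \<ge> 1 \<Longrightarrow> m + unit_monom j \<in> monoms d \<longleftrightarrow> m \<in> monoms (d - 1)"
  by (auto simp: monoms_def mdeg_add)

lemma diff_unit_monom:
  assumes "Poly_Mapping.lookup m j > 0"
  shows "m - unit_monom j + unit_monom j = m"
  by (rule poly_mapping_eqI) (use assms in \<open>auto simp: lookup_add lookup_minus lookup_single when_def\<close>)

lemma eq_diff_unit_monom_iff:
  "Poly_Mapping.lookup m j > 0 \<and> m' = m - unit_monom j \<longleftrightarrow> m = m' + unit_monom j"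
  using diff_unit_monom[of m j] by (auto simp: lookup_add)

lemma monoms_cases:
  assumes "m \<in> monoms d" "d \<ge> 1"
  obtains j m' where "m = m' + unit_monom j" "m' \<in> monoms (d - 1)"
proof -
  have "m \<noteq> 0" using assms by (auto simp: monoms_def)
  then obtain j where "Poly_Mapping.lookup m j > 0"
    by (metis gr_zeroI lookup_zero poly_mapping_eqI)
  then show ?thesis
    using that[of "m - unit_monom j" j] diff_unit_monom[of m j] monoms_add_unit[of d "m - unit_monom j" j] assms
    by metis
qed

lemma single_in_monoms [simp]: "Poly_Mapping.single i e \<in> monoms e"
  by (simp add: monoms_def)

text \<open>
  Every monomial of degree \<open>d\<close> arises from \<open>T\<^sub>i\<^sup>d\<close> by exchanging factors \<open>T\<^sub>i\<close> for other variables,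
  one at a time; the number of factors different from \<open>T\<^sub>i\<close> decreases on the way back.
\<close>

lemma monoms_exchange_induct [consumes 2, case_names power exchange]:
  fixes m :: "'n::finite \<Rightarrow>\<^sub>0 nat"
  assumes "m \<in> monoms d" "d \<ge> 1"
    and power: "P (Poly_Mapping.single i d)"
    and exchange: "\<And>m' j. m' \<in> monoms (d - 1) \<Longrightarrow> P (m' + unit_monom i) \<Longrightarrow> P (m' + unit_monom j)"
  shows "P m"
  using assms(1)
proof (induction "d - Poly_Mapping.lookup m i" arbitrary: m rule: less_induct)
  case less
  show ?case
  proof (cases "\<exists>j. j \<noteq> i \<and> Poly_Mapping.lookup m j > 0")
    case True
    then obtain j where j: "j \<noteq> i" "Poly_Mapping.lookup m j > 0" by blast
    let ?m' = "m - unit_monom j"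
    have m: "m = ?m' + unit_monom j" using diff_unit_monom[OF j(2)] by simp
    then have m': "?m' \<in> monoms (d - 1)"
      using less.prems monoms_add_unit[OF assms(2), of ?m' j] by simp
    have "Poly_Mapping.lookup m i < d"
    proof -
      have "mdeg m = Poly_Mapping.lookup m i + (\<Sum>k\<in>UNIV - {i}. Poly_Mapping.lookup m k)"
        unfolding mdeg_eq_sum_UNIV by (subst sum.remove[of _ i]) auto
      moreover have "Poly_Mapping.lookup m j \<le> (\<Sum>k\<in>UNIV - {i}. Poly_Mapping.lookup m k)"
        using j by (intro member_le_sum) auto
      ultimately show ?thesis using j(2) less.prems by (simp add: monoms_def)
    qed
    moreover have "Poly_Mapping.lookup (?m' + unit_monom i) i = Suc (Poly_Mapping.lookup m i)"
      using j by (simp add: lookup_add lookup_minus lookup_single)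
    ultimately have "P (?m' + unit_monom i)"
      using m' monoms_add_unit[OF assms(2), of ?m' i] by (intro less.hyps) auto
    then show ?thesis using exchange[OF m', of j] m by simp
  next
    case False
    then have "m = Poly_Mapping.single i (Poly_Mapping.lookup m i)"
      by (intro poly_mapping_eqI) (auto simp: lookup_single when_def)
    moreover from this have "Poly_Mapping.lookup m i = d"
      using less.prems by (metis mdeg_single mem_Collect_eq monoms_def)
    ultimately show ?thesis using power by simp
  qed
qed

text \<open>
  The Veronese map on vectors, while \<open>veronese\<close> acts on lines.
\<close>

definition ver :: "nat \<Rightarrow> ('n \<Rightarrow> 'k::field) \<Rightarrow> ('n \<Rightarrow>\<^sub>0 nat) \<Rightarrow> 'k" where
  "ver e x = (\<lambda>m\<in>monoms e. mono_eval m x)"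

lemma ver_nz_vectors:
  assumes "x \<in> nz_vectors UNIV"
  shows "ver e x \<in> nz_vectors (monoms e)"
proof -
  obtain i where "x i \<noteq> 0" using assms by (auto simp: nz_vectors_iff)
  then have "ver e x (Poly_Mapping.single i e) \<noteq> 0"
    using single_in_monoms[of i e] by (simp add: ver_def del: single_in_monoms)
  then have "\<exists>m\<in>monoms e. ver e x m \<noteq> 0"
    by (rule bexI[OF _ single_in_monoms])
  then show ?thesis by (auto simp: nz_vectors_iff ver_def)
qed

lemma veronese_line:
  "veronese e (line UNIV x) = line (monoms e) (ver e x)"
proof (intro equalityI subsetI)
  fix v assume "v \<in> veronese e (line UNIV x)"
  then obtain c t where v: "v = (\<lambda>m\<in>monoms e. c * mono_eval m (\<lambda>i\<in>UNIV. t * x i))"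
    by (auto simp: veronese_def line_def)
  have "v = (\<lambda>m\<in>monoms e. c * t ^ e * ver e x m)"
    unfolding v by (rule restrict_ext) (use mono_eval_scale[of _ UNIV t x] in \<open>auto simp: ver_def monoms_def\<close>)
  then show "v \<in> line (monoms e) (ver e x)" unfolding line_def by (rule range_eqI)
next
  fix v assume "v \<in> line (monoms e) (ver e x)"
  then obtain c where "v = (\<lambda>m\<in>monoms e. c * ver e x m)" by (auto simp: line_def)
  then have "v = (\<lambda>m\<in>monoms e. c * mono_eval m x)" by (simp add: ver_def cong: restrict_cong)
  moreover have "x \<in> line UNIV x" by (rule self_in_line) auto
  ultimately show "v \<in> veronese e (line UNIV x)" unfolding veronese_def by blast
qed

text \<open>
  The hypothesis says that the catalecticant matrix of the \<open>u\<^bsub>m'+e\<^sub>j\<^esub>\<close> is the product of a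
  column and a row. Exchanging one factor \<open>T\<^sub>i\<close> of a monomial for \<open>T\<^sub>j\<close> therefore multiplies the
  coordinate of \<open>u\<close> by \<open>y\<^sub>j / y\<^sub>i\<close>, so all coordinates are determined by the one at \<open>T\<^sub>i\<^sup>d\<close>.
\<close>

lemma rank_one_catalecticant:
  fixes u w :: "('n::finite \<Rightarrow>\<^sub>0 nat) \<Rightarrow> 'k::field"
  assumes d: "d \<ge> 1" and y: "y i \<noteq> 0"
    and uw: "\<And>j m'. m' \<in> monoms (d - 1) \<Longrightarrow> u (m' + unit_monom j) = y j * w m'"
  obtains c where "\<And>m. m \<in> monoms d \<Longrightarrow> u m = c * mono_eval m y"
    "\<And>m'. m' \<in> monoms (d - 1) \<Longrightarrow> w m' = c * mono_eval m' y"
proof -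
  let ?c = "u (Poly_Mapping.single i d) / y i ^ d"
  have u: "u m = ?c * mono_eval m y" if "m \<in> monoms d" for m
    using that d
  proof (induction m rule: monoms_exchange_induct[where i = i])
    case power
    then show ?case using y by simp
  next
    case (exchange m' j)
    have "y i * w m' = ?c * (mono_eval m' y * y i)"
      using exchange.IH uw[OF exchange.hyps, of i] by (simp add: mono_eval_add)
    then have "w m' = ?c * mono_eval m' y" using y by (simp add: field_simps)
    then show ?case using uw[OF exchange.hyps, of j] by (simp add: mono_eval_add)
  qed
  moreover have "w m' = ?c * mono_eval m' y" if m': "m' \<in> monoms (d - 1)" for m'
  proof -
    have "m' + unit_monom i \<in> monoms d" by (rule iffD2[OF monoms_add_unit[OF d] m'])
    then have "y i * w m' = ?c * (mono_eval m' y * y i)"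
      using u[OF \<open>m' + unit_monom i \<in> monoms d\<close>] unfolding uw[OF m', of i] mono_eval_add
      by simp
    then show ?thesis using y by (simp add: field_simps)
  qed
  ultimately show ?thesis by (rule that)
qed

section \<open>Reineke's representations\<close>

lemma sub_dim_eq_0_iff:
  fixes L :: "('i \<Rightarrow> 'k::field) set"
  assumes "finite I" and L: "VectorSpace.subspace class_ring L (func_vs I)"
  shows "sub_dim (func_vs I) L = 0 \<longleftrightarrow> L = {\<lambda>i\<in>I. 0}"
proof -
  interpret V: vectorspace class_ring "func_vs I :: ('k, 'i \<Rightarrow> 'k) module"
    by (rule vectorspace_func_vs)
  interpret W: vectorspace class_ring "V.vs L" by (rule V.subspace_is_vs[OF L])
  have "W.fin_dim" by (rule V.fin_dim_subspace[OF fin_dim_func_vs[OF assms(1)] L])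
  then show ?thesis using W.dim_eq_0_iff by simp
qed

lemma subspace_zero:
  "VectorSpace.subspace class_ring {\<lambda>i\<in>I. 0} (func_vs I :: ('k::field, 'i \<Rightarrow> 'k) module)"
  "LinearCombinations.module.span class_ring (func_vs I :: ('k, 'i \<Rightarrow> 'k) module) {} = {\<lambda>i\<in>I. 0}"
proof -
  interpret V: vectorspace class_ring "func_vs I :: ('k, 'i \<Rightarrow> 'k) module"
    by (rule vectorspace_func_vs)
  show *: "V.span {} = {\<lambda>i\<in>I. 0}" using V.span_empty by simp
  show "VectorSpace.subspace class_ring {\<lambda>i\<in>I. 0} (func_vs I :: ('k, 'i \<Rightarrow> 'k) module)"
    using V.span_is_subspace[of "{}"] unfolding * by simp
qed

lemma module_hom_func_vs_zero:
  assumes "g \<in> module_hom class_ring (func_vs I) (func_vs J)"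
  shows "g (\<lambda>i\<in>I. 0) = (\<lambda>j\<in>J. 0 :: 'k::field)"
proof -
  have "(\<lambda>i\<in>I. 0 * (\<lambda>i\<in>I. 0::'k) i) = (\<lambda>i\<in>I. 0)" by (rule restrict_ext) simp
  then show ?thesis using module_hom_smult[OF assms, of 0 "\<lambda>i\<in>I. 0"] by simp
qed

lemma lin_ext_module_hom:
  "lin_ext A B w \<in> module_hom class_ring (func_vs A) (func_vs B)"
proof -
  have add: "lin_ext A B w (\<lambda>i\<in>A. x i + y i) = (\<lambda>j\<in>B. lin_ext A B w x j + lin_ext A B w y j)" for x y
    unfolding lin_ext_def
    by (rule restrict_ext) (simp add: distrib_right sum.distrib)
  have smult: "lin_ext A B w (\<lambda>i\<in>A. c * x i) = (\<lambda>j\<in>B. c * lin_ext A B w x j)" for c x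
    unfolding lin_ext_def
    by (rule restrict_ext) (simp add: sum_distrib_left mult.assoc)
  have "lin_ext A B w x \<in> B \<rightarrow>\<^sub>E UNIV" for x by (simp add: lin_ext_def)
  then show ?thesis using add smult by (simp add: module_hom_def)
qed

text \<open>
  The map \<open>g\<^sub>j\<close>, written by coordinates: the transpose of multiplication by \<open>T\<^sub>j\<close>.
\<close>

definition contraction :: "nat \<Rightarrow> 'n \<Rightarrow> (('n::finite \<Rightarrow>\<^sub>0 nat) \<Rightarrow> 'k::field) \<Rightarrow> ('n \<Rightarrow>\<^sub>0 nat) \<Rightarrow> 'k" where
  "contraction d j x = (\<lambda>m'\<in>monoms (d - 1). x (m' + unit_monom j))"

text \<open>
  The functionals \<open>\<phi>\<^sub>i\<close> and \<open>\<psi>\<^sub>i\<close> for \<open>p = f\<^sub>i\<close> and \<open>p = h\<^sub>i\<close>.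
\<close>

definition pairing :: "nat \<Rightarrow> ('n::finite, 'k::field) mpoly \<Rightarrow> (('n \<Rightarrow>\<^sub>0 nat) \<Rightarrow> 'k) \<Rightarrow> 'k" where
  "pairing d p x = (\<Sum>m\<in>monoms d. x m * Poly_Mapping.lookup p m)"

lemma reineke_quiver_simps [simp]:
  "verts reineke_quiver = {1, 2, 3}" "arcs reineke_quiver = UNIV"
  "tail reineke_quiver a = 2" "head reineke_quiver (Inl j) = 3" "head reineke_quiver (Inr i) = 1"
  by (simp_all add: reineke_quiver_def)

lemma wf_digraph_reineke_quiver: "wf_digraph reineke_quiver"
  by (auto simp: wf_digraph_def reineke_quiver_def split: sum.splits)

lemma vsp_reineke_rep [simp]:
  "vsp (reineke_rep d f) 1 = func_vs {0}" "vsp (reineke_rep d f) (Suc 0) = func_vs {0}"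
  "vsp (reineke_rep d f) 2 = func_vs (monoms d)" "vsp (reineke_rep d f) 3 = func_vs (monoms (d - 1))"
  by (simp_all add: reineke_rep_def)

lemma act_reineke_rep_Inl:
  fixes f :: "'r \<Rightarrow> ('n::finite, 'k::field) mpoly" and x :: "('n \<Rightarrow>\<^sub>0 nat) \<Rightarrow> 'k"
  assumes d: "d \<ge> 1"
  shows "act (reineke_rep d f) (Inl j) x = contraction d j x"
proof -
  have "(\<Sum>m\<in>monoms d. x m * (if Poly_Mapping.lookup m j > 0
        then (\<lambda>m'. of_bool (m' = m - unit_monom j)) else (\<lambda>_. 0)) m') = x (m' + unit_monom j)"
    if m': "m' \<in> monoms (d - 1)" for m'
  proof -
    have "(\<Sum>m\<in>monoms d. x m * (if Poly_Mapping.lookup m j > 0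
        then (\<lambda>m'. of_bool (m' = m - unit_monom j)) else (\<lambda>_. 0)) m') =
      (\<Sum>m\<in>monoms d. if m = m' + unit_monom j then x m else 0)"
    proof (rule sum.cong)
      fix m :: "'n \<Rightarrow>\<^sub>0 nat"
      show "x m * (if Poly_Mapping.lookup m j > 0
          then (\<lambda>m'. of_bool (m' = m - unit_monom j)) else (\<lambda>_. 0)) m' =
          (if m = m' + unit_monom j then x m else 0)"
        unfolding eq_diff_unit_monom_iff[of m j m', symmetric] by auto
    qed simp
    also have "\<dots> = x (m' + unit_monom j)"
      using iffD2[OF monoms_add_unit[OF d] m', of j] by (simp add: sum.delta finite_monoms)
    finally show ?thesis .
  qed
  then show ?thesis
    by (auto simp: reineke_rep_def lin_ext_def contraction_def intro!: restrict_ext)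
qed

lemma act_reineke_rep_Inr:
  "act (reineke_rep d f) (Inr i) x = (\<lambda>_\<in>{0}. pairing d (f i) x)"
  by (simp add: reineke_rep_def lin_ext_def pairing_def)

lemma is_rep_reineke_rep:
  fixes f :: "'r \<Rightarrow> ('n::finite, 'k::field) mpoly"
  shows "is_rep reineke_quiver (reineke_rep d f)"
  unfolding is_rep_def
proof (intro conjI ballI)
  fix i :: nat assume i: "i \<in> verts (reineke_quiver :: (nat, 'n + 'r) pre_digraph)"
  then show "vectorspace class_ring (vsp (reineke_rep d f) i)"
    using vectorspace_func_vs by (auto simp: vsp_reineke_rep(1)[unfolded One_nat_def])
  show "vectorspace.fin_dim class_ring (vsp (reineke_rep d f) i)"
    using i by (auto simp: fin_dim_func_vs finite_monoms)
next
  fix a :: "'n + 'r"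
  show "act (reineke_rep d f) a \<in> module_hom class_ring
      (vsp (reineke_rep d f) (tail reineke_quiver a)) (vsp (reineke_rep d f) (head reineke_quiver a))"
    by (cases a) (simp_all add: lin_ext_module_hom, simp_all add: reineke_rep_def lin_ext_module_hom)
qed

lemma homogeneous_keys:
  "homogeneous UNIV d p \<Longrightarrow> Poly_Mapping.keys p \<subseteq> monoms d"
  by (auto simp: homogeneous_def monoms_def)

lemma pairing_ver:
  fixes p :: "('n::finite, 'k::field) mpoly"
  assumes "homogeneous UNIV d p"
  shows "pairing d p (\<lambda>m\<in>monoms d. c * ver d x m) = c * peval p x"
proof -
  have "pairing d p (\<lambda>m\<in>monoms d. c * ver d x m) =
      (\<Sum>m\<in>monoms d. c * (Poly_Mapping.lookup p m * mono_eval m x))"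
    unfolding pairing_def by (rule sum.cong) (auto simp: ver_def)
  also have "\<dots> = c * peval p x"
    unfolding peval_eq_sum[OF finite_monoms homogeneous_keys[OF assms]] by (simp add: sum_distrib_left)
  finally show ?thesis .
qed

lemma contraction_ver:
  assumes d: "d \<ge> 1"
  shows "contraction d j (\<lambda>m\<in>monoms d. c * ver d x m) = (\<lambda>m\<in>monoms (d - 1). c * x j * ver (d - 1) x m)"
  unfolding contraction_def
proof (rule restrict_ext)
  fix m :: "'a \<Rightarrow>\<^sub>0 nat" assume "m \<in> monoms (d - 1)"
  then show "(\<lambda>m\<in>monoms d. c * ver d x m) (m + unit_monom j) = c * x j * ver (d - 1) x m"
    using iffD2[OF monoms_add_unit[OF d], of m j] by (simp add: ver_def mono_eval_add)
qed

lemma line_in_proj_zeros: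
  fixes f :: "'r \<Rightarrow> ('n::finite, 'k::field) mpoly"
  assumes f: "\<And>i. homogeneous UNIV d (f i)" and x: "x \<in> nz_vectors UNIV"
  shows "line UNIV x \<in> proj_zeros f \<longleftrightarrow> (\<forall>i. peval (f i) x = 0)"
proof -
  have "peval (f i) (\<lambda>i\<in>UNIV. t * x i) = t ^ d * peval (f i) x" for i t
    by (rule form_scale[OF form_peval[OF f]])
  moreover have "x \<in> line UNIV x" by (rule self_in_line) auto
  ultimately show ?thesis
    using x by (auto simp: proj_zeros_def proj_points_eq line_def)
qed

text \<open>
  The subrepresentation \<open>(0, K \<nu>\<^sub>d(x), K \<nu>\<^bsub>d-1\<^esub>(x))\<close> for the line \<open>L = K x\<close>.
\<close>

definition veronese_subrep :: "nat \<Rightarrow> ('n \<Rightarrow> 'k::field) set \<Rightarrow> nat \<Rightarrow> (('n \<Rightarrow>\<^sub>0 nat) \<Rightarrow> 'k) set" where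
  "veronese_subrep d L =
    (\<lambda>i\<in>{1, 2, 3}. if i = 1 then {\<lambda>_\<in>{0}. 0} else if i = 2 then veronese d L else veronese (d - 1) L)"

lemma veronese_subrep_simps [simp]:
  "veronese_subrep d L 1 = {\<lambda>_\<in>{0}. 0}" "veronese_subrep d L (Suc 0) = {\<lambda>_\<in>{0}. 0}"
  "veronese_subrep d L 2 = veronese d L" "veronese_subrep d L 3 = veronese (d - 1) L"
  by (simp_all add: veronese_subrep_def)

lemma dim_011_simps [simp]:
  "dim_011 1 = 0" "dim_011 (Suc 0) = 0" "dim_011 2 = 1" "dim_011 3 = 1"
  by (simp_all add: dim_011_def)

lemma sub_dim_line:
  fixes u :: "'i \<Rightarrow> 'k::field"
  shows "finite I \<Longrightarrow> u \<in> nz_vectors I \<Longrightarrow> sub_dim (func_vs I) (line I u) = 1"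
  using sub_dim_eq_1_iff_line[OF _ subspace_line(1)] by (auto simp: nz_vectors_def)

text \<open>
  This holds because \<open>g\<^sub>j(\<nu>\<^sub>d(x)) = x\<^sub>j \<nu>\<^bsub>d-1\<^esub>(x)\<close> and \<open>\<phi>\<^sub>i(\<nu>\<^sub>d(x)) = f\<^sub>i(x)\<close>.
\<close>

lemma veronese_subrep_in_Gr_points:
  fixes f :: "'r::finite \<Rightarrow> ('n::finite, 'k::field) mpoly"
  assumes d: "d \<ge> 1" and f: "\<And>i. homogeneous UNIV d (f i)" and L: "L \<in> proj_zeros f"
  shows "veronese_subrep d L \<in> Gr_points reineke_quiver dim_011 (reineke_rep d f)"
proof -
  have "L \<in> proj_points UNIV" using L by (simp add: proj_zeros_def)
  then obtain x where x: "x \<in> nz_vectors UNIV" "L = line UNIV x" by (rule proj_pointsE[OF finite])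
  then have fx: "peval (f i) x = 0" for i using L line_in_proj_zeros[where f = f, OF f] by blast
  have ver: "ver e x \<in> monoms e \<rightarrow>\<^sub>E UNIV" for e by (simp add: ver_def)
  have act: "act (reineke_rep d f) a ` veronese_subrep d L 2 \<subseteq> veronese_subrep d L (head reineke_quiver a)"
    for a :: "'n + 'r"
  proof (cases a)
    case (Inl j)
    then show ?thesis
      unfolding x(2) Inl reineke_quiver_simps veronese_subrep_simps veronese_line
      by (auto simp: line_def act_reineke_rep_Inl[OF d] contraction_ver[OF d])
  next
    case (Inr i)
    then show ?thesis
      unfolding x(2) Inr reineke_quiver_simps veronese_subrep_simps veronese_line
      by (auto simp: line_def act_reineke_rep_Inr pairing_ver[OF f] fx)
  qed
  have sub: "VectorSpace.subspace class_ring (veronese_subrep d L i) (vsp (reineke_rep d f) i)"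
    if "i \<in> {1, 2, 3}" for i
    using that subspace_line(1)[OF ver] subspace_zero(1) unfolding x(2) by (auto simp: veronese_line)
  have dim: "sub_dim (vsp (reineke_rep d f) i) (veronese_subrep d L i) = dim_011 i"
    if "i \<in> {1, 2, 3}" for i
    using that unfolding x(2)
    by (auto simp: veronese_line sub_dim_eq_0_iff[OF _ subspace_zero(1)]
        sub_dim_line[unfolded One_nat_def, OF finite_monoms ver_nz_vectors[OF x(1)]])
  have ext: "veronese_subrep d L \<in> extensional {1, 2, 3}" by (simp add: veronese_subrep_def)
  show ?thesis
    unfolding Gr_points_def subreps_def mem_Collect_eq reineke_quiver_simps(1-3)
    by (intro conjI ballI ext sub dim act; assumption)
qed

text \<open>
  Let \<open>u\<close> and \<open>w\<close> span \<open>U\<^sub>2\<close> and \<open>U\<^sub>3\<close>. Then \<open>g\<^sub>j(u) = y\<^sub>j w\<close> for some \<open>y\<close>, and \<open>y \<noteq> 0\<close> since a nonzero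
  coordinate of \<open>u\<close>, of degree \<open>d \<ge> 1\<close>, is a coordinate of some \<open>g\<^sub>j(u)\<close>. So the rank one argument
  applies and identifies the line \<open>K y\<close> as the point of \<open>X\<close> that gives \<open>U\<close>.
\<close>

lemma Gr_points_reineke_rep:
  fixes f :: "'r::finite \<Rightarrow> ('n::finite, 'k::field) mpoly"
  assumes d: "d \<ge> 1" and f: "\<And>i. homogeneous UNIV d (f i)"
  shows "Gr_points reineke_quiver dim_011 (reineke_rep d f) = veronese_subrep d ` proj_zeros f"
proof (intro equalityI subsetI)
  fix U assume "U \<in> Gr_points (reineke_quiver :: (nat, 'n + 'r) pre_digraph) dim_011 (reineke_rep d f)"
  then have ext: "U \<in> extensional {1, 2, 3}"
    and sub: "\<And>i. i \<in> {1, 2, 3} \<Longrightarrow> VectorSpace.subspace class_ring (U i) (vsp (reineke_rep d f) i)"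
    and act: "\<And>a :: 'n + 'r. act (reineke_rep d f) a ` U 2 \<subseteq> U (head reineke_quiver a)"
    and dim: "\<And>i. i \<in> {1, 2, 3} \<Longrightarrow> sub_dim (vsp (reineke_rep d f) i) (U i) = dim_011 i"
    by (auto simp: Gr_points_def subreps_def)
  have U1: "U 1 = {\<lambda>_\<in>{0}. 0}"
    using sub[of 1] dim[of 1] sub_dim_eq_0_iff[of "{0}" "U 1"] by simp
  obtain u where u: "u \<in> nz_vectors (monoms d)" "U 2 = line (monoms d) u"
    using sub[of 2] dim[of 2] sub_dim_eq_1_iff_line[OF finite_monoms, of "U 2" d] by auto
  obtain w where w: "w \<in> nz_vectors (monoms (d - 1))" "U 3 = line (monoms (d - 1)) w"
    using sub[of 3] dim[of 3] sub_dim_eq_1_iff_line[OF finite_monoms, of "U 3" "d - 1"] by auto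
  have uU: "u \<in> U 2" using u self_in_line[of u "monoms d"] by (simp add: nz_vectors_def)
  have "\<exists>y. contraction d j u = (\<lambda>m\<in>monoms (d - 1). y * w m)" for j
  proof -
    have "contraction d j u \<in> U 3"
      using act[of "Inl j"] uU act_reineke_rep_Inl[OF d, of f j u] by auto
    then show ?thesis unfolding w(2) line_def by blast
  qed
  then obtain y where y: "\<And>j. contraction d j u = (\<lambda>m\<in>monoms (d - 1). y j * w m)" by metis
  have uw: "u (m' + unit_monom j) = y j * w m'" if "m' \<in> monoms (d - 1)" for j m'
    using fun_cong[OF y[of j], of m'] that by (simp add: contraction_def)
  obtain m where m: "m \<in> monoms d" "u m \<noteq> 0" using u(1) by (auto simp: nz_vectors_iff)
  obtain i m' where "m = m' + unit_monom i" "m' \<in> monoms (d - 1)" using monoms_cases[OF m(1) d] .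
  then have yi: "y i \<noteq> 0" using uw[of m' i] m(2) by auto
  obtain c where c: "\<And>m. m \<in> monoms d \<Longrightarrow> u m = c * mono_eval m y"
    "\<And>m'. m' \<in> monoms (d - 1) \<Longrightarrow> w m' = c * mono_eval m' y"
    using rank_one_catalecticant[where y = y and u = u and w = w, OF d yi uw, of thesis] by blast
  have "c \<noteq> 0" using c(1)[OF m(1)] m(2) by auto
  have u_eq: "u = (\<lambda>m\<in>monoms d. c * ver d y m)"
    using u(1) c(1) by (auto simp: fun_eq_iff nz_vectors_iff ver_def PiE_def extensional_def)
  have w_eq: "w = (\<lambda>m\<in>monoms (d - 1). c * ver (d - 1) y m)"
    using w(1) c(2) by (auto simp: fun_eq_iff nz_vectors_iff ver_def PiE_def extensional_def)
  have U23: "U 2 = veronese d (line UNIV y)" "U 3 = veronese (d - 1) (line UNIV y)"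
    unfolding u(2) w(2) u_eq w_eq veronese_line by (rule line_scale[OF \<open>c \<noteq> 0\<close>])+
  have "peval (f k) y = 0" for k
  proof -
    have "act (reineke_rep d f) (Inr k) u \<in> U 1" using act[of "Inr k"] uU by auto
    then have "(\<lambda>_\<in>{0 :: 'n \<Rightarrow>\<^sub>0 nat}. pairing d (f k) u) = (\<lambda>_\<in>{0}. 0)" unfolding U1 act_reineke_rep_Inr by simp
    then have "pairing d (f k) u = 0" by (metis restrict_apply' singletonI)
    then show ?thesis unfolding u_eq pairing_ver[OF f] using \<open>c \<noteq> 0\<close> by simp
  qed
  moreover have "y \<in> nz_vectors UNIV" using yi by (auto simp: nz_vectors_iff)
  ultimately have "line UNIV y \<in> proj_zeros f" using line_in_proj_zeros[where f = f, OF f] by blast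
  moreover have "U = veronese_subrep d (line UNIV y)"
  proof (rule extensionalityI[OF ext])
    show "veronese_subrep d (line UNIV y) \<in> extensional {1, 2, 3}" by (simp add: veronese_subrep_def)
    show "U i = veronese_subrep d (line UNIV y) i" if "i \<in> {1, 2, 3}" for i
      using that U1 U23 by auto
  qed
  ultimately show "U \<in> veronese_subrep d ` proj_zeros f" by blast
next
  fix U assume "U \<in> veronese_subrep d ` proj_zeros f"
  then show "U \<in> Gr_points (reineke_quiver :: (nat, 'n + 'r) pre_digraph) dim_011 (reineke_rep d f)"
    using veronese_subrep_in_Gr_points[where f = f, OF d f] by blast
qed

section \<open>Homomorphisms into \<open>W\<close>\<close>

lemma coord_class_multiple_of_generator:
  fixes f :: "'r \<Rightarrow> ('n, 'k::field) mpoly"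
  shows "coord_class f (c * f i) = \<zero>\<^bsub>coord_ring f\<^esub>"
proof -
  have R: "ring (class_ring :: ('n, 'k) mpoly ring)" by (rule class_ring.ring_axioms)
  interpret I: ideal "gens_ideal f" "class_ring :: ('n, 'k) mpoly ring"
    unfolding gens_ideal_def by (rule ring.genideal_ideal[OF R]) simp
  have "f i \<in> gens_ideal f"
    unfolding gens_ideal_def using ring.genideal_self[OF R, of "range f"] by auto
  then have "c * f i \<in> gens_ideal f" using I.I_l_closed[of "f i" c] by simp
  then have "gens_ideal f +>\<^bsub>class_ring\<^esub> (c * f i) = gens_ideal f"
    by (intro abelian_group.a_coset_join2[OF ring.is_abelian_group[OF R]] I.a_subgroup) auto
  then show ?thesis by (simp add: coord_class_def coord_ring_def FactRing_def)
qed

lemma lookup_scale: "Poly_Mapping.lookup (Poly_Mapping.single 0 c * p) m = c * Poly_Mapping.lookup p m"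
  for p :: "('n \<Rightarrow>\<^sub>0 nat) \<Rightarrow>\<^sub>0 'k::field"
  unfolding mult_map_scale_conv_mult[symmetric] by (simp add: Poly_Mapping.map.rep_eq when_def)

lemma monoms_ne_less:
  fixes m a :: "'n::finite \<Rightarrow>\<^sub>0 nat"
  assumes "m \<in> monoms d" "a \<in> monoms d" "m \<noteq> a"
  obtains j where "Poly_Mapping.lookup a j < Poly_Mapping.lookup m j"
proof (rule ccontr)
  assume no: "\<not> thesis"
  have le: "Poly_Mapping.lookup m j \<le> Poly_Mapping.lookup a j" for j
    by (rule leI) (use that no in blast)
  obtain j where "Poly_Mapping.lookup m j \<noteq> Poly_Mapping.lookup a j"
    using assms(3) poly_mapping_eqI[of m a] by auto
  then have "Poly_Mapping.lookup m j < Poly_Mapping.lookup a j" using le[of j] by simp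
  then have "mdeg m < mdeg a"
    unfolding mdeg_eq_sum_UNIV using le by (intro sum_strict_mono_ex1) auto
  then show False using assms by (simp add: monoms_def)
qed

text \<open>
  The hypotheses say that \<open>E\<close> and \<open>B\<close> are the matrices, in degrees \<open>d\<close> and \<open>d - 1\<close>, of a map that
  commutes with all contractions. By \<open>EB\<close>, an entry of \<open>E\<close> does not change when a common factor \<open>T\<^sub>j\<close>
  of its row and its column is exchanged for \<open>T\<^sub>i\<close>. If the row contains \<open>T\<^sub>j\<close> more often than the
  column, exchanging removes \<open>T\<^sub>j\<close> from the column and \<open>E0\<close> applies; on the diagonal, exchanging
  links every monomial to \<open>T\<^sub>i\<^sup>d\<close>.
\<close>

lemma contraction_equivariant_matrix_scalar:
  fixes E B :: "('n::finite \<Rightarrow>\<^sub>0 nat) \<Rightarrow> ('n \<Rightarrow>\<^sub>0 nat) \<Rightarrow> 'k::field"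
  assumes d: "d \<ge> 1"
    and E0: "\<And>m' a j. m' \<in> monoms (d - 1) \<Longrightarrow> a \<in> monoms d \<Longrightarrow> Poly_Mapping.lookup a j = 0 \<Longrightarrow>
      E (m' + unit_monom j) a = 0"
    and EB: "\<And>m' a' j. m' \<in> monoms (d - 1) \<Longrightarrow> a' \<in> monoms (d - 1) \<Longrightarrow>
      E (m' + unit_monom j) (a' + unit_monom j) = B m' a'"
  obtains \<mu> where "\<And>m a. m \<in> monoms d \<Longrightarrow> a \<in> monoms d \<Longrightarrow> E m a = \<mu> * of_bool (m = a)"
proof -
  have off: "E m a = 0"
    if "m \<in> monoms d" "a \<in> monoms d" "Poly_Mapping.lookup a j < Poly_Mapping.lookup m j" for m a j
    using that
  proof (induction "Poly_Mapping.lookup a j" arbitrary: m a)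
    case 0
    have "Poly_Mapping.lookup m j > 0" using 0 by simp
    from diff_unit_monom[OF this] have m: "m = m - unit_monom j + unit_monom j" by simp
    then have "m - unit_monom j \<in> monoms (d - 1)" using monoms_add_unit[OF d] 0(2) by metis
    then show ?case using E0[of "m - unit_monom j" a j] 0 m by metis
  next
    case (Suc k)
    have pos: "Poly_Mapping.lookup m j > 0" "Poly_Mapping.lookup a j > 0" using Suc by auto
    let ?m = "m - unit_monom j" and ?a = "a - unit_monom j"
    have m: "m = ?m + unit_monom j" and a: "a = ?a + unit_monom j"
      using diff_unit_monom[OF pos(1)] diff_unit_monom[OF pos(2)] by simp_all
    then have mem: "?m \<in> monoms (d - 1)" "?a \<in> monoms (d - 1)"
      using monoms_add_unit[OF d] Suc.prems(1,2) by metis+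
    have "m \<noteq> a" using Suc.prems(3) by auto
    obtain i where "Poly_Mapping.lookup m i < Poly_Mapping.lookup a i"
      using monoms_ne_less[OF Suc.prems(2,1)] \<open>m \<noteq> a\<close> by metis
    then have "i \<noteq> j" using Suc.prems(3) by auto
    have "E m a = E (?m + unit_monom i) (?a + unit_monom i)"
      using EB[OF mem, of i] EB[OF mem, of j] m a by metis
    also have "\<dots> = 0"
    proof (rule Suc.hyps(1))
      show "k = Poly_Mapping.lookup (?a + unit_monom i) j"
        "Poly_Mapping.lookup (?a + unit_monom i) j < Poly_Mapping.lookup (?m + unit_monom i) j"
        using Suc.hyps(2) Suc.prems(3) \<open>i \<noteq> j\<close> by (auto simp: lookup_add lookup_minus lookup_single)
    qed (rule iffD2[OF monoms_add_unit[OF d]], rule mem)+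
    finally show ?case .
  qed
  \<comment> \<open>Any variable can serve as the common reference for the diagonal entries.\<close>
  obtain i :: 'n where True by blast
  let ?\<mu> = "E (Poly_Mapping.single i d) (Poly_Mapping.single i d)"
  have diag: "E m m = ?\<mu>" if "m \<in> monoms d" for m
    using that d
  proof (induction m rule: monoms_exchange_induct[where i = i])
    case (exchange m' j)
    then show ?case using EB[OF exchange.hyps exchange.hyps, of i] EB[OF exchange.hyps exchange.hyps, of j] by metis
  qed simp
  show ?thesis
  proof (rule that[of ?\<mu>])
    fix m a :: "'n \<Rightarrow>\<^sub>0 nat" assume ma: "m \<in> monoms d" "a \<in> monoms d"
    show "E m a = ?\<mu> * of_bool (m = a)"
    proof (cases "m = a")
      case True
      then show ?thesis using diag[OF ma(1)] by simp
    next
      case False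
      then obtain j where "Poly_Mapping.lookup a j < Poly_Mapping.lookup m j"
        by (rule monoms_ne_less[OF ma])
      then have "E m a = 0" by (rule off[OF ma])
      then show ?thesis using False by simp
    qed
  qed
qed

lemma rep_hom_reineke_repD:
  fixes f h :: "'r \<Rightarrow> ('n::finite, 'k::field) mpoly"
    and Y :: "(nat, 'n + 'r, 'k, ('n \<Rightarrow>\<^sub>0 nat) \<Rightarrow> 'k) qrep"
  assumes d: "d \<ge> 1" and act: "act Y = act (reineke_rep d f)"
    and \<eta>: "\<eta> \<in> rep_hom reineke_quiver Y (reineke_rep d h)"
  shows "\<eta> 1 \<in> module_hom class_ring (vsp Y 1) (func_vs {0})"
    "\<eta> 2 \<in> module_hom class_ring (vsp Y 2) (func_vs (monoms d))"
    "\<eta> 3 \<in> module_hom class_ring (vsp Y 3) (func_vs (monoms (d - 1)))"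
    "x \<in> carrier (vsp Y 2) \<Longrightarrow> \<eta> 3 (contraction d j x) = contraction d j (\<eta> 2 x)"
    "x \<in> carrier (vsp Y 2) \<Longrightarrow>
      \<eta> 1 (\<lambda>_\<in>{0}. pairing d (f i) x) = (\<lambda>_\<in>{0}. pairing d (h i) (\<eta> 2 x))"
proof -
  have hom: "\<And>i. i \<in> {1, 2, 3} \<Longrightarrow> \<eta> i \<in> module_hom class_ring (vsp Y i) (vsp (reineke_rep d h) i)"
    and comm: "\<And>a x. x \<in> carrier (vsp Y 2) \<Longrightarrow> \<eta> (head reineke_quiver a) (act (reineke_rep d f) a x) =
        act (reineke_rep d h) a (\<eta> 2 x)"
    using \<eta> by (auto simp: rep_hom_def act)
  show "\<eta> 1 \<in> module_hom class_ring (vsp Y 1) (func_vs {0})"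
    "\<eta> 2 \<in> module_hom class_ring (vsp Y 2) (func_vs (monoms d))"
    "\<eta> 3 \<in> module_hom class_ring (vsp Y 3) (func_vs (monoms (d - 1)))"
    using hom[of 1] hom[of 2] hom[of 3] by (simp_all only: vsp_reineke_rep insert_iff simp_thms)
  show "\<eta> 3 (contraction d j x) = contraction d j (\<eta> 2 x)" if "x \<in> carrier (vsp Y 2)"
    using comm[OF that, of "Inl j"] by (simp only: reineke_quiver_simps act_reineke_rep_Inl[OF d])
  show "\<eta> 1 (\<lambda>_\<in>{0}. pairing d (f i) x) = (\<lambda>_\<in>{0}. pairing d (h i) (\<eta> 2 x))"
    if "x \<in> carrier (vsp Y 2)"
    using comm[OF that, of "Inr i"] by (simp only: reineke_quiver_simps act_reineke_rep_Inr)
qed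

text \<open>
  A homomorphism is a scalar \<open>\<mu>\<close> at vertex 2 and a scalar \<open>\<lambda>\<close> at vertex 1, and compatibility
  with the arrows from 2 to 1 reads \<open>\<lambda> f\<^sub>k = \<mu> h\<^sub>k\<close>. If \<open>\<mu> \<noteq> 0\<close>, then \<open>h\<^sub>k\<close> is a multiple of \<open>f\<^sub>k\<close>; so
  \<open>\<mu> = 0\<close>, and then \<open>\<lambda> = 0\<close> as \<open>f\<^sub>k \<noteq> 0\<close>. Vertex 3 follows since all its matrix entries also occur at
  vertex 2.
\<close>

lemma reineke_rep_in_left_perp:
  fixes f h :: "'r \<Rightarrow> ('n::finite, 'k::field) mpoly"
  assumes d: "d \<ge> 1" and f0: "\<And>i. f i \<noteq> 0"
    and f: "\<And>i. homogeneous UNIV d (f i)" and h: "\<And>i. homogeneous UNIV d (h i)"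
    and ideal: "\<And>j. coord_class f (h j) \<noteq> \<zero>\<^bsub>coord_ring f\<^esub>"
  shows "reineke_rep d f \<in> left_perp reineke_quiver (reineke_rep d h)"
  unfolding left_perp_def mem_Collect_eq
proof (intro conjI ballI)
  show "is_rep reineke_quiver (reineke_rep d f)" by (rule is_rep_reineke_rep)
  fix \<eta> i and x :: "('n \<Rightarrow>\<^sub>0 nat) \<Rightarrow> 'k"
  assume \<eta>: "\<eta> \<in> rep_hom reineke_quiver (reineke_rep d f) (reineke_rep d h)"
    and i: "i \<in> verts (reineke_quiver :: (nat, 'n + 'r) pre_digraph)"
    and x: "x \<in> carrier (vsp (reineke_rep d f) i)"
  note hom = rep_hom_reineke_repD(1-3)[OF d refl \<eta>, unfolded vsp_reineke_rep]
  note comm = rep_hom_reineke_repD(4,5)[OF d refl \<eta>, unfolded vsp_reineke_rep func_vs_simps]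
  let ?e = "\<lambda>e (a :: 'n \<Rightarrow>\<^sub>0 nat). (\<lambda>m\<in>monoms e. of_bool (m = a)) :: ('n \<Rightarrow>\<^sub>0 nat) \<Rightarrow> 'k"
  let ?E = "\<lambda>m a. \<eta> 2 (?e d a) m" and ?B = "\<lambda>m a. \<eta> 3 (?e (d - 1) a) m"
  let ?lam = "\<eta> 1 (\<lambda>m\<in>{0}. of_bool (m = 0)) 0"
  have e: "?e d a \<in> monoms d \<rightarrow>\<^sub>E UNIV" for a by simp
  have up: "m + unit_monom j \<in> monoms d" if "m \<in> monoms (d - 1)" for m :: "'n \<Rightarrow>\<^sub>0 nat" and j
    by (rule iffD2[OF monoms_add_unit[OF d] that])
  have contr: "\<eta> 3 (contraction d j (?e d a)) m = ?E (m + unit_monom j) a"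
    if "m \<in> monoms (d - 1)" for m a j
    using comm(1)[OF e, of j a] that by (simp add: contraction_def)
  have EB: "?E (m + unit_monom j) (a + unit_monom j) = ?B m a"
    if "m \<in> monoms (d - 1)" "a \<in> monoms (d - 1)" for m a j
  proof -
    have "contraction d j (?e d (a + unit_monom j)) = ?e (d - 1) a"
      unfolding contraction_def by (rule restrict_ext) (simp add: up[unfolded One_nat_def])
    then show ?thesis using contr[OF that(1), of j "a + unit_monom j"] by simp
  qed
  have E0: "?E (m + unit_monom j) a = 0"
    if m: "m \<in> monoms (d - 1)" and "Poly_Mapping.lookup a j = 0" for m a j
  proof -
    have "a \<noteq> m' + unit_monom j" for m' using \<open>Poly_Mapping.lookup a j = 0\<close> by (auto simp: lookup_add)
    then have "contraction d j (?e d a) = (\<lambda>m\<in>monoms (d - 1). 0)"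
      unfolding contraction_def using up by (intro restrict_ext) auto
    then show ?thesis
      using contr[OF m, of j a] module_hom_func_vs_zero[OF hom(3)] m by simp
  qed
  obtain \<mu> where \<mu>: "\<And>m a. m \<in> monoms d \<Longrightarrow> a \<in> monoms d \<Longrightarrow> ?E m a = \<mu> * of_bool (m = a)"
    using contraction_equivariant_matrix_scalar[of d ?E ?B, OF d E0 EB] by blast
  have coeff: "?lam * Poly_Mapping.lookup (f k) a = \<mu> * Poly_Mapping.lookup (h k) a" for k a
  proof (cases "a \<in> monoms d")
    case True
    have "\<eta> 1 (\<lambda>_\<in>{0}. pairing d (f k) (?e d a)) 0 = pairing d (f k) (?e d a) * ?lam"
      using module_hom_func_vs_expand[OF _ hom(1), of "\<lambda>_\<in>{0}. pairing d (f k) (?e d a)" 0] by simp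
    moreover have "pairing d (f k) (?e d a) = (\<Sum>m\<in>monoms d. if m = a then Poly_Mapping.lookup (f k) m else 0)"
      unfolding pairing_def by (rule sum.cong) auto
    moreover have "pairing d (h k) (\<eta> 2 (?e d a)) =
        (\<Sum>m\<in>monoms d. if m = a then \<mu> * Poly_Mapping.lookup (h k) m else 0)"
      unfolding pairing_def by (rule sum.cong) (auto simp: \<mu>[OF _ True])
    moreover have "\<eta> 1 (\<lambda>_\<in>{0}. pairing d (f k) (?e d a)) 0 = pairing d (h k) (\<eta> 2 (?e d a))"
      using comm(2)[OF e, of k a] by simp
    ultimately show ?thesis using True by (simp add: finite_monoms mult.commute)
  next
    case False
    then have "a \<notin> Poly_Mapping.keys (f k)" "a \<notin> Poly_Mapping.keys (h k)"
      using homogeneous_keys[OF f, of k] homogeneous_keys[OF h, of k] by auto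
    then show ?thesis by (simp add: in_keys_iff)
  qed
  have "\<mu> = 0"
  proof (rule ccontr)
    assume "\<mu> \<noteq> 0"
    fix k
    \<comment> \<open>Some index \<open>k\<close> exists because types are nonempty.\<close>
    have "h k = Poly_Mapping.single 0 (?lam / \<mu>) * f k"
    proof (rule poly_mapping_eqI)
      fix a
      have "Poly_Mapping.lookup (h k) a = ?lam / \<mu> * Poly_Mapping.lookup (f k) a"
        using coeff[of k a] \<open>\<mu> \<noteq> 0\<close> by (simp add: nonzero_eq_divide_eq mult.commute)
      then show "Poly_Mapping.lookup (h k) a =
          Poly_Mapping.lookup (Poly_Mapping.single 0 (?lam / \<mu>) * f k) a"
        unfolding lookup_scale .
    qed
    then show False using ideal[of k] coord_class_multiple_of_generator by metis
  qed
  have "?lam = 0"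
  proof -
    fix k
    obtain a where "Poly_Mapping.lookup (f k) a \<noteq> 0"
      using f0[of k] poly_mapping_eqI[of "f k" 0] by auto
    then show ?thesis using coeff[of k a] \<open>\<mu> = 0\<close> by simp
  qed
  have B0: "?B m a = 0" if "m \<in> monoms (d - 1)" "a \<in> monoms (d - 1)" for m a
  proof -
    fix j
    show ?thesis using EB[OF that, of j] \<mu>[OF up[OF that(1)] up[OF that(2)], of j j] \<open>\<mu> = 0\<close> by simp
  qed
  have zero: "y = (\<lambda>i\<in>I. 0)" if "y \<in> I \<rightarrow>\<^sub>E UNIV" "\<And>i. i \<in> I \<Longrightarrow> y i = 0"
    for y :: "('n \<Rightarrow>\<^sub>0 nat) \<Rightarrow> 'k" and I
    using that by (auto simp: fun_eq_iff PiE_def extensional_def)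
  have "\<eta> 1 y = (\<lambda>i\<in>{0}. 0)" if "y \<in> {0} \<rightarrow>\<^sub>E UNIV" for y
  proof (rule zero)
    show "\<eta> 1 y \<in> {0} \<rightarrow>\<^sub>E UNIV" using module_hom_closed[OF hom(1)] that by auto
    show "\<eta> 1 y k = 0" if "k \<in> {0}" for k
      using module_hom_func_vs_expand[OF _ hom(1) \<open>y \<in> {0} \<rightarrow>\<^sub>E UNIV\<close>, of k] \<open>?lam = 0\<close> that by simp
  qed
  moreover have "\<eta> 2 y = (\<lambda>i\<in>monoms d. 0)" if "y \<in> monoms d \<rightarrow>\<^sub>E UNIV" for y
  proof (rule zero)
    show "\<eta> 2 y \<in> monoms d \<rightarrow>\<^sub>E UNIV" using module_hom_closed[OF hom(2)] that by auto
    show "\<eta> 2 y k = 0" if "k \<in> monoms d" for k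
      using module_hom_func_vs_expand[OF finite_monoms hom(2) \<open>y \<in> monoms d \<rightarrow>\<^sub>E UNIV\<close> that]
        \<mu>[OF that] \<open>\<mu> = 0\<close> by simp
  qed
  moreover have "\<eta> 3 y = (\<lambda>i\<in>monoms (d - 1). 0)" if "y \<in> monoms (d - 1) \<rightarrow>\<^sub>E UNIV" for y
  proof (rule zero)
    show "\<eta> 3 y \<in> monoms (d - 1) \<rightarrow>\<^sub>E UNIV" using module_hom_closed[OF hom(3)] that by auto
    show "\<eta> 3 y k = 0" if "k \<in> monoms (d - 1)" for k
      using module_hom_func_vs_expand[OF finite_monoms hom(3) \<open>y \<in> monoms (d - 1) \<rightarrow>\<^sub>E UNIV\<close> that]
        B0[OF that] by simp
  qed
  ultimately show "\<eta> i x = \<zero>\<^bsub>vsp (reineke_rep d h) i\<^esub>"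
    using i x by auto
qed

text \<open>
  If all \<open>h\<^sub>j\<close> vanish at \<open>x\<close>, the inclusion is a nonzero homomorphism to \<open>W\<close>. Conversely, the
  images \<open>u\<close> and \<open>w\<close> of \<open>\<nu>\<^sub>d(x)\<close> and \<open>\<nu>\<^bsub>d-1\<^esub>(x)\<close> under a homomorphism satisfy \<open>g\<^sub>j(u) = x\<^sub>j w\<close>, so they
  are \<open>c \<nu>\<^sub>d(x)\<close> and \<open>c \<nu>\<^bsub>d-1\<^esub>(x)\<close> for some \<open>c\<close>; the arrows from 2 to 1 give \<open>c h\<^sub>k(x) = 0\<close>, because the
  subrepresentation is zero at vertex 1.
\<close>

lemma veronese_subrep_in_left_perp_iff:
  fixes f h :: "'r::finite \<Rightarrow> ('n::finite, 'k::field) mpoly"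
  assumes d: "d \<ge> 1" and f: "\<And>i. homogeneous UNIV d (f i)" and h: "\<And>i. homogeneous UNIV d (h i)"
    and x: "x \<in> nz_vectors UNIV" "line UNIV x \<in> proj_zeros f"
  shows "sub_rep (reineke_rep d f) (veronese_subrep d (line UNIV x)) \<in>
      left_perp reineke_quiver (reineke_rep d h) \<longleftrightarrow> (\<exists>j. peval (h j) x \<noteq> 0)"
proof -
  let ?U = "veronese_subrep d (line UNIV x)"
  let ?Y = "sub_rep (reineke_rep d f) ?U"
  have fx: "peval (f i) x = 0" for i using x line_in_proj_zeros[where f = f, OF f] by blast
  have ver: "ver e x \<in> monoms e \<rightarrow>\<^sub>E UNIV" for e by (simp add: ver_def)
  have U_sub: "?U \<in> subreps reineke_quiver (reineke_rep d f)"
    using veronese_subrep_in_Gr_points[where f = f, OF d f x(2)] by (simp add: Gr_points_def)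
  have rep: "is_rep reineke_quiver ?Y"
    by (rule is_rep_sub_rep[OF wf_digraph_reineke_quiver is_rep_reineke_rep U_sub])
  have U: "?U 2 = line (monoms d) (ver d x)" "?U 3 = line (monoms (d - 1)) (ver (d - 1) x)"
    by (simp_all add: veronese_line)
  have actY: "act ?Y = act (reineke_rep d f)" by (simp add: sub_rep_def)
  have vspY: "vsp ?Y 1 = (func_vs {0})\<lparr>carrier := {\<lambda>_\<in>{0}. 0}\<rparr>"
      "vsp ?Y 2 = (func_vs (monoms d))\<lparr>carrier := line (monoms d) (ver d x)\<rparr>"
      "vsp ?Y 3 = (func_vs (monoms (d - 1)))\<lparr>carrier := line (monoms (d - 1)) (ver (d - 1) x)\<rparr>"
    by (simp_all only: sub_rep_def qrep.simps vsp_reineke_rep veronese_subrep_simps veronese_line)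
  have self: "ver e x \<in> line (monoms e) (ver e x)" for e by (rule self_in_line[OF ver])
  show ?thesis
  proof
    assume perp: "?Y \<in> left_perp reineke_quiver (reineke_rep d h)"
    show "\<exists>j. peval (h j) x \<noteq> 0"
    proof (rule ccontr)
      assume no: "\<nexists>j. peval (h j) x \<noteq> 0"
      have "(\<lambda>_ v. v) \<in> rep_hom reineke_quiver ?Y (reineke_rep d h)"
        unfolding rep_hom_def mem_Collect_eq
      proof (intro conjI ballI)
        fix i :: nat assume i: "i \<in> verts (reineke_quiver :: (nat, 'n + 'r) pre_digraph)"
        have "?U i \<subseteq> carrier (vsp (reineke_rep d f) i)"
          using subreps_subspace[OF U_sub i] by (auto simp: VectorSpace.subspace_def submodule_def)
        moreover have "vsp (reineke_rep d h) i = vsp (reineke_rep d f) i"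
          by (simp add: reineke_rep_def)
        ultimately show "(\<lambda>v. v) \<in> module_hom class_ring (vsp ?Y i) (vsp (reineke_rep d h) i)"
          by (auto simp: module_hom_def sub_rep_def)
      next
        fix a :: "'n + 'r" and v :: "('n \<Rightarrow>\<^sub>0 nat) \<Rightarrow> 'k"
        assume "v \<in> carrier (vsp ?Y (tail reineke_quiver a))"
        then have "v \<in> line (monoms d) (ver d x)" by (simp add: vspY)
        then obtain c where c: "v = (\<lambda>m\<in>monoms d. c * ver d x m)" by (auto simp: line_def)
        show "act ?Y a v = act (reineke_rep d h) a v"
          unfolding actY c using no
          by (cases a) (simp_all add: act_reineke_rep_Inl[OF d] act_reineke_rep_Inr
              pairing_ver[OF f] pairing_ver[OF h] fx)
      qed
      then have "ver d x = \<zero>\<^bsub>vsp (reineke_rep d h) 2\<^esub>"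
        using perp[unfolded left_perp_def mem_Collect_eq, THEN conjunct2, rule_format,
            of "\<lambda>_ v. v" 2 "ver d x"] self[of d]
        by (simp add: vspY(2))
      then show False using ver_nz_vectors[OF x(1), of d] by (simp add: nz_vectors_def)
    qed
  next
    assume "\<exists>j. peval (h j) x \<noteq> 0"
    then obtain k where k: "peval (h k) x \<noteq> 0" by blast
    show "?Y \<in> left_perp reineke_quiver (reineke_rep d h)"
      unfolding left_perp_def mem_Collect_eq
    proof (intro conjI ballI)
      show "is_rep reineke_quiver ?Y" by (rule rep)
      fix \<eta> i and v :: "('n \<Rightarrow>\<^sub>0 nat) \<Rightarrow> 'k"
      assume \<eta>: "\<eta> \<in> rep_hom reineke_quiver ?Y (reineke_rep d h)"
        and i: "i \<in> verts (reineke_quiver :: (nat, 'n + 'r) pre_digraph)"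
        and v: "v \<in> carrier (vsp ?Y i)"
      note hom = rep_hom_reineke_repD(1-3)[OF d actY \<eta>, unfolded vspY]
      note comm = rep_hom_reineke_repD(4,5)[OF d actY \<eta>, unfolded vspY]
      let ?u = "\<eta> 2 (ver d x)" and ?w = "\<eta> 3 (ver (d - 1) x)"
      have ver_eq: "(\<lambda>m\<in>monoms e. 1 * ver e x m) = ver e x" for e by (simp add: ver_def fun_eq_iff)
      have contr: "contraction d j (ver d x) = (\<lambda>m\<in>monoms (d - 1). x j * ver (d - 1) x m)" for j
        using contraction_ver[OF d, of j 1 x] unfolding ver_eq by simp
      have smult2: "\<eta> 2 (\<lambda>m\<in>monoms d. c * ver d x m) = (\<lambda>m\<in>monoms d. c * ?u m)" for c
        using module_hom_smult[OF hom(2), of c "ver d x"] self[of d] by simp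
      have smult3: "\<eta> 3 (\<lambda>m\<in>monoms (d - 1). c * ver (d - 1) x m) = (\<lambda>m\<in>monoms (d - 1). c * ?w m)" for c
        using module_hom_smult[OF hom(3), of c "ver (d - 1) x"] self[of "d - 1"] by simp
      have u_eq: "contraction d j ?u = (\<lambda>m\<in>monoms (d - 1). x j * ?w m)" for j
        using comm(1)[of "ver d x" j] self[of d] by (simp add: contr smult3[unfolded One_nat_def])
      have uw: "?u (m + unit_monom j) = x j * ?w m" if "m \<in> monoms (d - 1)" for m j
        using fun_cong[OF u_eq[of j], of m] that by (simp add: contraction_def)
      obtain l where l: "x l \<noteq> 0" using x(1) by (auto simp: nz_vectors_iff)
      obtain c where c: "\<And>m. m \<in> monoms d \<Longrightarrow> ?u m = c * mono_eval m x"
        "\<And>m. m \<in> monoms (d - 1) \<Longrightarrow> ?w m = c * mono_eval m x"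
        using rank_one_catalecticant[where y = x and u = ?u and w = ?w, OF d l uw, of thesis] by blast
      have \<eta>1: "\<eta> 1 (\<lambda>_\<in>{0}. 0) = (\<lambda>_\<in>{0}. 0)"
        using module_hom_smult[OF hom(1), of 0 "\<lambda>_\<in>{0}. 0"] by (simp add: fun_eq_iff)
      have "pairing d (f k) (ver d x) = 0"
        using pairing_ver[OF f, of k 1 x] unfolding ver_eq fx by simp
      then have "(\<lambda>_\<in>{0::'n \<Rightarrow>\<^sub>0 nat}. pairing d (h k) ?u) = (\<lambda>_\<in>{0}. 0)"
        using comm(2)[of "ver d x" k] self[of d] \<eta>1 by simp
      then have "pairing d (h k) ?u = 0" by (metis restrict_apply' singletonI)
      moreover have "pairing d (h k) ?u = pairing d (h k) (\<lambda>m\<in>monoms d. c * ver d x m)"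
        unfolding pairing_def
      proof (rule sum.cong)
        fix m :: "'n \<Rightarrow>\<^sub>0 nat" assume m: "m \<in> monoms d"
        show "?u m * Poly_Mapping.lookup (h k) m =
            (\<lambda>m\<in>monoms d. c * ver d x m) m * Poly_Mapping.lookup (h k) m"
          unfolding c(1)[OF m] using m by (simp add: ver_def)
      qed simp
      ultimately have "c = 0" using pairing_ver[OF h, of k c x] k by simp
      then have "?u m = 0" if "m \<in> monoms d" for m using c(1)[OF that] by simp
      then have \<eta>2: "\<eta> 2 (\<lambda>m\<in>monoms d. t * ver d x m) = (\<lambda>m\<in>monoms d. 0)" for t
        unfolding smult2 by (intro restrict_ext) simp
      have "?w m = 0" if "m \<in> monoms (d - 1)" for m using c(2)[OF that] \<open>c = 0\<close> by simp
      then have \<eta>3: "\<eta> 3 (\<lambda>m\<in>monoms (d - 1). t * ver (d - 1) x m) = (\<lambda>m\<in>monoms (d - 1). 0)" for t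
        unfolding smult3 by (intro restrict_ext) simp
      consider "i = 1" | "i = 2" | "i = 3" using i by auto
      then show "\<eta> i v = \<zero>\<^bsub>vsp (reineke_rep d h) i\<^esub>"
      proof cases
        case 1
        then have "v = (\<lambda>_\<in>{0}. 0)" using v unfolding 1 vspY by simp
        then show ?thesis unfolding 1 vsp_reineke_rep func_vs_simps using \<eta>1 by simp
      next
        case 2
        then obtain t where "v = (\<lambda>m\<in>monoms d. t * ver d x m)"
          using v unfolding 2 vspY by (auto simp: line_def)
        then show ?thesis unfolding 2 vsp_reineke_rep func_vs_simps using \<eta>2 by simp
      next
        case 3
        then obtain t where "v = (\<lambda>m\<in>monoms (d - 1). t * ver (d - 1) x m)"
          using v unfolding 3 vspY by (auto simp: line_def)
        then show ?thesis unfolding 3 vsp_reineke_rep func_vs_simps using \<eta>3 by simp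
      qed
    qed
  qed
qed

lemma line_in_D_plus:
  fixes f :: "'r \<Rightarrow> ('n::finite, 'k::field) mpoly"
  assumes "homogeneous UNIV d p" "x \<in> nz_vectors UNIV"
  shows "line UNIV x \<in> D_plus f p \<longleftrightarrow> line UNIV x \<in> proj_zeros f \<and> peval p x \<noteq> 0"
  using line_in_proj_nonvanishing[OF finite assms] assms(2)
  by (auto simp: D_plus_def proj_nonvanishing_def proj_points_eq)

text \<open>
  The condition on the quotient is automatic, as the left perpendicular category of \<open>W\<close> is closed under quotients and contains \<open>V\<close>;
  so only the condition on the subrepresentation has to be examined.
\<close>

lemma Gr_in_points_reineke_rep:
  fixes f h :: "'r::finite \<Rightarrow> ('n::finite, 'k::field) mpoly"
  assumes d: "d \<ge> 1" and f: "\<And>i. homogeneous UNIV d (f i)" and h: "\<And>i. homogeneous UNIV d (h i)"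
    and V: "reineke_rep d f \<in> left_perp reineke_quiver (reineke_rep d h)"
  shows "Gr_in_points reineke_quiver (left_perp reineke_quiver (reineke_rep d h))
      (left_perp reineke_quiver (reineke_rep d h)) dim_011 (reineke_rep d f) =
    veronese_subrep d ` (\<Union>j. D_plus f (h j))"
proof -
  let ?G = "Gr_in_points reineke_quiver (left_perp reineke_quiver (reineke_rep d h))
      (left_perp reineke_quiver (reineke_rep d h)) dim_011 (reineke_rep d f)"
  have iff: "veronese_subrep d L \<in> Gr_in_points reineke_quiver (left_perp reineke_quiver (reineke_rep d h))
      (left_perp reineke_quiver (reineke_rep d h)) dim_011 (reineke_rep d f) \<longleftrightarrow> L \<in> (\<Union>j. D_plus f (h j))"
    if L: "L \<in> proj_zeros f" for L
  proof -
    have "L \<in> proj_points UNIV" using L by (simp add: proj_zeros_def)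
    then obtain x where x: "x \<in> nz_vectors UNIV" "L = line UNIV x" by (rule proj_pointsE[OF finite])
    have Gr: "veronese_subrep d L \<in> Gr_points reineke_quiver dim_011 (reineke_rep d f)"
      by (rule veronese_subrep_in_Gr_points[where f = f, OF d f L])
    then have "quot_rep reineke_quiver (reineke_rep d f) (veronese_subrep d L) \<in>
        left_perp reineke_quiver (reineke_rep d h)"
      by (intro left_perp_quot_rep[OF wf_digraph_reineke_quiver V]) (simp add: Gr_points_def)
    moreover have "sub_rep (reineke_rep d f) (veronese_subrep d L) \<in>
        left_perp reineke_quiver (reineke_rep d h) \<longleftrightarrow> (\<exists>j. peval (h j) x \<noteq> 0)"
      using veronese_subrep_in_left_perp_iff[where f = f and h = h, OF d f h x(1)] L x(2) by simp
    moreover have "L \<in> (\<Union>j. D_plus f (h j)) \<longleftrightarrow> (\<exists>j. peval (h j) x \<noteq> 0)"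
      using line_in_D_plus[OF h x(1), of f] L x(2) by simp
    ultimately show ?thesis using Gr by (simp add: Gr_in_points_def)
  qed
  have sub: "?G \<subseteq> veronese_subrep d ` proj_zeros f"
    using Gr_points_reineke_rep[where f = f, OF d f] by (auto simp: Gr_in_points_def)
  have D: "(\<Union>j. D_plus f (h j)) \<subseteq> proj_zeros f" by (auto simp: D_plus_def)
  show ?thesis
  proof (intro equalityI subsetI)
    fix U assume U: "U \<in> ?G"
    then obtain L where "L \<in> proj_zeros f" "U = veronese_subrep d L" using sub by auto
    then show "U \<in> veronese_subrep d ` (\<Union>j. D_plus f (h j))" using iff U by blast
  next
    fix U assume "U \<in> veronese_subrep d ` (\<Union>j. D_plus f (h j))"
    then obtain L where L: "L \<in> (\<Union>j. D_plus f (h j))" "U = veronese_subrep d L" by auto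
    then have "L \<in> proj_zeros f" using D by auto
    then show "U \<in> ?G" using iff L by simp
  qed
qed

section \<open>Reineke's isomorphism\<close>

lemma function_algebra_frame_polys: "function_algebra (frame_polys I V dv)"
  by unfold_locales (rule frame_polys.intros; assumption)+

abbreviation reineke_spaces :: "nat \<Rightarrow> ('r \<Rightarrow> ('n, 'k::field) mpoly) \<Rightarrow> nat \<Rightarrow>
    ('k, ('n \<Rightarrow>\<^sub>0 nat) \<Rightarrow> 'k) module" where
  "reineke_spaces d f \<equiv> vsp (reineke_rep d f)"

abbreviation reineke_frames :: "nat \<Rightarrow> ('r \<Rightarrow> ('n, 'k::field) mpoly) \<Rightarrow>
    (nat \<Rightarrow> nat \<Rightarrow> ('n \<Rightarrow>\<^sub>0 nat) \<Rightarrow> 'k) set" where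
  "reineke_frames d f \<equiv> frames {1, 2, 3} (reineke_spaces d f) dim_011"

abbreviation reineke_span :: "nat \<Rightarrow> ('r \<Rightarrow> ('n, 'k::field) mpoly) \<Rightarrow>
    (nat \<Rightarrow> nat \<Rightarrow> ('n \<Rightarrow>\<^sub>0 nat) \<Rightarrow> 'k) \<Rightarrow> nat \<Rightarrow> (('n \<Rightarrow>\<^sub>0 nat) \<Rightarrow> 'k) set" where
  "reineke_span d f \<equiv> frame_span {1, 2, 3} (reineke_spaces d f) dim_011"

lemma reineke_span_simps:
  fixes f :: "'r \<Rightarrow> ('n::finite, 'k::field) mpoly"
  shows "reineke_span d f b 1 = {\<lambda>_\<in>{0}. 0}"
    "b 2 0 \<in> monoms d \<rightarrow>\<^sub>E UNIV \<Longrightarrow> reineke_span d f b 2 = line (monoms d) (b 2 0)"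
    "b 3 0 \<in> monoms (d - 1) \<rightarrow>\<^sub>E UNIV \<Longrightarrow> reineke_span d f b 3 = line (monoms (d - 1)) (b 3 0)"
proof -
  have one: "{..<1::nat} = {0}" by auto
  show "reineke_span d f b 1 = {\<lambda>_\<in>{0}. 0}"
    using subspace_zero(2)[of "{0::'n \<Rightarrow>\<^sub>0 nat}", where 'k = 'k] by (simp add: frame_span_def)
  show "reineke_span d f b 2 = line (monoms d) (b 2 0)" if "b 2 0 \<in> monoms d \<rightarrow>\<^sub>E UNIV"
    using subspace_line(2)[OF that] by (simp add: frame_span_def one[unfolded One_nat_def])
  show "reineke_span d f b 3 = line (monoms (d - 1)) (b 3 0)" if "b 3 0 \<in> monoms (d - 1) \<rightarrow>\<^sub>E UNIV"
    using subspace_line(2)[OF that] by (simp add: frame_span_def one[unfolded One_nat_def])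
qed

lemma frame_vector_2:
  fixes f :: "'r \<Rightarrow> ('n::finite, 'k::field) mpoly"
  assumes b: "b \<in> reineke_frames d f"
  shows "b 2 0 \<in> nz_vectors (monoms d)" "reineke_span d f b 2 = line (monoms d) (b 2 0)"
proof -
  have "b 2 \<in> {..<dim_011 2} \<rightarrow>\<^sub>E carrier (reineke_spaces d f 2)"
    using b unfolding frames_def by blast
  then have b2: "b 2 0 \<in> monoms d \<rightarrow>\<^sub>E UNIV" by (auto simp: PiE_iff)
  show span: "reineke_span d f b 2 = line (monoms d) (b 2 0)" by (rule reineke_span_simps(2)[where b = b, OF b2])
  have "sub_dim (func_vs (monoms d)) (reineke_span d f b 2) = 1"
    using b unfolding frames_def by auto
  then obtain u where u: "u \<in> nz_vectors (monoms d)" "line (monoms d) (b 2 0) = line (monoms d) u"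
    using sub_dim_eq_1_iff_line[OF finite_monoms subspace_line(1)[OF b2]] unfolding span by blast
  then have "u \<in> line (monoms d) (b 2 0)"
    using self_in_line[of u "monoms d"] by (simp add: nz_vectors_def)
  then obtain c where "u = (\<lambda>m\<in>monoms d. c * b 2 0 m)" by (auto simp: line_def)
  then show "b 2 0 \<in> nz_vectors (monoms d)"
    using u(1) b2 by (auto simp: nz_vectors_iff)
qed

definition veronese_frame :: "nat \<Rightarrow> ('n \<Rightarrow> 'k::field) \<Rightarrow> nat \<Rightarrow> nat \<Rightarrow> ('n \<Rightarrow>\<^sub>0 nat) \<Rightarrow> 'k" where
  "veronese_frame d x =
    (\<lambda>i\<in>{1, 2, 3}. \<lambda>l\<in>{..<dim_011 i}. if i = 2 then ver d x else ver (d - 1) x)"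

lemma veronese_frame:
  fixes f :: "'r \<Rightarrow> ('n::finite, 'k::field) mpoly"
  assumes x: "x \<in> nz_vectors UNIV"
  shows "veronese_frame d x \<in> reineke_frames d f"
    "reineke_span d f (veronese_frame d x) = veronese_subrep d (line UNIV x)"
proof -
  let ?b = "veronese_frame d x"
  have ver: "ver e x \<in> monoms e \<rightarrow>\<^sub>E UNIV" for e by (simp add: ver_def)
  have b: "?b 2 0 = ver d x" "?b 3 0 = ver (d - 1) x" by (simp_all add: veronese_frame_def)
  note span = reineke_span_simps(1)[of d f ?b]
    reineke_span_simps(2)[where d = d and f = f and b = ?b, unfolded b(1), OF ver]
    reineke_span_simps(3)[where d = d and f = f and b = ?b, unfolded b(2), OF ver]
  show eq: "reineke_span d f ?b = veronese_subrep d (line UNIV x)"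
  proof (rule extensionalityI[of _ "{1, 2, 3}"])
    show "reineke_span d f ?b \<in> extensional {1, 2, 3}" by (simp add: frame_span_def)
    show "veronese_subrep d (line UNIV x) \<in> extensional {1, 2, 3}" by (simp add: veronese_subrep_def)
    show "reineke_span d f ?b i = veronese_subrep d (line UNIV x) i" if "i \<in> {1, 2, 3}" for i
      using that span by (auto simp: veronese_line)
  qed
  have "?b \<in> (\<Pi>\<^sub>E i\<in>{1, 2, 3}. {..<dim_011 i} \<rightarrow>\<^sub>E carrier (reineke_spaces d f i))"
    using ver by (auto simp: veronese_frame_def)
  moreover have "sub_dim (reineke_spaces d f i) (veronese_subrep d (line UNIV x) i) = dim_011 i"
    if "i \<in> {1, 2, 3}" for i
    using that
    by (auto simp: veronese_line sub_dim_eq_0_iff[OF _ subspace_zero(1)]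
        sub_dim_line[unfolded One_nat_def, OF finite_monoms ver_nz_vectors[OF x]])
  ultimately show "?b \<in> reineke_frames d f"
    unfolding frames_def mem_Collect_eq eq by blast
qed

lemma Gr_prod_to_proj_space:
  fixes f :: "'r \<Rightarrow> ('n::finite, 'k::field) mpoly"
  shows "variety_morphism (Gr_prod {1, 2, 3} (reineke_spaces d f) dim_011) (proj_space (monoms d)) (\<lambda>U. U 2)"
  unfolding Gr_prod_def
proof (rule function_algebra.variety_morphism_quotient_to_proj_space[OF function_algebra_frame_polys finite_monoms])
  show "(\<lambda>b. b 2 0 m) \<in> frame_polys {1, 2, 3} (reineke_spaces d f) dim_011" if m: "m \<in> monoms d" for m
  proof -
    have "(\<lambda>v. v m) \<in> module_hom class_ring (reineke_spaces d f 2) scalars"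
      using m by (simp add: module_hom_def scalars_def)
    then have "(\<lambda>b. (\<lambda>v. v m) (b 2 0)) \<in> frame_polys {1, 2, 3} (reineke_spaces d f) dim_011"
      by (intro frame_polys.functional) auto
    then show ?thesis by simp
  qed
qed (use frame_vector_2 in blast)+

text \<open>
  A linear functional of \<open>\<nu>\<^sub>e(x)\<close> is a form of degree \<open>e\<close> in \<open>x\<close>. As \<open>e\<close> is \<open>d\<close> or \<open>d - 1\<close>,
  depending on the vertex, sums of such functionals are in general inhomogeneous.
\<close>

lemma polyfun_frame_poly:
  fixes f :: "'r \<Rightarrow> ('n::finite, 'k::field) mpoly"
  assumes "a \<in> frame_polys {1, 2, 3} (reineke_spaces d f) dim_011"
  shows "polyfun UNIV (\<lambda>x. a (veronese_frame d x))"
  using assms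
proof induction
  case (const c)
  show ?case by (rule polyfun.form[OF form_const])
next
  case (functional i l \<xi>)
  have lin: "polyfun UNIV (\<lambda>x. \<xi> (ver e x))"
    if \<xi>: "\<xi> \<in> module_hom class_ring (func_vs (monoms e)) scalars" for e
  proof -
    let ?c = "\<lambda>m. \<xi> (\<lambda>m'\<in>monoms e. of_bool (m' = m))"
    have add: "\<xi> (\<lambda>i\<in>monoms e. x i + y i) = \<xi> x + \<xi> y"
      if "x \<in> monoms e \<rightarrow>\<^sub>E UNIV" "y \<in> monoms e \<rightarrow>\<^sub>E UNIV" for x y
      using module_hom_add[OF \<xi>, of x y] that by (simp add: scalars_def)
    have smult: "\<xi> (\<lambda>i\<in>monoms e. c * x i) = c * \<xi> x" if "x \<in> monoms e \<rightarrow>\<^sub>E UNIV" for x c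
      using module_hom_smult[OF \<xi>, of c x] that by (simp add: scalars_def)
    have "\<xi> (ver e x) = (\<Sum>m\<in>monoms e. ?c m * mono_eval m x)" for x
    proof -
      have "\<xi> (ver e x) = (\<Sum>m\<in>monoms e. ver e x m * ?c m)"
      proof (rule linear_functional_expand[OF finite_monoms _ add smult])
        show "ver e x \<in> monoms e \<rightarrow>\<^sub>E UNIV" by (simp add: ver_def)
      qed
      also have "\<dots> = (\<Sum>m\<in>monoms e. ?c m * mono_eval m x)"
        by (rule sum.cong) (auto simp: ver_def)
      finally show ?thesis .
    qed
    moreover have "form UNIV e (\<lambda>x. \<Sum>m\<in>monoms e. ?c m * mono_eval m x)"
    proof (rule form_sum[OF finite_monoms form_cmult])
      show "form UNIV e (mono_eval m)" if "m \<in> monoms e" for m :: "'n \<Rightarrow>\<^sub>0 nat"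
        using form_mono_eval[of m] that by (simp add: monoms_def)
    qed
    ultimately show ?thesis by (simp add: polyfun.form)
  qed
  consider "i = 2" | "i = 3" using functional by fastforce
  then show ?case
  proof cases
    case 1
    then show ?thesis using functional lin[of d] by (simp add: veronese_frame_def)
  next
    case 2
    then show ?thesis using functional lin[of "d - 1"] by (simp add: veronese_frame_def)
  qed
next
  case (add p q)
  then show ?case by (intro polyfun.add)
next
  case (mult p q)
  then show ?case by (intro polyfun_mult)
qed

lemma proj_space_to_Gr_prod:
  fixes f :: "'r \<Rightarrow> ('n::finite, 'k::field) mpoly"
  assumes "infinite (UNIV :: 'k set)"
  shows "variety_morphism (proj_space UNIV) (Gr_prod {1, 2, 3} (reineke_spaces d f) dim_011) (veronese_subrep d)"
  unfolding Gr_prod_def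
proof (rule function_algebra.variety_morphism_proj_space_to_quotient[OF function_algebra_frame_polys assms finite])
  show "polyfun UNIV (\<lambda>x. a (veronese_frame d x))"
    if "a \<in> frame_polys {1, 2, 3} (reineke_spaces d f) dim_011" for a
    by (rule polyfun_frame_poly[OF that])
qed (rule veronese_frame(1) veronese_frame(2)[symmetric]; assumption)+

text \<open>
  Applied to \<open>\<nu>\<^sub>d(x)\<close> this gives \<open>x\<^sub>i\<^bsup>d-1\<^esup> x\<close>, so it inverts the Veronese embedding on the chart
  \<open>x\<^sub>i \<noteq> 0\<close>.
\<close>

definition veronese_section :: "nat \<Rightarrow> 'n \<Rightarrow> (('n \<Rightarrow>\<^sub>0 nat) \<Rightarrow> 'k) \<Rightarrow> 'n \<Rightarrow> 'k" where
  "veronese_section d i u = (\<lambda>j. u (Poly_Mapping.single i (d - 1) + unit_monom j))"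

lemma veronese_section_index:
  assumes "d \<ge> 1"
  shows "Poly_Mapping.single i (d - 1) + unit_monom j \<in> monoms d"
    "Poly_Mapping.single i (d - 1) + unit_monom i = Poly_Mapping.single i d"
  using assms monoms_add_unit[OF assms, of "Poly_Mapping.single i (d - 1)" j]
  by (auto simp flip: single_add)

lemma veronese_section_line:
  fixes u :: "('n::finite \<Rightarrow>\<^sub>0 nat) \<Rightarrow> 'k::field"
  assumes d: "d \<ge> 1"
  shows "veronese_section d i ` line (monoms d) u = line UNIV (veronese_section d i u)"
proof -
  have "veronese_section d i (\<lambda>m\<in>monoms d. c * u m) = (\<lambda>j\<in>UNIV. c * veronese_section d i u j)" for c
    using veronese_section_index(1)[OF d, of i] by (auto simp: veronese_section_def)
  then show ?thesis by (simp add: line_def image_image)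
qed

lemma veronese_section_veronese:
  fixes x :: "'n::finite \<Rightarrow> 'k::field"
  assumes d: "d \<ge> 1" and "x i \<noteq> 0"
  shows "veronese_section d i ` veronese d (line UNIV x) = line UNIV x"
proof -
  have "veronese_section d i (ver d x) = (\<lambda>j\<in>UNIV. x i ^ (d - 1) * x j)"
    using veronese_section_index(1)[OF d, of i] by (auto simp: veronese_section_def ver_def mono_eval_add)
  then have "line UNIV (veronese_section d i (ver d x)) = line UNIV x"
    using line_scale[of "x i ^ (d - 1)" UNIV x] assms(2) by simp
  then show ?thesis by (simp add: veronese_line veronese_section_line[OF d])
qed

lemma veronese_coordinate_nonzero:
  fixes x y :: "'n::finite \<Rightarrow> 'k::field"
  assumes "veronese d (line UNIV x) = veronese d (line UNIV y)"
    and x: "x \<in> nz_vectors UNIV" and y: "y \<in> nz_vectors UNIV" and "d \<ge> 1" "x i \<noteq> 0"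
  shows "y i \<noteq> 0"
proof -
  obtain t where t: "t \<noteq> 0" "ver d y = (\<lambda>m\<in>monoms d. t * ver d x m)"
    using assms(1) unfolding veronese_line
    by (rule line_eqD[OF _ ver_nz_vectors[OF x] ver_nz_vectors[OF y]])
  then have "ver d y (Poly_Mapping.single i d) = t * ver d x (Poly_Mapping.single i d)" by simp
  then have "y i ^ d = t * x i ^ d" by (simp add: ver_def)
  then show ?thesis using \<open>t \<noteq> 0\<close> \<open>x i \<noteq> 0\<close> \<open>d \<ge> 1\<close> by (metis mult_eq_0_iff power_eq_0_iff not_one_le_zero gr_zeroI)
qed

lemma inj_on_veronese:
  assumes d: "d \<ge> 1"
  shows "inj_on (veronese d) (proj_points UNIV :: ('n::finite \<Rightarrow> 'k::field) set set)"
proof (rule inj_onI)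
  fix L L' :: "('n \<Rightarrow> 'k) set"
  assume L: "L \<in> proj_points UNIV" "L' \<in> proj_points UNIV" and eq: "veronese d L = veronese d L'"
  obtain x where x: "x \<in> nz_vectors UNIV" "L = line UNIV x" using L(1) by (rule proj_pointsE[OF finite])
  obtain y where y: "y \<in> nz_vectors UNIV" "L' = line UNIV y" using L(2) by (rule proj_pointsE[OF finite])
  obtain i where i: "x i \<noteq> 0" using x(1) by (auto simp: nz_vectors_iff)
  then have "y i \<noteq> 0"
    by (rule veronese_coordinate_nonzero[OF eq[unfolded x(2) y(2)] x(1) y(1) d])
  then have "L' = veronese_section d i ` veronese d L'"
    unfolding y(2) by (rule veronese_section_veronese[symmetric, OF d])
  also have "\<dots> = L"
    unfolding eq[symmetric] x(2) by (rule veronese_section_veronese[where x = x, OF d i])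
  finally show "L = L'" by simp
qed

text \<open>
  Every \<open>x\<close> has a nonzero coordinate \<open>x\<^sub>i\<close>, and near the image of \<open>K x\<close>, where the coordinate at \<open>T\<^sub>i\<^sup>d\<close> does
  not vanish, the inverse agrees with the linear map \<open>veronese_section d i\<close>.
\<close>

lemma veronese_inverse_morphism:
  fixes X :: "('n::finite \<Rightarrow> 'k::field) set set"
  assumes d: "d \<ge> 1" and X: "X \<subseteq> proj_points UNIV"
  shows "variety_morphism (sub_kspace (proj_space (monoms d)) (veronese d ` X))
    (sub_kspace (proj_space UNIV) X) (the_inv_into X (veronese d))"
proof (rule variety_morphism_sub_kspace_local)
  have inj: "inj_on (veronese d) X" by (rule inj_on_subset[OF inj_on_veronese[OF d] X])
  show "the_inv_into X (veronese d) ` (topspace (ktop (proj_space (monoms d))) \<inter> veronese d ` X)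
      \<subseteq> topspace (ktop (proj_space UNIV)) \<inter> X"
    using X by (auto simp: the_inv_into_f_f[OF inj] topspace_proj_space)
  fix L' assume "L' \<in> topspace (ktop (proj_space (monoms d))) \<inter> veronese d ` X"
  then obtain L where L: "L \<in> X" "L' = veronese d L" by blast
  then have "L \<in> proj_points UNIV" using X by blast
  then obtain x where x: "x \<in> nz_vectors UNIV" "L = line UNIV x" by (rule proj_pointsE[OF finite])
  obtain i where i: "x i \<noteq> 0" using x(1) by (auto simp: nz_vectors_iff)
  let ?s = "\<lambda>u :: ('n \<Rightarrow>\<^sub>0 nat) \<Rightarrow> 'k. u (Poly_Mapping.single i d)"
  let ?N = "{line (monoms d) u | u. u \<in> nz_vectors (monoms d) \<and> ?s u \<noteq> 0}"
  have "local_morphism (proj_space (monoms d)) (proj_space UNIV) ?N (image (veronese_section d i))"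
  proof (rule local_morphism_proj_space[OF finite_monoms finite, where G = "veronese_section d i" and e = 1])
    show "form (monoms d) 1 ?s" by (rule form_coord) simp
    show "form (monoms d) 1 (\<lambda>u. veronese_section d i u j)" for j
      unfolding veronese_section_def by (rule form_coord[OF veronese_section_index(1)[OF d]])
    show "veronese_section d i u \<in> nz_vectors UNIV" if "?s u \<noteq> 0" for u :: "('n \<Rightarrow>\<^sub>0 nat) \<Rightarrow> 'k"
    proof -
      have "veronese_section d i u i \<noteq> 0"
        using that unfolding veronese_section_def veronese_section_index(2)[OF d] .
      then show ?thesis by (auto simp: nz_vectors_iff)
    qed
    show "veronese_section d i ` line (monoms d) u = line UNIV (veronese_section d i u)"
      for u :: "('n \<Rightarrow>\<^sub>0 nat) \<Rightarrow> 'k"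
      by (rule veronese_section_line[OF d])
  qed
  moreover have "L' \<in> ?N"
    using ver_nz_vectors[OF x(1), of d] i unfolding L(2) x(2) veronese_line
    by (intro CollectI exI[of _ "ver d x"]) (simp add: ver_def)
  moreover have "the_inv_into X (veronese d) M = veronese_section d i ` M" if M: "M \<in> ?N \<inter> veronese d ` X" for M
  proof -
    obtain P where P: "P \<in> X" "M = veronese d P" using M by blast
    then have "P \<in> proj_points UNIV" using X by blast
    then obtain y where y: "y \<in> nz_vectors UNIV" "P = line UNIV y" by (rule proj_pointsE[OF finite])
    obtain u where u: "M = line (monoms d) u" "u \<in> nz_vectors (monoms d)" "?s u \<noteq> 0"
      using M by blast
    have "line (monoms d) (ver d y) = line (monoms d) u" using P(2) y(2) u(1) veronese_line by metis
    from line_eqD[OF this ver_nz_vectors[OF y(1)] u(2)]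
    obtain t where "u = (\<lambda>m\<in>monoms d. t * ver d y m)" by metis
    then have "?s u = t * ver d y (Poly_Mapping.single i d)" by simp
    then have "?s u = t * y i ^ d" by (simp add: ver_def)
    then have "y i \<noteq> 0" using u(3) d by (auto simp: power_0_left)
    then have "veronese_section d i ` M = P"
      unfolding P(2) y(2) by (rule veronese_section_veronese[OF d])
    then show ?thesis using the_inv_into_f_f[OF inj P(1)] P(2) by simp
  qed
  ultimately show "\<exists>N F. L' \<in> N \<and> local_morphism (proj_space (monoms d)) (proj_space UNIV) N F \<and>
      (\<forall>M\<in>N \<inter> veronese d ` X. the_inv_into X (veronese d) M = F M)"
    by (intro exI[of _ ?N] exI[of _ "image (veronese_section d i)"]) blast
qed

text \<open>
  The morphism \<open>A\<close> maps \<open>L\<close> to \<open>veronese_subrep d L\<close>, \<open>B\<close> maps \<open>U\<close> to \<open>U 2\<close>, and \<open>D\<close> inverts the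
  Veronese embedding. That embedding is \<open>B \<circ> A\<close>, so it needs no separate
  treatment, and \<open>A \<circ> D\<close> is the inverse of \<open>B\<close>.
\<close>

lemma reineke_isomorphisms:
  fixes f :: "'r::finite \<Rightarrow> ('n::finite, 'k::field) mpoly"
  assumes inf: "infinite (UNIV :: 'k set)" and d: "d \<ge> 1" and f: "\<And>i. homogeneous UNIV d (f i)"
  defines "X \<equiv> proj_zeros f"
  defines "Xvar \<equiv> sub_kspace (proj_space UNIV) X"
    and "Yvar \<equiv> sub_kspace (proj_space (monoms d)) (veronese d ` X)"
    and "Gvar \<equiv> Gr_var reineke_quiver dim_011 (reineke_rep d f)"
  shows "variety_iso Gvar Yvar (\<lambda>U. U 2)"
    "variety_iso Xvar Yvar (veronese d)"
    "variety_iso Yvar Xvar (the_inv_into X (veronese d))"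
    "topspace (ktop Gvar) = veronese_subrep d ` X"
proof -
  let ?P = "Gr_prod {1, 2, 3} (reineke_spaces d f) dim_011"
  let ?D = "the_inv_into X (veronese d)"
  have X: "X \<subseteq> proj_points UNIV" by (auto simp: X_def proj_zeros_def)
  have inj: "inj_on (veronese d) X" by (rule inj_on_subset[OF inj_on_veronese[OF d] X])
  have G: "Gvar = sub_kspace ?P (veronese_subrep d ` X)"
    unfolding Gvar_def Gr_var_def X_def Gr_points_reineke_rep[where f = f, OF d f] by simp
  have A: "variety_morphism Xvar Gvar (veronese_subrep d)"
    unfolding G Xvar_def
    by (rule variety_morphism_sub_kspace[OF proj_space_to_Gr_prod[OF inf]]) auto
  have B: "variety_morphism Gvar Yvar (\<lambda>U. U 2)"
    unfolding G Yvar_def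
    by (rule variety_morphism_sub_kspace[OF Gr_prod_to_proj_space]) auto
  have D: "variety_morphism Yvar Xvar ?D"
    unfolding Yvar_def Xvar_def by (rule veronese_inverse_morphism[OF d X])
  have "(\<lambda>U. U 2) \<circ> veronese_subrep d = (veronese d :: ('n \<Rightarrow> 'k) set \<Rightarrow> _)" by auto
  then have C: "variety_morphism Xvar Yvar (veronese d)"
    using variety_morphism_comp[OF A B] by simp
  have DC: "?D (veronese d L) = L" if "L \<in> X" for L by (rule the_inv_into_f_f[OF inj that])
  have topX: "topspace (ktop Xvar) = X"
    using X by (auto simp: Xvar_def topspace_sub_kspace topspace_proj_space)
  have topY: "topspace (ktop Yvar) \<subseteq> veronese d ` X"
    by (auto simp: Yvar_def topspace_sub_kspace)
  have "veronese_subrep d ` X \<subseteq> topspace (ktop Gvar)"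
    using A topX by (auto simp: variety_morphism_iff_local)
  then show topG: "topspace (ktop Gvar) = veronese_subrep d ` X"
    by (auto simp: G topspace_sub_kspace)
  show "variety_iso Gvar Yvar (\<lambda>U. U 2)"
    by (rule variety_isoI(1)[OF B variety_morphism_comp[OF D A]]) (use topY topG DC in auto)
  show "variety_iso Xvar Yvar (veronese d)" "variety_iso Yvar Xvar ?D"
    by (rule variety_isoI[OF C D]; use topX topY DC in auto)+
qed

theorem theorem4p3:
  fixes f h :: "'r::finite \<Rightarrow> ('n::finite, 'k::alg_closed_field) mpoly"
    and d :: nat
    and Q :: "(nat, 'n + 'r) pre_digraph"
    and V W :: "(nat, 'n + 'r, 'k, ('n \<Rightarrow>\<^sub>0 nat) \<Rightarrow> 'k) qrep"
    and X DX :: "('n \<Rightarrow> 'k) set set"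
    and GrE :: "(nat \<Rightarrow> (('n \<Rightarrow>\<^sub>0 nat) \<Rightarrow> 'k) set) set"
    and Xvar :: "(('n \<Rightarrow> 'k) set, 'k) kspace"
    and \<nu>Xvar :: "((('n \<Rightarrow>\<^sub>0 nat) \<Rightarrow> 'k) set, 'k) kspace"
    and GrQ :: "(nat \<Rightarrow> (('n \<Rightarrow>\<^sub>0 nat) \<Rightarrow> 'k) set, 'k) kspace"
  assumes "d \<ge> 1"
    and "\<And>i. f i \<noteq> 0" and "\<And>i. homogeneous UNIV d (f i)"
    and "\<And>j. h j \<noteq> 0" and "\<And>j. homogeneous UNIV d (h j)"
    and "\<And>j. coord_class f (h j) \<noteq> \<zero>\<^bsub>coord_ring f\<^esub>"
  defines "Q \<equiv> reineke_quiver"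
    and "V \<equiv> reineke_rep d f"
    and "W \<equiv> reineke_rep d h"
    and "X \<equiv> proj_zeros f"
    and "DX \<equiv> (\<Union>j. D_plus f (h j))"
    and "GrE \<equiv> Gr_in_points Q (left_perp Q W) (left_perp Q W) dim_011 V"
    and "Xvar \<equiv> sub_kspace (proj_space UNIV) X"
    and "\<nu>Xvar \<equiv> sub_kspace (proj_space (monoms d)) (veronese d ` X)"
    and "GrQ \<equiv> Gr_var Q dim_011 V"
  shows "variety_iso GrQ \<nu>Xvar (\<lambda>U. U 2) \<and>
    variety_iso Xvar \<nu>Xvar (veronese d) \<and>
    V \<in> left_perp Q W \<and>
    openin (ktop GrQ) GrE \<and>
    openin (ktop Xvar) DX \<and>
    variety_iso (sub_kspace GrQ GrE) (sub_kspace Xvar DX)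
      (\<lambda>U. the_inv_into X (veronese d) (U 2))"
proof -
  note iso = reineke_isomorphisms[where f = f, OF infinite_alg_closed_field assms(1,3),
      folded X_def, folded Xvar_def \<nu>Xvar_def Q_def V_def, folded GrQ_def]
  have perp: "V \<in> left_perp Q W"
    unfolding V_def Q_def W_def
    by (rule reineke_rep_in_left_perp[OF assms(1,2,3,5,6)])
  have GrE: "GrE = veronese_subrep d ` DX"
    unfolding GrE_def Q_def V_def W_def DX_def
    by (rule Gr_in_points_reineke_rep[where f = f and h = h, OF assms(1,3,5) perp[unfolded V_def Q_def W_def]])
  have DX_sub: "DX \<subseteq> X" by (auto simp: DX_def X_def D_plus_def)
  have X: "X \<subseteq> proj_points UNIV" by (auto simp: X_def proj_zeros_def)
  have inv: "the_inv_into X (veronese d) (veronese d L) = L" if "L \<in> X" for L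
    using the_inv_into_f_f[OF inj_on_subset[OF inj_on_veronese[OF assms(1)] X] that] .
  have iso_GX: "variety_iso GrQ Xvar (\<lambda>U. the_inv_into X (veronese d) (U 2))"
    using variety_iso_comp[OF iso(1,3)] by (simp add: comp_def)
  have "openin (ktop (proj_space UNIV)) (proj_nonvanishing UNIV (h j))" for j
    unfolding proj_space_def Let_def kspace.simps
    by (rule topology_generated_by_Basis) (use assms(5) in blast)
  then have "openin (ktop (proj_space UNIV)) (\<Union>j. proj_nonvanishing UNIV (h j))"
    by (intro openin_Union) auto
  moreover have "DX = (\<Union>j. proj_nonvanishing UNIV (h j)) \<inter> X"
    by (auto simp: DX_def D_plus_def X_def proj_nonvanishing_def proj_zeros_def)
  ultimately have openDX: "openin (ktop Xvar) DX"
    by (auto simp: Xvar_def sub_kspace_def openin_subtopology)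
  have "GrE = {U \<in> topspace (ktop GrQ). the_inv_into X (veronese d) (U 2) \<in> DX}"
    unfolding iso(4) GrE using DX_sub inv by auto
  moreover have "continuous_map (ktop GrQ) (ktop Xvar) (\<lambda>U. the_inv_into X (veronese d) (U 2))"
    using iso_GX by (simp add: variety_iso_def variety_morphism_def)
  ultimately have openGrE: "openin (ktop GrQ) GrE"
    using openDX by (simp add: continuous_map_def)
  have "(\<lambda>U. the_inv_into X (veronese d) (U 2)) ` GrE = DX"
    unfolding GrE using DX_sub inv by (auto simp: image_image subset_iff)
  then have "variety_iso (sub_kspace GrQ GrE) (sub_kspace Xvar DX)
      (\<lambda>U. the_inv_into X (veronese d) (U 2))"
    by (rule variety_iso_sub_kspace[OF iso_GX _ openin_subset[OF openGrE]])
  with iso(1,2) perp openGrE openDX show ?thesis by blast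
qed

end
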